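(* Let $\mathcal{L}$ be a countable language for continuous logic, let $\mathbf{p}=(p_n)_{n\in\omega}$ be a fixed enumeration of a dense subset of $\mathbb{U}$, and let $k\in\mathbb{N}$. For every Borel grey subset $A$ of $\mathrm{Mod}(\mathcal{L},\mathbb{U})$ and every positive integer $N$ there exists an $N$-Lipschitz $\mathcal{L}_{\omega_1\omega}$-formula $\phi$ with $k$ free variables such that for every $M\in\mathrm{Mod}(\mathcal{L},\mathbb{U})$ and $u\in\mathbb{U}^k$, $$\sup\nolimits^{*}_{g\in\mathrm{Iso}(\mathbb{U})}\big[A(gM)-N\,d(g^{-1}\mathbf{p}_{|k},u)\big]=\phi^M(u).$$
   Context: Continuous logic: a language has function and relation symbols with finite arities and moduli of continuity; metric $\mathcal{L}$-structures are complete metric spaces with uniformly continuous interpretations (relations $[0,1]$-valued). $\mathcal{L}_{\omega_1\omega}$-formulas are built from atomic formulas (symbols and the metric $d$) via continuous connectives $[0,1]^n\to[0,1]$, $\sup_x,\inf_x$, and countable $\inf_n,\sup_n$ of formulas with finitely many free variables in total and uniformly bounded moduli; each formula has a modulus of continuity defined by recursion, and is $N$-Lipschitz if its modulus is bounded by $t\mapsto Nt$; $\phi^M(u)\in[0,1]$ is its value at $u$. $\mathbb{U}$ is the Urysohn sphere, $\mathrm{Iso}(\mathbb{U})$ its isometry group (pointwise convergence), $\mathrm{Mod}(\mathcal{L},\mathbb{U})$ the Polish space of $\mathcal{L}$-structures with support $\mathbb{U}$ with action $f^{gM}(\bar y)=gf^M(g^{-1}\bar y)$, $R^{gM}(\bar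 y)=R^M(g^{-1}\bar y)$. A grey subset is a function to $[0,1]$, Borel if Borel measurable. $\mathbf{p}_{|k}=(p_0,\dots,p_{k-1})$, $g^{-1}$ acts coordinatewise, and $d$ on $\mathbb{U}^k$ is the maximum metric. All arithmetic operations are truncated to $[0,1]$ (e.g. $a-b$ means $\max\{0,\min\{1,a-b\}\}$). Category quantifier: for Polish $X,Y$, open $U\subseteq Y$ and a grey subset $B$ of $X\times Y$, $\sup^*_{y\in U}B$ is the grey subset of $X$ with $(\sup^*_{y\in U}B)(x)>r$ iff $\{y\in U: B(x,y)>r\}$ is nonmeager; similarly $(\inf^*_{y\in U}B)(x)<r$ iff $\{y\in U:B(x,y)<r\}$ is nonmeager. *)

theory Defs
  imports "HOL-Analysis.Analysis"
begin

section \<open>The Urysohn sphere\<close>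

definition isometries :: "('a::metric_space \<Rightarrow> 'a) set" where
  "isometries = {g. surj g \<and> (\<forall>x y. dist (g x) (g y) = dist x y)}"

text \<open>
  The Urysohn sphere is the unique (up to isometry) separable complete metric space of diameter 1
  that is ultrahomogeneous and contains an isometric copy of every separable metric space of
  diameter at most 1. A separable metric space has at most continuum many points, so it suffices
  to let the latter range over metric spaces whose points are real numbers, with an arbitrary
  metric \<open>\<delta>\<close>.
\<close>

class urysohn_sphere = polish_space +
  assumes dist_le_1: "dist x y \<le> 1"
    and ultrahomogeneous: "finite S \<Longrightarrow> (\<And>x y. x \<in> S \<Longrightarrow> y \<in> S \<Longrightarrow> dist (f x) (f y) = dist x y) \<Longrightarrow>
      \<exists>g \<in> isometries. \<forall>x\<in>S. g x = f x"
    and universal: "Metric_space (X :: real set) \<delta> \<Longrightarrow>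
      separable_space (Metric_space.mtopology X \<delta>) \<Longrightarrow>
      (\<And>x y. x \<in> X \<Longrightarrow> y \<in> X \<Longrightarrow> \<delta> x y \<le> 1) \<Longrightarrow>
      \<exists>h. \<forall>x\<in>X. \<forall>y\<in>X. dist (h x) (h y) = \<delta> x y"

text \<open>The product topology on functions is the topology of pointwise convergence.\<close>

definition Iso_topology :: "('a::metric_space \<Rightarrow> 'a) topology" where
  "Iso_topology = top_of_set isometries"

section \<open>Truncated arithmetic and the maximum metric\<close>

definition trunc :: "real \<Rightarrow> real" where
  "trunc x = max 0 (min 1 x)"

definition tminus :: "real \<Rightarrow> real \<Rightarrow> real" (infixl "\<ominus>\<^sub>t" 65) where
  "a \<ominus>\<^sub>t b = trunc (a - b)"

definition ttimes :: "real \<Rightarrow> real \<Rightarrow> real" (infixl "\<otimes>\<^sub>t" 70) where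
  "a \<otimes>\<^sub>t b = trunc (a * b)"

text \<open>Tuples are lists. The inserted \<open>0\<close> matters only for the empty tuple.\<close>

definition max0 :: "real list \<Rightarrow> real" where
  "max0 xs = Max (insert 0 (set xs))"

definition dist_max :: "'a::metric_space list \<Rightarrow> 'a list \<Rightarrow> real" where
  "dist_max xs ys = max0 (map2 dist xs ys)"

section \<open>Languages\<close>

definition is_modulus :: "(real \<Rightarrow> real) \<Rightarrow> bool" where
  "is_modulus \<omega> \<longleftrightarrow> mono_on {0..} \<omega> \<and> \<omega> 0 = 0 \<and> (\<omega> \<longlongrightarrow> 0) (at_right 0)"

record ('f, 'r) language =
  funs :: "'f set"
  rels :: "'r set"
  fun_arity :: "'f \<Rightarrow> nat"
  rel_arity :: "'r \<Rightarrow> nat"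
  fun_modulus :: "'f \<Rightarrow> real \<Rightarrow> real"
  rel_modulus :: "'r \<Rightarrow> real \<Rightarrow> real"

definition is_language :: "('f, 'r) language \<Rightarrow> bool" where
  "is_language L \<longleftrightarrow>
    (\<forall>f\<in>funs L. is_modulus (fun_modulus L f)) \<and> (\<forall>r\<in>rels L. is_modulus (rel_modulus L r))"

definition countable_language :: "('f, 'r) language \<Rightarrow> bool" where
  "countable_language L \<longleftrightarrow> is_language L \<and> countable (funs L) \<and> countable (rels L)"

section \<open>Structures supported on a fixed space\<close>

type_synonym ('f, 'r, 'u) struct = "('f \<Rightarrow> 'u list \<Rightarrow> 'u) \<times> ('r \<Rightarrow> 'u list \<Rightarrow> real)"

text \<open>
  Interpretations are extensional functions on tuples of the correct length, so that the
  coordinates without meaning are constant. The subspace topology from the product type is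
  therefore the topology of pointwise convergence of the interpretations of all symbols.
\<close>

definition Mod :: "('f, 'r) language \<Rightarrow> ('f, 'r, 'u::metric_space) struct set" where
  "Mod L = {(F, R).
     F \<in> (\<Pi>\<^sub>E f\<in>funs L. {xs. length xs = fun_arity L f} \<rightarrow>\<^sub>E UNIV) \<and>
     R \<in> (\<Pi>\<^sub>E r\<in>rels L. {xs. length xs = rel_arity L r} \<rightarrow>\<^sub>E {0..1}) \<and>
     (\<forall>f\<in>funs L. \<forall>xs ys. length xs = fun_arity L f \<longrightarrow> length ys = fun_arity L f \<longrightarrow>
        dist (F f xs) (F f ys) \<le> fun_modulus L f (dist_max xs ys)) \<and>
     (\<forall>r\<in>rels L. \<forall>xs ys. length xs = rel_arity L r \<longrightarrow> length ys = rel_arity L r \<longrightarrow>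
        \<bar>R r xs - R r ys\<bar> \<le> rel_modulus L r (dist_max xs ys))}"

definition act :: "('f, 'r) language \<Rightarrow> ('u \<Rightarrow> 'u) \<Rightarrow> ('f, 'r, 'u) struct \<Rightarrow> ('f, 'r, 'u) struct" where
  "act L g M =
    ((\<lambda>f\<in>funs L. \<lambda>xs\<in>{xs. length xs = fun_arity L f}. g (fst M f (map (inv g) xs))),
     (\<lambda>r\<in>rels L. \<lambda>xs\<in>{xs. length xs = rel_arity L r}. snd M r (map (inv g) xs)))"

definition borel_grey_subset ::
    "('f, 'r) language \<Rightarrow> (('f, 'r, 'u::metric_space) struct \<Rightarrow> real) \<Rightarrow> bool" where
  "borel_grey_subset L A \<longleftrightarrow>
    A \<in> borel_measurable (restrict_space borel (Mod L)) \<and> (\<forall>M\<in>Mod L. A M \<in> {0..1})"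

section \<open>Infinitary formulas\<close>

datatype 'f trm = Var nat | Fn 'f "'f trm list"

text \<open>
  A connective from \<open>[0,1]\<^sup>n\<close> to \<open>[0,1]\<close> takes an extensional function on \<open>{..<n}\<close> as its argument,
  where \<open>n\<close> is the number of formulas it is applied to. \<open>SupV\<close> and \<open>InfV\<close> quantify
  over a variable, \<open>SupN\<close> and \<open>InfN\<close> range over a sequence of formulas.
\<close>

datatype ('f, 'r) fm =
    Rel 'r "'f trm list"
  | Dist "'f trm" "'f trm"
  | Conn "(nat \<Rightarrow> real) \<Rightarrow> real" "('f, 'r) fm list"
  | SupV nat "('f, 'r) fm"
  | InfV nat "('f, 'r) fm"
  | SupN "nat \<Rightarrow> ('f, 'r) fm"
  | InfN "nat \<Rightarrow> ('f, 'r) fm"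

abbreviation cube :: "nat \<Rightarrow> (nat \<Rightarrow> real) set" where
  "cube n \<equiv> {..<n} \<rightarrow>\<^sub>E {0..1}"

definition is_connective :: "nat \<Rightarrow> ((nat \<Rightarrow> real) \<Rightarrow> real) \<Rightarrow> bool" where
  "is_connective n c \<longleftrightarrow> continuous_on (cube n) c \<and> c \<in> cube n \<rightarrow> {0..1}"

primrec fv_trm :: "'f trm \<Rightarrow> nat set" where
  "fv_trm (Var x) = {x}"
| "fv_trm (Fn f ts) = \<Union>(set (map fv_trm ts))"

primrec fv :: "('f, 'r) fm \<Rightarrow> nat set" where
  "fv (Rel r ts) = \<Union>(set (map fv_trm ts))"
| "fv (Dist s t) = fv_trm s \<union> fv_trm t"
| "fv (Conn c \<phi>s) = \<Union>(set (map fv \<phi>s))"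
| "fv (SupV x \<phi>) = fv \<phi> - {x}"
| "fv (InfV x \<phi>) = fv \<phi> - {x}"
| "fv (SupN \<phi>) = (\<Union>n. fv (\<phi> n))"
| "fv (InfN \<phi>) = (\<Union>n. fv (\<phi> n))"

subsection \<open>Moduli of continuity of formulas\<close>

text \<open>
  The recursion tracks how far each variable is moved: if \<open>\<delta> x\<close> bounds the change of the variable
  \<open>x\<close>, for every \<open>x\<close>, then \<open>modulus L \<phi> \<delta>\<close> bounds the change of the value of \<open>\<phi>\<close>. A bound variable
  is not moved. The modulus of continuity of \<open>\<phi>\<close> with respect to the maximum metric on the tuples
  of its free variables is \<open>t \<mapsto> modulus L \<phi> (\<lambda>_. t)\<close>. A connective contributes its optimal modulus
  in each of its arguments separately.
\<close>

definition conn_modulus :: "nat \<Rightarrow> ((nat \<Rightarrow> real) \<Rightarrow> real) \<Rightarrow> (nat \<Rightarrow> real) \<Rightarrow> real" where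
  "conn_modulus n c \<epsilon> =
    Sup {\<bar>c a - c b\<bar> | a b. a \<in> cube n \<and> b \<in> cube n \<and> (\<forall>i<n. \<bar>a i - b i\<bar> \<le> \<epsilon> i)}"

primrec trm_modulus :: "('f, 'r) language \<Rightarrow> 'f trm \<Rightarrow> (nat \<Rightarrow> real) \<Rightarrow> real" where
  "trm_modulus L (Var x) = (\<lambda>\<delta>. \<delta> x)"
| "trm_modulus L (Fn f ts) =
    (\<lambda>\<delta>. fun_modulus L f (max0 (map (\<lambda>t. trm_modulus L t \<delta>) ts)))"

primrec modulus :: "('f, 'r) language \<Rightarrow> ('f, 'r) fm \<Rightarrow> (nat \<Rightarrow> real) \<Rightarrow> real" where
  "modulus L (Rel r ts) = (\<lambda>\<delta>. rel_modulus L r (max0 (map (\<lambda>t. trm_modulus L t \<delta>) ts)))"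
| "modulus L (Dist s t) = (\<lambda>\<delta>. trm_modulus L s \<delta> + trm_modulus L t \<delta>)"
| "modulus L (Conn c \<phi>s) =
    (\<lambda>\<delta>. conn_modulus (length \<phi>s) c (\<lambda>i. (map (modulus L) \<phi>s ! i) \<delta>))"
| "modulus L (SupV x \<phi>) = (\<lambda>\<delta>. modulus L \<phi> (\<delta>(x := 0)))"
| "modulus L (InfV x \<phi>) = (\<lambda>\<delta>. modulus L \<phi> (\<delta>(x := 0)))"
| "modulus L (SupN \<phi>) = (\<lambda>\<delta>. SUP n. modulus L (\<phi> n) \<delta>)"
| "modulus L (InfN \<phi>) = (\<lambda>\<delta>. SUP n. modulus L (\<phi> n) \<delta>)"

definition lipschitz_fm :: "('f, 'r) language \<Rightarrow> real \<Rightarrow> ('f, 'r) fm \<Rightarrow> bool" where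
  "lipschitz_fm L N \<phi> \<longleftrightarrow> (\<forall>t\<ge>0. modulus L \<phi> (\<lambda>_. t) \<le> N * t)"

subsection \<open>Well-formed formulas and their values\<close>

primrec is_trm :: "('f, 'r) language \<Rightarrow> 'f trm \<Rightarrow> bool" where
  "is_trm L (Var x) \<longleftrightarrow> True"
| "is_trm L (Fn f ts) \<longleftrightarrow> f \<in> funs L \<and> length ts = fun_arity L f \<and> list_all (is_trm L) ts"

definition admissible_seq :: "('f, 'r) language \<Rightarrow> (nat \<Rightarrow> ('f, 'r) fm) \<Rightarrow> bool" where
  "admissible_seq L \<phi> \<longleftrightarrow> finite (\<Union>n. fv (\<phi> n)) \<and>
    (\<exists>\<omega>. is_modulus \<omega> \<and> (\<forall>n. \<forall>t\<ge>0. modulus L (\<phi> n) (\<lambda>_. t) \<le> \<omega> t))"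

primrec is_formula :: "('f, 'r) language \<Rightarrow> ('f, 'r) fm \<Rightarrow> bool" where
  "is_formula L (Rel r ts) \<longleftrightarrow>
    r \<in> rels L \<and> length ts = rel_arity L r \<and> list_all (is_trm L) ts"
| "is_formula L (Dist s t) \<longleftrightarrow> is_trm L s \<and> is_trm L t"
| "is_formula L (Conn c \<phi>s) \<longleftrightarrow> is_connective (length \<phi>s) c \<and> list_all (is_formula L) \<phi>s"
| "is_formula L (SupV x \<phi>) \<longleftrightarrow> is_formula L \<phi>"
| "is_formula L (InfV x \<phi>) \<longleftrightarrow> is_formula L \<phi>"
| "is_formula L (SupN \<phi>) \<longleftrightarrow> (\<forall>n. is_formula L (\<phi> n)) \<and> admissible_seq L \<phi>"
| "is_formula L (InfN \<phi>) \<longleftrightarrow> (\<forall>n. is_formula L (\<phi> n)) \<and> admissible_seq L \<phi>"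

primrec trm_value :: "('f, 'r, 'u) struct \<Rightarrow> 'f trm \<Rightarrow> (nat \<Rightarrow> 'u) \<Rightarrow> 'u" where
  "trm_value M (Var x) = (\<lambda>e. e x)"
| "trm_value M (Fn f ts) = (\<lambda>e. fst M f (map (\<lambda>t. trm_value M t e) ts))"

primrec fm_value :: "('f, 'r, 'u::metric_space) struct \<Rightarrow> ('f, 'r) fm \<Rightarrow> (nat \<Rightarrow> 'u) \<Rightarrow> real" where
  "fm_value M (Rel r ts) = (\<lambda>e. snd M r (map (\<lambda>t. trm_value M t e) ts))"
| "fm_value M (Dist s t) = (\<lambda>e. dist (trm_value M s e) (trm_value M t e))"
| "fm_value M (Conn c \<phi>s) = (\<lambda>e. c (\<lambda>i\<in>{..<length \<phi>s}. (map (fm_value M) \<phi>s ! i) e))"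
| "fm_value M (SupV x \<phi>) = (\<lambda>e. SUP a. fm_value M \<phi> (e(x := a)))"
| "fm_value M (InfV x \<phi>) = (\<lambda>e. INF a. fm_value M \<phi> (e(x := a)))"
| "fm_value M (SupN \<phi>) = (\<lambda>e. SUP n. fm_value M (\<phi> n) e)"
| "fm_value M (InfN \<phi>) = (\<lambda>e. INF n. fm_value M (\<phi> n) e)"

text \<open>
  A formula in \<open>k\<close> free variables has its free variables among \<open>0, \<dots>, k - 1\<close>. Its value at a tuple
  \<open>u\<close> of length \<open>k\<close> does not depend on the unspecified entries of \<open>(!) u\<close> from index \<open>k\<close> on.
\<close>

definition value_at :: "('f, 'r, 'u::metric_space) struct \<Rightarrow> ('f, 'r) fm \<Rightarrow> 'u list \<Rightarrow> real" where
  "value_at M \<phi> u = fm_value M \<phi> ((!) u)"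

section \<open>The category quantifier\<close>

definition nowhere_dense_in :: "'a topology \<Rightarrow> 'a set \<Rightarrow> bool" where
  "nowhere_dense_in X T \<longleftrightarrow> T \<subseteq> topspace X \<and> X interior_of (X closure_of T) = {}"

definition meager_in :: "'a topology \<Rightarrow> 'a set \<Rightarrow> bool" where
  "meager_in X S \<longleftrightarrow> (\<exists>T :: nat \<Rightarrow> 'a set. (\<forall>n. nowhere_dense_in X (T n)) \<and> S \<subseteq> (\<Union>n. T n))"

text \<open>
  Only the instance of the quantifier over the whole space is needed. The thresholds are
  nonnegative since grey subsets have values in \<open>[0,1]\<close>.
\<close>

definition sup_star :: "'a topology \<Rightarrow> ('a \<Rightarrow> real) \<Rightarrow> real" where
  "sup_star Y B = (THE s. s \<in> {0..1} \<and>
     (\<forall>r\<ge>0. s > r \<longleftrightarrow> \<not> meager_in Y {y \<in> topspace Y. B y > r}))"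

lemma meager_in_empty: "meager_in X {}"
  unfolding meager_in_def nowhere_dense_in_def by (intro exI[of _ "\<lambda>_. {}"]) simp

lemma meager_in_mono: "meager_in X S \<Longrightarrow> S' \<subseteq> S \<Longrightarrow> meager_in X S'"
  unfolding meager_in_def by blast

lemma meager_in_Union:
  assumes "\<And>n::nat. meager_in X (S n)"
  shows "meager_in X (\<Union>n. S n)"
proof -
  obtain T where T: "\<And>n m::nat. nowhere_dense_in X (T n m)" "\<And>n. S n \<subseteq> (\<Union>m. T n m)"
    using assms unfolding meager_in_def by metis
  show ?thesis
    unfolding meager_in_def
  proof (intro exI[of _ "\<lambda>j. T (fst (prod_decode j)) (snd (prod_decode j))"] conjI allI)
    show "nowhere_dense_in X (T (fst (prod_decode j)) (snd (prod_decode j)))" for j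
      using T(1) .
    show "(\<Union>n. S n) \<subseteq> (\<Union>j. T (fst (prod_decode j)) (snd (prod_decode j)))"
    proof
      fix x assume "x \<in> (\<Union>n. S n)"
      then obtain n m where "x \<in> T n m" using T(2) by blast
      then have "x \<in> T (fst (prod_decode (prod_encode (n, m)))) (snd (prod_decode (prod_encode (n, m))))"
        by simp
      then show "x \<in> (\<Union>j. T (fst (prod_decode j)) (snd (prod_decode j)))" by blast
    qed
  qed
qed

text \<open>The description in \<open>sup_star_def\<close> is proper: it holds of exactly one number.\<close>

lemma sup_star_ex1:
  fixes B :: "'a \<Rightarrow> real"
  assumes B: "\<And>y. y \<in> topspace Y \<Longrightarrow> B y \<in> {0..1}"
  shows "\<exists>!s. s \<in> {0..1} \<and> (\<forall>r\<ge>0. s > r \<longleftrightarrow> \<not> meager_in Y {y \<in> topspace Y. B y > r})"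
proof -
  define W where "W r = {y \<in> topspace Y. B y > r}" for r :: real
  define s where "s = Sup (insert 0 {r. r \<ge> 0 \<and> \<not> meager_in Y (W r)})"
  have le1: "r \<le> 1" if "r \<in> insert 0 {r. r \<ge> 0 \<and> \<not> meager_in Y (W r)}" for r
  proof (rule ccontr)
    assume "\<not> r \<le> 1"
    then have "W r = {}" using B unfolding W_def by fastforce
    then show False using that \<open>\<not> r \<le> 1\<close> meager_in_empty by auto
  qed
  then have bdd: "bdd_above (insert 0 {r. r \<ge> 0 \<and> \<not> meager_in Y (W r)})"
    by (meson bdd_aboveI)
  have "0 \<le> s"
    unfolding s_def by (rule cSup_upper[OF _ bdd]) simp
  moreover have "s \<le> 1"
    unfolding s_def by (rule cSup_least) (use le1 in blast)+
  ultimately have s01: "s \<in> {0..1}" by simp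
  have main: "s > r \<longleftrightarrow> \<not> meager_in Y (W r)" if "r \<ge> 0" for r
  proof
    assume "s > r"
    then obtain q where "q \<in> insert 0 {r. r \<ge> 0 \<and> \<not> meager_in Y (W r)}" "q > r"
      unfolding s_def by (rule less_cSupE) auto
    then have "\<not> meager_in Y (W q)" "W q \<subseteq> W r" using that unfolding W_def by auto
    then show "\<not> meager_in Y (W r)" using meager_in_mono by blast
  next
    assume nm: "\<not> meager_in Y (W r)"
    have "W r \<subseteq> (\<Union>n. W (r + inverse (real (Suc n))))"
    proof
      fix y assume y: "y \<in> W r"
      then obtain n where "inverse (real (Suc n)) < B y - r"
        using reals_Archimedean[of "B y - r"] unfolding W_def by auto
      then show "y \<in> (\<Union>n. W (r + inverse (real (Suc n))))"
        using y unfolding W_def by (intro UN_I[of n]) auto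
    qed
    then obtain n where "\<not> meager_in Y (W (r + inverse (real (Suc n))))"
      using nm meager_in_Union[of Y "\<lambda>n. W (r + inverse (real (Suc n)))"] meager_in_mono by blast
    moreover have pos: "inverse (real (Suc n)) > 0" by simp
    ultimately have "r + inverse (real (Suc n)) \<le> s"
      unfolding s_def using that by (intro cSup_upper[OF _ bdd]) (simp del: of_nat_Suc)
    with pos show "s > r" by linarith
  qed
  show ?thesis
  proof (rule ex1I[of _ s])
    show "s \<in> {0..1} \<and> (\<forall>r\<ge>0. s > r \<longleftrightarrow> \<not> meager_in Y {y \<in> topspace Y. B y > r})"
      using s01 main unfolding W_def by blast
    fix t assume t: "t \<in> {0..1} \<and> (\<forall>r\<ge>0. t > r \<longleftrightarrow> \<not> meager_in Y {y \<in> topspace Y. B y > r})"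
    have "t > r \<longleftrightarrow> s > r" if "r \<ge> 0" for r
      using t main that unfolding W_def by blast
    from this[of s] this[of t] show "t = s"
      using t s01 by auto
  qed
qed

end

theory Submission
  imports Defs
begin

text \<open>
  Call a grey subset \<open>A\<close> definable if its transform
  \<open>sup*\<^sub>g [A(gM) - N d(g\<inverse> p|k, u)]\<close> is the value of an \<open>N\<close>-Lipschitz formula for all \<open>N\<close> and \<open>k\<close>.
  Definable grey subsets are closed under countable suprema because countable unions of meager sets
  are meager. For \<open>q - A\<close>, a nonmeager set of isometries with the Baire property is comeager in a basic
  open set, and such sets are parametrized by the tuples \<open>w\<close> that are isometric to an initial part of
  \<open>p\<close>. Hence the transform is the supremum over \<open>l\<close>, \<open>m\<close> and \<open>w\<close> of
  \<open>q - sup*\<^sub>g [A(gM) - m d(g\<inverse> p|l, w)] - N d(w|k, u)\<close>, where \<open>w\<close> may range over all tuples of length \<open>l\<close>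
  once a multiple of its defect from being isometric to \<open>p|l\<close> is subtracted: in the Urysohn sphere a
  tuple of defect \<open>\<eta>\<close> is within \<open>\<eta>\<close> of an exact copy of \<open>p|l\<close>. Starting from atomic formulas at tuples of
  \<open>p\<close>, this reaches the indicators of all Borel sets.
\<close>

section \<open>Category and the Baire property\<close>

text \<open>The obstacle is the Lipschitz constant. Testing that \<open>A\<close> is small near a
  tuple \<open>w\<close> takes transforms of \<open>A\<close> with arbitrarily large constants
  \<open>m\<close>, yet the complement needs a formula with the prescribed constant
  \<open>N\<close>, so that the supremum over all \<open>m\<close> has a common modulus. This works
  because the \<open>m\<close>-Lipschitz formula contains only the quantified \<open>w\<close>: the
  free variables \<open>u\<close> enter through \<open>N d(w|k, u)\<close> alone. The multiple of
  the defect is \<open>m + N\<close>, since replacing \<open>w\<close> by a copy at distance \<eta>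
  changes the inner transform by at most \<open>m\<close> \<eta> and the penalty by at most
  \<open>N\<close> \<eta>. Moduli of atomic formulas need not have a linear bound; there the infimum
  over all multiples of the defect is taken. The height \<open>q\<close> stays variable because the
  penalty does not scale with the values: a grey subset is assembled from layers, each
  \<open>q\<close> times an indicator, and complements are formed within a layer.\<close>

lemma meager_in_Un:
  assumes "meager_in X S" "meager_in X T"
  shows "meager_in X (S \<union> T)"
proof -
  have "meager_in X (\<Union>n::nat. if n = 0 then S else T)"
    using assms by (intro meager_in_Union) auto
  then show ?thesis
    by (rule meager_in_mono) (auto split: if_splits intro: exI[of _ 0] exI[of _ 1])
qed

lemma meager_in_nowhere_dense: "nowhere_dense_in X T \<Longrightarrow> meager_in X T"
  unfolding meager_in_def by (intro exI[of _ "\<lambda>_. T"]) auto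

definition baire_property_in :: "'a topology \<Rightarrow> 'a set \<Rightarrow> bool" where
  "baire_property_in X S \<longleftrightarrow>
    S \<subseteq> topspace X \<and> (\<exists>G. openin X G \<and> meager_in X ((S - G) \<union> (G - S)))"

lemma baire_property_in_open: "openin X G \<Longrightarrow> baire_property_in X G"
  unfolding baire_property_in_def
  by (auto simp: openin_subset meager_in_empty intro!: exI[of _ G])

text \<open>A nonempty open set inside the closure of \<open>G\<close> meets \<open>G\<close>,
  whereas the frontier of an open set is disjoint from it. As the frontier is closed, empty interior
  is all that is needed.\<close>

lemma nowhere_dense_in_frontier_of_open:
  assumes "openin X G"
  shows "nowhere_dense_in X (X closure_of G - G)"
proof -
  have eq: "X closure_of G - G = X frontier_of G"
    using assms by (simp add: frontier_of_openin)
  have "X interior_of (X frontier_of G) = {}"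
  proof (rule ccontr)
    let ?I = "X interior_of (X frontier_of G)"
    assume "?I \<noteq> {}"
    then obtain x where x: "x \<in> ?I" by blast
    have sub: "?I \<subseteq> X closure_of G - G"
      using interior_of_subset[of X "X frontier_of G"] eq by simp
    then have "x \<in> X closure_of G" using x by blast
    then obtain y where "y \<in> G" "y \<in> ?I"
      using x openin_interior_of[of X "X frontier_of G"] unfolding in_closure_of by blast
    then show False using sub by blast
  qed
  then show ?thesis
    unfolding nowhere_dense_in_def eq
    by (simp add: frontier_of_subset_topspace closure_of_closedin closedin_frontier_of)
qed

lemma baire_property_in_complement:
  assumes "baire_property_in X S"
  shows "baire_property_in X (topspace X - S)"
proof -
  obtain G where G: "openin X G" "meager_in X ((S - G) \<union> (G - S))" and S: "S \<subseteq> topspace X"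
    using assms unfolding baire_property_in_def by blast
  \<comment> \<open>The complement is compared with the exterior of \<open>G\<close>; besides the
    old error this loses only the frontier of \<open>G\<close>, which is nowhere dense.\<close>
  let ?H = "topspace X - X closure_of G" and ?C = "topspace X - S"
  have "G \<subseteq> X closure_of G" using G(1) by (simp add: closure_of_subset openin_subset)
  then have "(?C - ?H) \<union> (?H - ?C) \<subseteq> ((S - G) \<union> (G - S)) \<union> (X closure_of G - G)"
    by auto
  moreover have "meager_in X (((S - G) \<union> (G - S)) \<union> (X closure_of G - G))"
    by (rule meager_in_Un[OF G(2) meager_in_nowhere_dense[OF nowhere_dense_in_frontier_of_open[OF G(1)]]])
  ultimately have "meager_in X ((?C - ?H) \<union> (?H - ?C))" using meager_in_mono by blast
  moreover have "openin X ?H" by (simp add: openin_diff)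
  ultimately show ?thesis unfolding baire_property_in_def by blast
qed

lemma baire_property_in_Union:
  assumes "\<And>n::nat. baire_property_in X (S n)"
  shows "baire_property_in X (\<Union>n. S n)"
proof -
  obtain G where G: "\<And>n. openin X (G n)" "\<And>n. meager_in X ((S n - G n) \<union> (G n - S n))"
    using assms unfolding baire_property_in_def by metis
  have "meager_in X (\<Union>n. (S n - G n) \<union> (G n - S n))"
    using G(2) by (rule meager_in_Union)
  then have "meager_in X (((\<Union>n. S n) - (\<Union>n. G n)) \<union> ((\<Union>n. G n) - (\<Union>n. S n)))"
    by (rule meager_in_mono) blast
  moreover have "openin X (\<Union>n. G n)" using G(1) by blast
  ultimately show ?thesis
    using assms unfolding baire_property_in_def by (meson UN_least)
qed

text \<open>Used to pass from a nonmeager set of isometries to an open set on which its complement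
  may be ignored.\<close>

lemma nonmeager_baire_propertyE:
  assumes "baire_property_in X S" "\<not> meager_in X S"
  obtains G where "openin X G" "G \<noteq> {}" "meager_in X (G - S)"
proof -
  obtain G where G: "openin X G" "meager_in X ((S - G) \<union> (G - S))"
    using assms unfolding baire_property_in_def by blast
  have "G \<noteq> {}" using G(2) assms(2) by auto
  moreover have "meager_in X (G - S)" using G(2) by (rule meager_in_mono) blast
  ultimately show ?thesis using that G(1) by blast
qed

lemma baire_property_in_borel:
  assumes S: "S \<in> sets (restrict_space borel X)"
  shows "baire_property_in (top_of_set X) S"
proof -
  have "baire_property_in (top_of_set X) (X \<inter> T)" if "T \<in> sets borel" for T
  proof -
    have "T \<in> sigma_sets UNIV {S. open S}"
      using that by (simp add: borel_def)
    then show ?thesis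
    proof induction
      case (Basic T)
      then show ?case by (auto intro: baire_property_in_open)
    next
      case Empty
      then show ?case by (simp add: baire_property_in_open)
    next
      case (Compl T)
      have "X \<inter> (UNIV - T) = topspace (top_of_set X) - X \<inter> T" by auto
      then show ?case using baire_property_in_complement[OF Compl.IH] by simp
    next
      case (Union T)
      have "X \<inter> (\<Union>i. T i) = (\<Union>i. X \<inter> T i)" by auto
      then show ?case using baire_property_in_Union[OF Union.IH] by simp
    qed
  qed
  then show ?thesis using S by (auto simp: sets_restrict_space)
qed

lemma completely_metrizable_nonmeager:
  assumes X: "completely_metrizable_space X" and G: "openin X G" "G \<noteq> {}"
  shows "\<not> meager_in X G"
proof
  assume "meager_in X G"
  then obtain T :: "nat \<Rightarrow> _" where T: "\<And>n. nowhere_dense_in X (T n)" "G \<subseteq> (\<Union>n. T n)"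
    unfolding meager_in_def by blast
  let ?G = "range (\<lambda>n. X closure_of T n)"
  have "X interior_of \<Union>?G = {}"
    using T(1) X by (intro Baire_category_alt) (auto simp: nowhere_dense_in_def)
  moreover have "G \<subseteq> \<Union>?G"
  proof -
    have "T n \<subseteq> X closure_of T n" for n
      using T(1) by (simp add: closure_of_subset nowhere_dense_in_def)
    then have "(\<Union>n. T n) \<subseteq> \<Union>?G" by (simp add: SUP_mono')
    then show ?thesis using T(2) by (rule order_trans[rotated])
  qed
  ultimately show False
    using G interior_of_maximal[of G "\<Union>?G" X] by simp
qed

section \<open>The isometry group\<close>

lemma isometries_bij: "g \<in> isometries \<Longrightarrow> bij g"
  unfolding isometries_def bij_def inj_on_def by (auto, metis dist_eq_0_iff)

lemma isometries_dist: "g \<in> isometries \<Longrightarrow> dist (g x) (g y) = dist x y"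
  unfolding isometries_def by blast

lemma isometries_inv_inverse [simp]:
  assumes "g \<in> isometries"
  shows "g (inv g x) = x" "inv g (g x) = x"
  using isometries_bij[OF assms] by (auto simp: bij_is_surj surj_f_inv_f bij_is_inj)

lemma dist_inv_isometry: "g \<in> isometries \<Longrightarrow> dist (inv g x) y = dist x (g y)"
  by (metis isometries_dist isometries_inv_inverse(1))

lemma isometries_inv: "g \<in> isometries \<Longrightarrow> inv g \<in> isometries"
  by (smt (verit, ccfv_SIG) bij_imp_bij_inv bij_is_surj dist_inv_isometry isometries_bij
      isometries_def isometries_inv_inverse(1) mem_Collect_eq)

lemma topspace_Iso [simp]: "topspace Iso_topology = isometries"
  by (simp add: Iso_topology_def)

lemma continuous_on_eval: "continuous_on S (\<lambda>g::'a \<Rightarrow> 'b::topological_space. g x)"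
  by (rule continuous_on_product_then_coordinatewise[where f = "\<lambda>g. g" and i = x, OF continuous_on_id])

lemma continuous_on_fst_apply:
  "continuous_on S (\<lambda>y :: ('i \<Rightarrow> 'b::topological_space) \<times> 'c::topological_space. fst y i)"
  by (rule continuous_on_product_then_coordinatewise, intro continuous_intros)

lemma continuous_on_snd_apply:
  "continuous_on S (\<lambda>y :: 'c::topological_space \<times> ('i \<Rightarrow> 'b::topological_space). snd y i)"
  by (rule continuous_on_product_then_coordinatewise, intro continuous_intros)

text \<open>For \<open>y = inv g x\<close> the distance from \<open>inv h x\<close> to
  \<open>inv g x\<close> equals that from \<open>h y\<close> to \<open>g y\<close>, so convergence
  of \<open>h\<close> to \<open>g\<close> at the single point \<open>y\<close> suffices.\<close>

lemma continuous_on_inv_eval: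
  "continuous_on isometries (\<lambda>g::'a::metric_space \<Rightarrow> 'a. inv g x)"
proof -
  have "((\<lambda>h. inv h x) \<longlongrightarrow> inv g x) (at g within isometries)" if g: "g \<in> isometries" for g :: "'a \<Rightarrow> 'a"
  proof -
    have "((\<lambda>h. dist (h (inv g x)) (g (inv g x))) \<longlongrightarrow> 0) (at g within isometries)"
      using continuous_on_eval[of isometries "inv g x"] g
      unfolding continuous_on_def by (intro iffD1[OF tendsto_dist_iff]) blast
    moreover have "\<forall>\<^sub>F h in at g within isometries. dist (h (inv g x)) (g (inv g x)) = dist (inv h x) (inv g x)"
      unfolding eventually_at_filter
      by (rule always_eventually) (auto simp: g dist_inv_isometry dist_commute)
    ultimately have "((\<lambda>h. dist (inv h x) (inv g x)) \<longlongrightarrow> 0) (at g within isometries)"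
      by (rule Lim_transform_eventually)
    then show "((\<lambda>h. inv h x) \<longlongrightarrow> inv g x) (at g within isometries)"
      by (rule iffD2[OF tendsto_dist_iff])
  qed
  then show ?thesis by (auto simp: continuous_on_def)
qed

section \<open>Extension and continuity from a dense sequence\<close>

lemma dense_range_sequence:
  fixes p :: "nat \<Rightarrow> 'a::metric_space"
  assumes "closure (range p) = UNIV"
  shows "\<exists>s. (\<lambda>n. p (s n)) \<longlonglongrightarrow> x"
proof -
  have "x \<in> closure (range p)" using assms by simp
  then have "\<exists>i. dist (p i) x < inverse (real (Suc n))" for n
    unfolding closure_approachable by (auto elim!: allE[of _ "inverse (real (Suc n))"])
  then obtain s where s: "\<And>n. dist (p (s n)) x < inverse (real (Suc n))" by metis
  have "(\<lambda>n. dist (p (s n)) x) \<longlonglongrightarrow> 0"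
    by (rule tendsto_sandwich[OF _ _ tendsto_const LIMSEQ_inverse_real_of_nat])
      (auto simp del: of_nat_Suc intro!: always_eventually less_imp_le s)
  then have "(\<lambda>n. p (s n)) \<longlonglongrightarrow> x" by (rule iffD2[OF tendsto_dist_iff])
  then show ?thesis by (rule exI[of _ s])
qed

text \<open>Distances are preserved along \<open>p\<close>, so sequences from \<open>p\<close>
  converging to \<open>x\<close> go to Cauchy sequences, and completeness provides the value at
  \<open>x\<close>. The result is only an isometric embedding, which is why the coding of isometries
  below also records the inverse.\<close>

lemma dense_isometry_extension:
  fixes p a :: "nat \<Rightarrow> 'a::complete_space"
  assumes dense: "closure (range p) = UNIV"
    and a: "\<And>i j. dist (a i) (a j) = dist (p i) (p j)"
  obtains g where "\<And>i. g (p i) = a i" "\<And>x y. dist (g x) (g y) = dist x y"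
proof -
  have "\<exists>s. (\<lambda>n. p (s n)) \<longlonglongrightarrow> x" for x
    using dense_range_sequence[OF dense, of x] by (elim exE) (rule exI)
  then obtain s where s: "\<And>x. (\<lambda>n. p (s x n)) \<longlonglongrightarrow> x" by metis
  have "convergent (\<lambda>n. a (s x n))" for x
  proof -
    have "Cauchy (\<lambda>n. p (s x n))" by (rule LIMSEQ_imp_Cauchy[OF s])
    then have "Cauchy (\<lambda>n. a (s x n))" by (simp add: Cauchy_def a)
    then show ?thesis by (rule Cauchy_convergent)
  qed
  then obtain g where g: "\<And>x. (\<lambda>n. a (s x n)) \<longlonglongrightarrow> g x" unfolding convergent_def by metis
  have gd: "dist (g x) (g y) = dist x y" for x y
  proof -
    have "(\<lambda>n. dist (a (s x n)) (a (s y n))) \<longlonglongrightarrow> dist (g x) (g y)"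
      using g by (intro tendsto_intros)
    moreover have "(\<lambda>n. dist (p (s x n)) (p (s y n))) \<longlonglongrightarrow> dist x y"
      using s by (intro tendsto_intros)
    ultimately show ?thesis by (simp add: a LIMSEQ_unique)
  qed
  have "g (p i) = a i" for i
  proof -
    have "(\<lambda>n. dist (a (s (p i) n)) (a i)) \<longlonglongrightarrow> dist (g (p i)) (a i)"
      using g by (intro tendsto_intros)
    moreover have "(\<lambda>n. dist (p (s (p i) n)) (p i)) \<longlonglongrightarrow> dist (p i) (p i)"
      using s by (intro tendsto_intros)
    ultimately have "dist (g (p i)) (a i) = dist (p i) (p i)" unfolding a by (rule LIMSEQ_unique)
    then show ?thesis by simp
  qed
  then show ?thesis using that gd by blast
qed

lemma isometries_eqI:
  assumes dense: "closure (range p) = UNIV"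
    and g: "\<And>x y. dist (g x) (g y) = dist x (y::'a::metric_space)"
    and h: "\<And>x y. dist (h x) (h y) = dist x (y::'a)"
    and eq: "\<And>i. g (p i) = (h (p i) :: 'a)"
  shows "g = h"
proof
  fix x
  have "dist (g x) (h x) < e" if "e > 0" for e
  proof -
    have "x \<in> closure (range p)" using dense by simp
    then obtain i where "dist (p i) x < e/2" using \<open>e > 0\<close> unfolding closure_approachable
      by (metis half_gt_zero rangeE)
    moreover have "dist (g x) (h x) \<le> dist (g x) (g (p i)) + dist (h (p i)) (h x)"
      using dist_triangle[of "g x" "h x" "g (p i)"] eq by simp
    ultimately show ?thesis by (simp add: g h dist_commute)
  qed
  then show "g x = h x" by (metis dist_eq_0_iff less_irrefl zero_less_dist_iff)
qed

text \<open>All maps of the family preserve distances, so the evaluations along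
  \<open>p (s n)\<close> tending to \<open>x\<close> converge uniformly in the parameter.\<close>

lemma continuous_on_dense_eval:
  fixes p :: "nat \<Rightarrow> 'a::metric_space" and G :: "'b::topological_space \<Rightarrow> 'a \<Rightarrow> 'a"
  assumes dense: "closure (range p) = UNIV"
    and G: "\<And>y x x'. y \<in> C \<Longrightarrow> dist (G y x) (G y x') = dist x x'"
    and c: "\<And>i. continuous_on C (\<lambda>y. G y (p i))"
  shows "continuous_on C (\<lambda>y. G y x)"
proof -
  obtain s where s: "(\<lambda>n. p (s n)) \<longlonglongrightarrow> x"
    using dense_range_sequence[OF dense, of x] by (elim exE)
  have "uniform_limit C (\<lambda>n z. G z (p (s n))) (\<lambda>z. G z x) sequentially"
  proof (rule uniform_limitI)
    fix e :: real assume "e > 0"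
    then have "\<forall>\<^sub>F n in sequentially. dist (p (s n)) x < e" using s by (simp add: tendsto_iff)
    then show "\<forall>\<^sub>F n in sequentially. \<forall>z\<in>C. dist (G z (p (s n))) (G z x) < e"
      by eventually_elim (simp add: G)
  qed
  moreover have "continuous_on C (\<lambda>z. G z (p (s n)))" for n
    by (rule c)
  ultimately show ?thesis
    by (intro uniform_limit_theorem[where F = sequentially and f = "\<lambda>n z. G z (p (s n))"]) auto
qed

text \<open>
  An isometry is coded by its values and those of its inverse on a dense sequence. The codes are
  those pairs of sequences that satisfy the closed conditions below, the last of which makes the
  two induced isometric embeddings inverse to each other.
\<close>

lemma completely_metrizable_Iso:
  "completely_metrizable_space (Iso_topology :: ('a::polish_space \<Rightarrow> 'a) topology)"
proof -
  obtain D :: "'a set" where D: "countable D" "\<And>X. open X \<Longrightarrow> X \<noteq> {} \<Longrightarrow> \<exists>d\<in>D. d \<in> X"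
    using countable_dense_exists by blast
  have "D \<noteq> {}" using D(2)[of UNIV] by auto
  define p where "p = from_nat_into D"
  have rp: "range p = D" unfolding p_def using D(1) \<open>D \<noteq> {}\<close> by simp
  have dense: "closure (range p) = UNIV"
  proof (intro set_eqI iffI UNIV_I)
    show "x \<in> closure (range p)" for x
      unfolding rp closure_approachable
    proof (intro allI impI)
      fix e :: real assume "e > 0"
      then obtain d where "d \<in> D" "d \<in> ball x e" using D(2)[of "ball x e"] by auto
      then show "\<exists>y\<in>D. dist y x < e" by (auto simp: dist_commute)
    qed
  qed
  define C :: "((nat \<Rightarrow> 'a) \<times> (nat \<Rightarrow> 'a)) set" where "C = {(a, b).
    (\<forall>i j. dist (a i) (a j) = dist (p i) (p j)) \<and> (\<forall>i j. dist (b i) (b j) = dist (p i) (p j)) \<and>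
    (\<forall>i j. dist (a i) (p j) = dist (p i) (b j))}"
  define F where "F g = ((\<lambda>i. g (p i)), (\<lambda>i. inv g (p i)))" for g :: "'a \<Rightarrow> 'a"
  have "closed C"
    unfolding C_def case_prod_unfold
    by (intro closed_Collect_conj closed_Collect_all closed_Collect_eq continuous_intros
        continuous_on_fst_apply continuous_on_snd_apply)
  have FC: "F g \<in> C" if "g \<in> isometries" for g
  proof -
    have "dist (g (p i)) (p j) = dist (p i) (inv g (p j))" for i j
      using dist_inv_isometry[OF that, of "p j" "p i"] by (simp add: dist_commute)
    then show ?thesis
      unfolding C_def F_def
      by (simp add: isometries_dist[OF that] isometries_dist[OF isometries_inv[OF that]])
  qed
  have ex: "\<exists>g\<in>isometries. F g = y" if y: "y \<in> C" for y
  proof -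
    obtain a b where ab: "y = (a, b)" by fastforce
    have a: "dist (a i) (a j) = dist (p i) (p j)" and b: "dist (b i) (b j) = dist (p i) (p j)"
      and adj: "dist (a i) (p j) = dist (p i) (b j)" for i j
      using y unfolding ab C_def by auto
    obtain g where g: "\<And>i. g (p i) = a i" "\<And>x y. dist (g x) (g y) = dist x y"
      using dense_isometry_extension[OF dense a] by blast
    obtain h where h: "\<And>i. h (p i) = b i" "\<And>x y. dist (h x) (h y) = dist x y"
      using dense_isometry_extension[OF dense b] by blast
    \<comment> \<open>For \<open>x = p i\<close> the identity
      \<open>dist (g x) (p j) = dist x (b j)\<close> is the last condition on codes. Both sides are
      continuous, so it holds everywhere, and \<open>x = b j\<close> gives the claim. It follows
      that \<open>h\<close> is a right inverse of \<open>g\<close>, hence \<open>g\<close> is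
      onto.\<close>
    have gb: "g (b j) = p j" for j
    proof -
      have "dist (g x) (p j) = dist x (b j)" for x
      proof -
        have cg: "continuous_on UNIV g"
          unfolding continuous_on_iff using g(2) by metis
        have "closed {x. dist (g x) (p j) = dist x (b j)}"
          by (intro closed_Collect_eq continuous_intros cg)
        moreover have "range p \<subseteq> {x. dist (g x) (p j) = dist x (b j)}" using adj g(1) by auto
        ultimately show ?thesis using closure_minimal dense by blast
      qed
      from this[of "b j"] show ?thesis by simp
    qed
    have "g \<circ> h = id"
      by (rule isometries_eqI[OF dense]) (auto simp: g h gb)
    then have gh: "g (h x) = x" for x by (metis comp_apply id_apply)
    then have "surj g" by (metis surjI)
    then have gi: "g \<in> isometries" unfolding isometries_def using g(2) by simp
    have "inv g (p i) = b i" for i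
      using gb isometries_inv_inverse(2)[OF gi] by metis
    then have "F g = y" unfolding F_def ab using g(1) by auto
    then show ?thesis using gi by blast
  qed
  define G where "G y = (SOME g. g \<in> isometries \<and> F g = y)" for y
  have G: "G y \<in> isometries" "F (G y) = y" if "y \<in> C" for y
    using someI_ex[of "\<lambda>g. g \<in> isometries \<and> F g = y"] ex[OF that] unfolding G_def by blast+
  have GF: "G (F g) = g" if "g \<in> isometries" for g
  proof (rule isometries_eqI[OF dense])
    show "dist (G (F g) x) (G (F g) y) = dist x y" for x y
      using G FC that isometries_dist by blast
    show "dist (g x) (g y) = dist x y" for x y
      using that isometries_dist by blast
    show "G (F g) (p i) = g (p i)" for i
      using G(2)[OF FC[OF that]] unfolding F_def by (metis prod.inject)
  qed
  have "homeomorphic_maps Iso_topology (top_of_set C) F G"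
    unfolding homeomorphic_maps_def
  proof (intro conjI ballI)
    show "continuous_map Iso_topology (top_of_set C) F"
    proof -
      have "continuous_on isometries F"
        unfolding F_def[abs_def]
        by (intro continuous_on_Pair continuous_on_coordinatewise_then_product
            continuous_on_eval continuous_on_inv_eval)
      then show ?thesis
        unfolding Iso_topology_def using FC by (simp add: Pi_iff)
    qed
    have "continuous_on C (\<lambda>y. G y (p i))" for i
    proof (rule continuous_on_eq[OF continuous_on_fst_apply])
      show "fst y i = G y (p i)" if "y \<in> C" for y using G(2)[OF that] unfolding F_def by (metis fst_conv)
    qed
    then have "continuous_on C (\<lambda>y. G y x)" for x
      by (intro continuous_on_dense_eval[of p C G x, OF dense]) (auto simp: isometries_dist[OF G(1)])
    then show "continuous_map (top_of_set C) Iso_topology G"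
      unfolding Iso_topology_def
      using G(1) continuous_on_coordinatewise_then_product[of C G] by (simp add: Pi_iff)
  qed (auto simp: GF G)
  then have "(Iso_topology :: ('a \<Rightarrow> 'a) topology) homeomorphic_space top_of_set C"
    unfolding homeomorphic_space_def by blast
  moreover have "completely_metrizable_space (top_of_set C)"
    using completely_metrizable_space_closedin[OF completely_metrizable_space_euclidean] \<open>closed C\<close>
    by (metis closed_closedin)
  ultimately show ?thesis
    using homeomorphic_completely_metrizable_space by blast
qed

lemma nonmeager_Iso:
  "openin Iso_topology G \<Longrightarrow> G \<noteq> {} \<Longrightarrow> \<not> meager_in Iso_topology (G :: ('a::polish_space \<Rightarrow> 'a) set)"
  using completely_metrizable_nonmeager completely_metrizable_Iso by blast

section \<open>Finite configurations in the Urysohn sphere\<close>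

text \<open>Universality speaks of genuine metrics on sets of reals. Indices at distance zero are
  therefore merged: each is replaced by the least index at distance zero from it, read as a real
  number.\<close>

lemma finite_pseudometric_embeds:
  fixes \<delta> :: "nat \<Rightarrow> nat \<Rightarrow> real"
  assumes sym: "\<And>i j. i < n \<Longrightarrow> j < n \<Longrightarrow> \<delta> i j = \<delta> j i"
    and refl: "\<And>i. i < n \<Longrightarrow> \<delta> i i = 0"
    and tri: "\<And>i j k. i < n \<Longrightarrow> j < n \<Longrightarrow> k < n \<Longrightarrow> \<delta> i k \<le> \<delta> i j + \<delta> j k"
    and le1: "\<And>i j. i < n \<Longrightarrow> j < n \<Longrightarrow> \<delta> i j \<le> 1"
  obtains h :: "nat \<Rightarrow> 'u::urysohn_sphere" where "\<And>i j. i < n \<Longrightarrow> j < n \<Longrightarrow> dist (h i) (h j) = \<delta> i j"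
proof -
  define rep where "rep i = (LEAST j. \<delta> i j = 0)" for i
  have rep0: "\<delta> i (rep i) = 0" if "i < n" for i
    unfolding rep_def by (rule LeastI[of "\<lambda>j. \<delta> i j = 0" i]) (simp add: refl that)
  have rep_le: "rep i \<le> i" if "i < n" for i
    unfolding rep_def by (rule Least_le) (simp add: refl that)
  have repn: "rep i < n" if "i < n" for i using rep_le[OF that] that by simp
  have nonneg: "0 \<le> \<delta> i j" if "i < n" "j < n" for i j
    using tri[of i j i] sym[of i j] refl[of i] that by simp
  have d0: "\<delta> i k = \<delta> j k" if "\<delta> i j = 0" "i < n" "j < n" "k < n" for i j k
    using tri[of i j k] tri[of j i k] sym[of i j] that by simp
  have rep_eq: "rep i = rep j" if "\<delta> i j = 0" "i < n" "j < n" for i j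
  proof -
    have "\<delta> i (rep j) = 0" using d0[of i j "rep j"] rep0[of j] repn that by simp
    then have "rep i \<le> rep j" unfolding rep_def[of i] by (rule Least_le)
    moreover have "\<delta> j (rep i) = 0" using d0[of i j "rep i"] rep0[of i] repn that by simp
    then have "rep j \<le> rep i" unfolding rep_def[of j] by (rule Least_le)
    ultimately show ?thesis by simp
  qed
  have rep_rep: "rep (rep i) = rep i" if "i < n" for i
    using rep_eq[of i "rep i"] rep0 repn that by simp
  define X where "X = (\<lambda>i. real (rep i)) ` {..<n}"
  \<comment> \<open>\<open>Metric_space\<close> demands nonnegativity and symmetry at all reals, not
    only on \<open>X\<close>; the absolute values and the symmetrisation provide them without
    changing the distances on \<open>X\<close>.\<close>
  define e where "e x y = (\<bar>\<delta> (nat \<lfloor>x\<rfloor>) (nat \<lfloor>y\<rfloor>)\<bar> + \<bar>\<delta> (nat \<lfloor>y\<rfloor>) (nat \<lfloor>x\<rfloor>)\<bar>) / 2" for x y :: real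
  have e_rep: "e (real (rep i)) (real (rep j)) = \<delta> (rep i) (rep j)" if "i < n" "j < n" for i j
    using nonneg[of "rep i" "rep j"] nonneg[of "rep j" "rep i"] sym[of "rep i" "rep j"] repn that
    by (simp add: e_def)
  have M: "Metric_space X e"
  proof
    show "0 \<le> e x y" for x y by (simp add: e_def)
    show "e x y = e y x" for x y by (simp add: e_def)
    show "(e x y = 0) = (x = y)" if xy: "x \<in> X" "y \<in> X" for x y
    proof -
      obtain i j where ij: "x = real (rep i)" "y = real (rep j)" "i < n" "j < n"
        using xy unfolding X_def by auto
      then show ?thesis
        using e_rep[of i j] rep_eq[of "rep i" "rep j"] rep_rep repn refl by auto
    qed
    show "e x z \<le> e x y + e y z" if "x \<in> X" "y \<in> X" "z \<in> X" for x y z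
      using that unfolding X_def by (auto simp: e_rep repn intro!: tri)
  qed
  have "separable_space (Metric_space.mtopology X e)"
  proof -
    have "countable X" unfolding X_def by simp
    then show ?thesis
      unfolding separable_space_def
      using Metric_space.topspace_mtopology[OF M] by (metis closure_of_topspace order_refl)
  qed
  then obtain h :: "real \<Rightarrow> 'u" where h: "\<forall>x\<in>X. \<forall>y\<in>X. dist (h x) (h y) = e x y"
    using universal[OF M] unfolding X_def by (force simp: e_rep repn le1)
  show ?thesis
  proof (rule that)
    fix i j assume ij: "i < n" "j < n"
    then have "dist (h (real (rep i))) (h (real (rep j))) = \<delta> (rep i) (rep j)"
      using h e_rep unfolding X_def by auto
    also have "\<dots> = \<delta> i j"
      using d0[of i "rep i" "rep j"] d0[of j "rep j" i] rep0 repn ij sym by metis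
    finally show "dist (h (real (rep i))) (h (real (rep j))) = \<delta> i j" .
  qed
qed

text \<open>Ultrahomogeneity concerns maps on sets of points, while tuples may repeat entries; a
  repetition in \<open>a\<close> forces one in \<open>b\<close>, because distance zero is
  preserved.\<close>

lemma isometry_between_tuples:
  fixes a b :: "nat \<Rightarrow> 'u::urysohn_sphere"
  assumes "\<And>i j. i < l \<Longrightarrow> j < l \<Longrightarrow> dist (a i) (a j) = dist (b i) (b j)"
  obtains g where "g \<in> isometries" "\<And>i. i < l \<Longrightarrow> g (a i) = b i"
proof -
  define f where "f x = b (SOME i. i < l \<and> a i = x)" for x
  have f: "f (a i) = b i" if "i < l" for i
  proof -
    define j where "j = (SOME j. j < l \<and> a j = a i)"
    have "j < l \<and> a j = a i" unfolding j_def by (rule someI[of _ i]) (simp add: that)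
    then have "dist (b j) (b i) = 0" using assms[of j i] that by simp
    then show ?thesis unfolding f_def j_def by simp
  qed
  have "\<exists>g\<in>isometries. \<forall>x\<in>a ` {..<l}. g x = f x"
    by (rule ultrahomogeneous) (auto simp: f assms)
  then show ?thesis using that f by auto
qed

text \<open>
  The amalgam of two tuples along their indices, with gap \<open>\<eta>\<close>: the distance from \<open>x\<close> to \<open>y\<close>
  in different parts is the least length of a path that changes parts at some index.
\<close>

definition amalgam_cross :: "nat \<Rightarrow> (nat \<Rightarrow> 'a::metric_space) \<Rightarrow> (nat \<Rightarrow> 'a) \<Rightarrow> real \<Rightarrow> 'a \<Rightarrow> 'a \<Rightarrow> real" where
  "amalgam_cross l a b \<eta> x y = min 1 (Min ((\<lambda>k. dist x (a k) + \<eta> + dist (b k) y) ` {..<l}))"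

fun amalgam_dist ::
    "nat \<Rightarrow> (nat \<Rightarrow> 'a::metric_space) \<Rightarrow> (nat \<Rightarrow> 'a) \<Rightarrow> real \<Rightarrow> 'a + 'a \<Rightarrow> 'a + 'a \<Rightarrow> real" where
  "amalgam_dist l a b \<eta> (Inl x) (Inl y) = dist x y"
| "amalgam_dist l a b \<eta> (Inr x) (Inr y) = dist x y"
| "amalgam_dist l a b \<eta> (Inl x) (Inr y) = amalgam_cross l a b \<eta> x y"
| "amalgam_dist l a b \<eta> (Inr y) (Inl x) = amalgam_cross l a b \<eta> x y"

lemma amalgam_cross_le:
  "k < l \<Longrightarrow> amalgam_cross l a b \<eta> x y \<le> dist x (a k) + \<eta> + dist (b k) y"
  unfolding amalgam_cross_def by (rule min.coboundedI2) (auto intro!: Min_le)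

lemma amalgam_cross_cases:
  assumes "l > 0"
  obtains "amalgam_cross l a b \<eta> x y = 1"
    | k where "k < l" "amalgam_cross l a b \<eta> x y = dist x (a k) + \<eta> + dist (b k) y"
proof -
  have "Min ((\<lambda>k. dist x (a k) + \<eta> + dist (b k) y) ` {..<l}) \<in> (\<lambda>k. dist x (a k) + \<eta> + dist (b k) y) ` {..<l}"
    using assms by (intro Min_in) auto
  then obtain k where k: "k < l"
    "Min ((\<lambda>k. dist x (a k) + \<eta> + dist (b k) y) ` {..<l}) = dist x (a k) + \<eta> + dist (b k) y"
    by auto
  show ?thesis
  proof (cases "1 \<le> dist x (a k) + \<eta> + dist (b k) y")
    case True
    then show ?thesis using k by (intro that(1)) (simp add: amalgam_cross_def)
  next
    case False
    then show ?thesis using k by (intro that(2)[of k]) (simp_all add: amalgam_cross_def)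
  qed
qed

lemma amalgam_cross_nonneg:
  assumes "l > 0" "\<eta> \<ge> 0"
  shows "0 \<le> amalgam_cross l a b \<eta> x y"
  using assms by (cases rule: amalgam_cross_cases[of l a b \<eta> x y]) auto

lemma amalgam_cross_le_1: "amalgam_cross l a b \<eta> x y \<le> 1"
  by (simp add: amalgam_cross_def)

text \<open>Only paths that leave a part and return to it use the hypothesis on \<open>a\<close> and
  \<open>b\<close>. They cross the gap twice, at cost \<open>2 * \<eta>\<close>, while exchanging
  one tuple for the other changes a distance between entries by at most \<eta>. Truncation at 1 is
  harmless because distances in the sphere are at most 1.\<close>

lemma amalgam_dist_triangle:
  fixes a b :: "nat \<Rightarrow> 'u::urysohn_sphere"
  assumes l: "l > 0" and \<eta>: "\<eta> \<ge> 0"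
    and ab: "\<And>i j. i < l \<Longrightarrow> j < l \<Longrightarrow> \<bar>dist (a i) (a j) - dist (b i) (b j)\<bar> \<le> \<eta>"
  shows "amalgam_dist l a b \<eta> x z \<le> amalgam_dist l a b \<eta> x y + amalgam_dist l a b \<eta> y z"
proof -
  let ?c = "amalgam_cross l a b \<eta>"
  have LLR: "?c x z \<le> dist x y + ?c y z" for x y z
  proof (cases rule: amalgam_cross_cases[OF l, of a b \<eta> y z])
    case 1 then show ?thesis using amalgam_cross_le_1[of l a b \<eta> x z] by (smt (verit) zero_le_dist)
  next
    case (2 k) then show ?thesis
      using amalgam_cross_le[of k l a b \<eta> x z] dist_triangle[of x "a k" y] by simp
  qed
  have RRL: "?c x z \<le> ?c x y + dist y z" for x y z
  proof (cases rule: amalgam_cross_cases[OF l, of a b \<eta> x y])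
    case 1 then show ?thesis using amalgam_cross_le_1[of l a b \<eta> x z] by (smt (verit) zero_le_dist)
  next
    case (2 k) then show ?thesis
      using amalgam_cross_le[of k l a b \<eta> x z] dist_triangle[of "b k" z y] by simp
  qed
  have LRL: "dist x z \<le> ?c x y + ?c z y" for x y z
  proof (cases rule: amalgam_cross_cases[OF l, of a b \<eta> x y])
    case 1 then show ?thesis
      using dist_le_1[of x z] amalgam_cross_nonneg[OF l \<eta>, of a b z y] by simp
  next
    case i: (2 i)
    show ?thesis
    proof (cases rule: amalgam_cross_cases[OF l, of a b \<eta> z y])
      case 1 then show ?thesis
        using dist_le_1[of x z] amalgam_cross_nonneg[OF l \<eta>, of a b x y] by simp
    next
      case j: (2 j)
      have "dist x z \<le> dist x (a i) + dist (a i) (a j) + dist z (a j)"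
        using dist_triangle[of x z "a i"] dist_triangle[of "a i" z "a j"] by (simp add: dist_commute)
      moreover have "dist (b i) (b j) \<le> dist (b i) y + dist (b j) y"
        by (rule dist_triangle2)
      ultimately show ?thesis using i j ab[of i j] \<eta> by (simp add: abs_le_iff)
    qed
  qed
  have RLR: "dist x z \<le> ?c y x + ?c y z" for x y z
  proof (cases rule: amalgam_cross_cases[OF l, of a b \<eta> y x])
    case 1 then show ?thesis
      using dist_le_1[of x z] amalgam_cross_nonneg[OF l \<eta>, of a b y z] by simp
  next
    case i: (2 i)
    show ?thesis
    proof (cases rule: amalgam_cross_cases[OF l, of a b \<eta> y z])
      case 1 then show ?thesis
        using dist_le_1[of x z] amalgam_cross_nonneg[OF l \<eta>, of a b y x] by simp
    next
      case j: (2 j)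
      have "dist x z \<le> dist (b i) x + dist (b i) (b j) + dist (b j) z"
        using dist_triangle[of x z "b i"] dist_triangle[of "b i" z "b j"] by (simp add: dist_commute)
      moreover have "dist (a i) (a j) \<le> dist y (a i) + dist y (a j)"
        by (rule dist_triangle3)
      ultimately show ?thesis using i j ab[of i j] \<eta> by (simp add: abs_le_iff)
    qed
  qed
  have RLL: "?c z x \<le> ?c y x + dist y z" and RRL': "?c z x \<le> dist x y + ?c z y" for x y z
    using LLR[of z x y] RRL[of z x y] by (simp_all add: dist_commute)
  show ?thesis
    by (cases x; cases y; cases z) (simp_all add: LLR RRL LRL RLR RLL RRL' dist_triangle)
qed

text \<open>The \<open>2 * l\<close> entries of both tuples embed in the sphere with the amalgam
  distance, where corresponding entries are at most \<eta> apart. Ultrahomogeneity moves the first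
  half onto \<open>a\<close>; the second half is carried to the required copy of
  \<open>b\<close>.\<close>

lemma nearby_isometric_copy:
  fixes a b :: "nat \<Rightarrow> 'u::urysohn_sphere"
  assumes ab: "\<And>i j. i < l \<Longrightarrow> j < l \<Longrightarrow> \<bar>dist (a i) (a j) - dist (b i) (b j)\<bar> \<le> \<eta>"
  obtains c where "\<And>i j. i < l \<Longrightarrow> j < l \<Longrightarrow> dist (c i) (c j) = dist (b i) (b j)"
    "\<And>i. i < l \<Longrightarrow> dist (a i) (c i) \<le> \<eta>"
proof (cases "l = 0")
  case True then show ?thesis using that by auto
next
  case False
  then have l: "l > 0" by simp
  then have \<eta>: "\<eta> \<ge> 0" using ab[of 0 0] by simp
  define z where "z i = (if i < l then Inl (a i) else Inr (b (i - l)))" for i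
  \<comment> \<open>Index \<open>i < l\<close> stands for \<open>a i\<close> and
    \<open>l + i\<close> for \<open>b i\<close>. Repeated entries, or \<open>\<eta> = 0\<close>,
    make this a pseudometric only.\<close>
  define \<delta> where "\<delta> i j = amalgam_dist l a b \<eta> (z i) (z j)" for i j
  have sym: "amalgam_dist l a b \<eta> x y = amalgam_dist l a b \<eta> y x" for x y
    by (cases x; cases y) (auto simp: dist_commute)
  have le1: "amalgam_dist l a b \<eta> x y \<le> 1" for x y
    by (cases x; cases y) (auto simp: dist_le_1 amalgam_cross_le_1)
  have refl: "amalgam_dist l a b \<eta> x x = 0" for x
    by (cases x) auto
  obtain h :: "nat \<Rightarrow> 'u" where h: "\<And>i j. i < 2*l \<Longrightarrow> j < 2*l \<Longrightarrow> dist (h i) (h j) = \<delta> i j"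
    by (rule finite_pseudometric_embeds[of "2*l" \<delta>])
      (auto simp: \<delta>_def sym le1 refl intro: amalgam_dist_triangle[OF l \<eta> ab] simp del: amalgam_dist.simps)
  obtain g where g: "g \<in> isometries" "\<And>i. i < l \<Longrightarrow> g (h i) = a i"
    by (rule isometry_between_tuples[of l h a]) (auto simp: h \<delta>_def z_def)
  show ?thesis
  proof (rule that[of "\<lambda>i. g (h (l + i))"])
    show "dist (g (h (l + i))) (g (h (l + j))) = dist (b i) (b j)" if "i < l" "j < l" for i j
      using that by (simp add: isometries_dist[OF g(1)] h \<delta>_def z_def)
    show "dist (a i) (g (h (l + i))) \<le> \<eta>" if "i < l" for i
    proof -
      have "dist (g (h i)) (g (h (l + i))) = amalgam_cross l a b \<eta> (a i) (b i)"
        using that by (simp add: isometries_dist[OF g(1)] h \<delta>_def z_def)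
      then show ?thesis using g(2)[OF that] amalgam_cross_le[OF that, of a b \<eta> "a i" "b i"] by simp
    qed
  qed
qed

section \<open>Formulas and their moduli\<close>

lemma max0_Nil [simp]: "max0 [] = 0"
  and max0_Cons [simp]: "max0 (x # xs) = max x (max0 xs)"
proof -
  show "max0 [] = 0" by (simp add: max0_def)
  have "max0 (x # xs) = Max (insert x (insert 0 (set xs)))"
    by (simp add: max0_def insert_commute)
  also have "\<dots> = max x (max0 xs)" by (subst Max_insert) (auto simp: max0_def)
  finally show "max0 (x # xs) = max x (max0 xs)" .
qed

lemma max0_nonneg: "0 \<le> max0 xs"
  by (induction xs) auto

lemma max0_le_iff: "0 \<le> c \<Longrightarrow> max0 xs \<le> c \<longleftrightarrow> (\<forall>x\<in>set xs. x \<le> c)"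
  by (induction xs) auto

lemma max0_less_iff: "0 < c \<Longrightarrow> max0 xs < c \<longleftrightarrow> (\<forall>x\<in>set xs. x < c)"
  by (induction xs) auto

lemma max0_upper: "x \<in> set xs \<Longrightarrow> x \<le> max0 xs"
  using max0_le_iff[OF max0_nonneg[of xs], of xs] by simp

lemma max0_map_diff:
  assumes "0 \<le> e" "\<And>x. x \<in> set xs \<Longrightarrow> \<bar>f x - g x\<bar> \<le> e"
  shows "\<bar>max0 (map f xs) - max0 (map g xs)\<bar> \<le> e"
  using assms(2)
proof (induction xs)
  case (Cons x xs)
  then have "\<bar>max0 (map f xs) - max0 (map g xs)\<bar> \<le> e" "\<bar>f x - g x\<bar> \<le> e" by auto
  then show ?case by (auto simp: max_def)
qed (simp add: assms(1))

lemma max0_zero: "(\<And>x. x \<in> set xs \<Longrightarrow> x = 0) \<Longrightarrow> max0 xs = 0"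
  using max0_le_iff[of 0 xs] max0_nonneg[of xs] by fastforce

lemma continuous_on_max0:
  "(\<And>x. x \<in> set xs \<Longrightarrow> continuous_on S (f x)) \<Longrightarrow> continuous_on S (\<lambda>a. max0 (map (\<lambda>x. f x a) xs))"
  by (induction xs) (auto intro!: continuous_on_max)

lemma trunc_range: "0 \<le> trunc x" "trunc x \<le> 1"
  by (auto simp: trunc_def)

lemma trunc_greater_iff: "0 \<le> r \<Longrightarrow> x \<le> 1 \<Longrightarrow> trunc x > r \<longleftrightarrow> x > r"
  by (auto simp: trunc_def)

lemma trunc_diff: "\<bar>trunc x - trunc y\<bar> \<le> \<bar>x - y\<bar>"
  by (auto simp: trunc_def)

lemma continuous_on_trunc [continuous_intros]:
  "continuous_on S f \<Longrightarrow> continuous_on S (\<lambda>x. trunc (f x))"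
  unfolding trunc_def by (intro continuous_intros)

lemma cube_nonempty: "(\<lambda>i\<in>{..<n}. 0) \<in> cube n"
  by simp

lemma conn_modulus_cong:
  "(\<And>i. i < n \<Longrightarrow> \<epsilon> i = \<epsilon>' i) \<Longrightarrow> conn_modulus n c \<epsilon> = conn_modulus n c \<epsilon>'"
  by (simp add: conn_modulus_def)

text \<open>Nonnegative tolerances admit \<open>a = b\<close>, so the set under \<open>Sup\<close>
  is nonempty and a bound on its members bounds the supremum.\<close>

lemma conn_modulus_le:
  assumes "\<And>i. i < n \<Longrightarrow> 0 \<le> \<epsilon> i"
    and "\<And>a b. a \<in> cube n \<Longrightarrow> b \<in> cube n \<Longrightarrow> (\<And>i. i < n \<Longrightarrow> \<bar>a i - b i\<bar> \<le> \<epsilon> i) \<Longrightarrow> \<bar>c a - c b\<bar> \<le> B"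
  shows "conn_modulus n c \<epsilon> \<le> B"
  unfolding conn_modulus_def
proof (rule cSup_least)
  let ?z = "\<lambda>i\<in>{..<n}. 0 :: real"
  have "?z \<in> cube n \<and> ?z \<in> cube n \<and> (\<forall>i<n. \<bar>?z i - ?z i\<bar> \<le> \<epsilon> i)"
    using cube_nonempty[of n] assms(1) by simp
  then have "\<bar>c ?z - c ?z\<bar> \<in>
      {\<bar>c a - c b\<bar> |a b. a \<in> cube n \<and> b \<in> cube n \<and> (\<forall>i<n. \<bar>a i - b i\<bar> \<le> \<epsilon> i)}"
    by (intro CollectI exI[of _ ?z] conjI refl) simp_all
  then show "{\<bar>c a - c b\<bar> |a b. a \<in> cube n \<and> b \<in> cube n \<and> (\<forall>i<n. \<bar>a i - b i\<bar> \<le> \<epsilon> i)} \<noteq> {}"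
    by (metis empty_iff)
next
  fix x assume "x \<in> {\<bar>c a - c b\<bar> |a b. a \<in> cube n \<and> b \<in> cube n \<and> (\<forall>i<n. \<bar>a i - b i\<bar> \<le> \<epsilon> i)}"
  then show "x \<le> B" by (elim CollectE exE conjE) (simp add: assms(2))
qed

lemma conn_modulus_zero: "conn_modulus n c (\<lambda>_. 0) = 0"
proof -
  have "{\<bar>c a - c b\<bar> |a b. a \<in> cube n \<and> b \<in> cube n \<and> (\<forall>i<n. \<bar>a i - b i\<bar> \<le> 0)} = {0}"
  proof (intro set_eqI iffI)
    fix x assume "x \<in> {\<bar>c a - c b\<bar> |a b. a \<in> cube n \<and> b \<in> cube n \<and> (\<forall>i<n. \<bar>a i - b i\<bar> \<le> 0)}"
    then obtain a b where ab: "x = \<bar>c a - c b\<bar>" "a \<in> cube n" "b \<in> cube n" "\<forall>i<n. \<bar>a i - b i\<bar> \<le> 0"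
      by (elim CollectE exE conjE)
    then have "a = b" by (intro PiE_ext[of a "{..<n}" _ b]) auto
    then show "x \<in> {0}" using ab by simp
  next
    fix x :: real assume "x \<in> {0}"
    then show "x \<in> {\<bar>c a - c b\<bar> |a b. a \<in> cube n \<and> b \<in> cube n \<and> (\<forall>i<n. \<bar>a i - b i\<bar> \<le> 0)}"
      using cube_nonempty[of n]
      by (intro CollectI exI[of _ "\<lambda>i\<in>{..<n}. 0"] conjI) simp_all
  qed
  then show ?thesis by (simp add: conn_modulus_def)
qed

lemma trm_modulus_cong:
  "(\<And>x. x \<in> fv_trm t \<Longrightarrow> \<delta> x = \<delta>' x) \<Longrightarrow> trm_modulus L t \<delta> = trm_modulus L t \<delta>'"
proof (induction t)
  case (Fn f ts)
  then have "map (\<lambda>t. trm_modulus L t \<delta>) ts = map (\<lambda>t. trm_modulus L t \<delta>') ts"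
    by (intro map_cong) auto
  then show ?case by (simp only: trm_modulus.simps)
qed simp

lemma modulus_cong:
  "(\<And>x. x \<in> fv \<phi> \<Longrightarrow> \<delta> x = \<delta>' x) \<Longrightarrow> modulus L \<phi> \<delta> = modulus L \<phi> \<delta>'"
proof (induction \<phi> arbitrary: \<delta> \<delta>')
  case (Rel r ts)
  then have "map (\<lambda>t. trm_modulus L t \<delta>) ts = map (\<lambda>t. trm_modulus L t \<delta>') ts"
    by (intro map_cong trm_modulus_cong) auto
  then show ?case by (simp only: modulus.simps)
next
  case (Dist s t)
  then have "trm_modulus L s \<delta> = trm_modulus L s \<delta>'" "trm_modulus L t \<delta> = trm_modulus L t \<delta>'"
    by (auto intro!: trm_modulus_cong)
  then show ?case by simp
next
  case (Conn c \<phi>s)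
  have "(map (modulus L) \<phi>s ! i) \<delta> = (map (modulus L) \<phi>s ! i) \<delta>'" if "i < length \<phi>s" for i
  proof -
    have mem: "\<phi>s ! i \<in> set \<phi>s" using that by simp
    have "\<delta> x = \<delta>' x" if "x \<in> fv (\<phi>s ! i)" for x
      using that mem by (intro Conn.prems) auto
    then have "modulus L (\<phi>s ! i) \<delta> = modulus L (\<phi>s ! i) \<delta>'"
      by (rule Conn.IH[OF mem])
    then show ?thesis using that by simp
  qed
  then show ?case unfolding modulus.simps by (rule conn_modulus_cong)
next
  case (SupV x \<phi>)
  show ?case unfolding modulus.simps by (rule SupV.IH) (use SupV.prems in auto)
next
  case (InfV x \<phi>)
  show ?case unfolding modulus.simps by (rule InfV.IH) (use InfV.prems in auto)
next
  case (SupN \<phi>)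
  have "modulus L (\<phi> n) \<delta> = modulus L (\<phi> n) \<delta>'" for n
    by (rule SupN.IH) (use SupN.prems in auto)
  then show ?case by simp
next
  case (InfN \<phi>)
  have "modulus L (\<phi> n) \<delta> = modulus L (\<phi> n) \<delta>'" for n
    by (rule InfN.IH) (use InfN.prems in auto)
  then show ?case by simp
qed

lemma trm_modulus_zero:
  assumes L: "is_language L" and t: "is_trm L t"
  shows "trm_modulus L t (\<lambda>_. 0) = 0"
  using t
proof (induction t)
  case (Fn f ts)
  then have "max0 (map (\<lambda>t. trm_modulus L t (\<lambda>_. 0)) ts) = 0"
    by (intro max0_zero) (auto simp: list_all_iff)
  then show ?case using L Fn.prems by (simp add: is_language_def is_modulus_def)
qed simp

lemma modulus_zero:
  assumes L: "is_language L" and \<phi>: "is_formula L \<phi>"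
  shows "modulus L \<phi> (\<lambda>_. 0) = 0"
  using \<phi>
proof (induction \<phi>)
  case (Rel r ts)
  then have "max0 (map (\<lambda>t. trm_modulus L t (\<lambda>_. 0)) ts) = 0"
    by (intro max0_zero) (auto simp: list_all_iff trm_modulus_zero[OF L])
  then show ?case using L Rel.prems by (simp add: is_language_def is_modulus_def)
next
  case (Conn c \<phi>s)
  have "conn_modulus (length \<phi>s) c (\<lambda>i. (map (modulus L) \<phi>s ! i) (\<lambda>_. 0)) =
      conn_modulus (length \<phi>s) c (\<lambda>_. 0)"
    using Conn by (intro conn_modulus_cong) (simp add: list_all_iff)
  then show ?case by (simp add: conn_modulus_zero)
next
  case (SupV x \<phi>)
  have "(\<lambda>_. 0 :: real)(x := 0) = (\<lambda>_. 0)" by (rule ext) simp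
  then show ?case using SupV by simp
next
  case (InfV x \<phi>)
  have "(\<lambda>_. 0 :: real)(x := 0) = (\<lambda>_. 0)" by (rule ext) simp
  then show ?case using InfV by simp
qed (use L in \<open>simp_all add: trm_modulus_zero\<close>)

text \<open>The reason why inner formulas with large Lipschitz constants are harmless: when all
  their free variables are quantified, the recursion evaluates their moduli at increments that
  vanish on these variables.\<close>

lemma modulus_eq_0:
  assumes "is_language L" "is_formula L \<phi>" "\<And>x. x \<in> fv \<phi> \<Longrightarrow> \<delta> x = 0"
  shows "modulus L \<phi> \<delta> = 0"
  using modulus_cong[of \<phi> \<delta> "\<lambda>_. 0" L] modulus_zero[OF assms(1,2)] assms(3) by simp

subsection \<open>Quantification over tuples\<close>

fun sup_vars :: "nat list \<Rightarrow> ('f, 'r) fm \<Rightarrow> ('f, 'r) fm" where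
  "sup_vars [] \<phi> = \<phi>"
| "sup_vars (x # xs) \<phi> = SupV x (sup_vars xs \<phi>)"

lemma is_formula_sup_vars [simp]: "is_formula L (sup_vars xs \<phi>) = is_formula L \<phi>"
  by (induction xs) auto

lemma fv_sup_vars [simp]: "fv (sup_vars xs \<phi>) = fv \<phi> - set xs"
  by (induction xs) auto

lemma modulus_sup_vars:
  "modulus L (sup_vars xs \<phi>) \<delta> = modulus L \<phi> (\<lambda>x. if x \<in> set xs then 0 else \<delta> x)"
proof (induction xs arbitrary: \<delta>)
  case (Cons y xs)
  have "(\<lambda>x. if x \<in> set xs then 0 else (\<delta>(y := 0)) x) = (\<lambda>x. if x \<in> set (y # xs) then 0 else \<delta> x)"
    by auto
  then show ?case using Cons.IH by simp
qed simp

text \<open>Values are compared through strict lower bounds, which turn suprema into existential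
  statements and are also what defines the category quantifier. The bounds 0 and 1 make
  \<open>SUP\<close> a genuine supremum.\<close>

lemma fm_value_SupV_greater:
  assumes "\<And>e. fm_value M \<phi> e \<in> {0..1}"
  shows "fm_value M (SupV x \<phi>) e \<in> {0..1}"
    and "r < fm_value M (SupV x \<phi>) e \<longleftrightarrow> (\<exists>a. r < fm_value M \<phi> (e(x := a)))"
proof -
  have bdd: "bdd_above (range (\<lambda>a. fm_value M \<phi> (e(x := a))))"
    using assms by (intro bdd_aboveI[of _ 1]) auto
  have "fm_value M \<phi> (e(x := a)) \<le> (SUP a. fm_value M \<phi> (e(x := a)))" for a
    by (rule cSUP_upper[OF UNIV_I bdd])
  moreover have "(SUP a. fm_value M \<phi> (e(x := a))) \<le> 1"
    using assms by (intro cSUP_least) auto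
  ultimately show "fm_value M (SupV x \<phi>) e \<in> {0..1}"
    using assms[of "e(x := undefined)"] by (auto intro: order_trans)
  show "r < fm_value M (SupV x \<phi>) e \<longleftrightarrow> (\<exists>a. r < fm_value M \<phi> (e(x := a)))"
    using less_cSUP_iff[OF _ bdd] by simp
qed

lemma fm_value_sup_vars:
  assumes "\<And>e. fm_value M \<phi> e \<in> {0..1}"
  shows "fm_value M (sup_vars xs \<phi>) e \<in> {0..1}"
    and "r < fm_value M (sup_vars xs \<phi>) e \<longleftrightarrow>
      (\<exists>e'. (\<forall>x. x \<notin> set xs \<longrightarrow> e' x = e x) \<and> r < fm_value M \<phi> e')"
proof (induction xs arbitrary: e)
  case Nil
  { case 1 then show ?case using assms by simp }
  { case 2
    have "e' = e" if "\<forall>x. x \<notin> set [] \<longrightarrow> e' x = e x" for e'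
      using that by auto
    then show ?case by (metis sup_vars.simps(1)) }
next
  case (Cons y xs)
  note bd = Cons(1)
  { case 1 then show ?case using fm_value_SupV_greater(1)[OF bd] by simp }
  { case 2
    have "r < fm_value M (sup_vars (y # xs) \<phi>) e \<longleftrightarrow>
      (\<exists>a e'. (\<forall>x. x \<notin> set xs \<longrightarrow> e' x = (e(y := a)) x) \<and> r < fm_value M \<phi> e')"
      unfolding sup_vars.simps fm_value_SupV_greater(2)[OF bd] Cons(2) ..
    also have "\<dots> \<longleftrightarrow> (\<exists>e'. (\<forall>x. x \<notin> set (y # xs) \<longrightarrow> e' x = e x) \<and> r < fm_value M \<phi> e')"
    proof
      assume "\<exists>a e'. (\<forall>x. x \<notin> set xs \<longrightarrow> e' x = (e(y := a)) x) \<and> r < fm_value M \<phi> e'"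
      then obtain a e' where "\<forall>x. x \<notin> set xs \<longrightarrow> e' x = (e(y := a)) x" "r < fm_value M \<phi> e'" by blast
      then show "\<exists>e'. (\<forall>x. x \<notin> set (y # xs) \<longrightarrow> e' x = e x) \<and> r < fm_value M \<phi> e'"
        by (intro exI[of _ e']) auto
    next
      assume "\<exists>e'. (\<forall>x. x \<notin> set (y # xs) \<longrightarrow> e' x = e x) \<and> r < fm_value M \<phi> e'"
      then obtain e' where "\<forall>x. x \<notin> set (y # xs) \<longrightarrow> e' x = e x" "r < fm_value M \<phi> e'" by blast
      then show "\<exists>a e'. (\<forall>x. x \<notin> set xs \<longrightarrow> e' x = (e(y := a)) x) \<and> r < fm_value M \<phi> e'"
        by (intro exI[of _ "e' y"] exI[of _ e']) auto
    qed
    finally show ?case . }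
qed

section \<open>Penalised suprema over tuples\<close>

definition tuple_dist :: "nat \<Rightarrow> (nat \<Rightarrow> 'a::metric_space) \<Rightarrow> (nat \<Rightarrow> 'a) \<Rightarrow> real" where
  "tuple_dist k a b = max0 (map (\<lambda>i. dist (a i) (b i)) [0..<k])"

text \<open>It vanishes exactly when the first \<open>l\<close> entries of \<open>w\<close> are
  isometric to those of \<open>p\<close>. Being computed from distances, it can occur inside a
  formula, unlike the condition that it vanishes.\<close>

definition defect :: "nat \<Rightarrow> (nat \<Rightarrow> 'a::metric_space) \<Rightarrow> (nat \<Rightarrow> 'a) \<Rightarrow> real" where
  "defect l p w = max0 (map (\<lambda>(i, j). \<bar>dist (w i) (w j) - dist (p i) (p j)\<bar>) (List.product [0..<l] [0..<l]))"

text \<open>Coordinate 0 carries the inner formula, the next \<open>k\<close> the distances between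
  \<open>w\<close> and \<open>u\<close>, and the last \<open>l * l\<close> the distances within
  \<open>w\<close>. The distances of \<open>p\<close> are real constants of the connective, so
  formulas need no names for points of \<open>p\<close>. The function \<theta> is
  \<open>q - x\<close> for complements and a ramp for atomic formulas.\<close>

definition penalty_connective ::
    "(nat \<Rightarrow> 'a::metric_space) \<Rightarrow> (real \<Rightarrow> real) \<Rightarrow> nat \<Rightarrow> nat \<Rightarrow> real \<Rightarrow> real \<Rightarrow> (nat \<Rightarrow> real) \<Rightarrow> real" where
  "penalty_connective p \<theta> k l N K a = trunc (\<theta> (a 0)
    - N * max0 (map (\<lambda>i. a (Suc i)) [0..<k])
    - K * max0 (map (\<lambda>n. \<bar>a (Suc (k + n)) - (case List.product [0..<l] [0..<l] ! n of (i, j) \<Rightarrow> dist (p i) (p j))\<bar>)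
        [0..<l * l]))"

text \<open>
  The \<open>l\<close> variables from \<open>v + k\<close> on are quantified. The first \<open>k\<close> of them are compared with the
  free variables \<open>v, \<dots>, v + k - 1\<close>.
\<close>

definition penalty_formulas :: "nat \<Rightarrow> nat \<Rightarrow> nat \<Rightarrow> ('f, 'r) fm \<Rightarrow> ('f, 'r) fm list" where
  "penalty_formulas k l v \<phi> = \<phi> # map (\<lambda>i. Dist (Var (v + k + i)) (Var (v + i))) [0..<k] @
    map (\<lambda>(i, j). Dist (Var (v + k + i)) (Var (v + k + j))) (List.product [0..<l] [0..<l])"

definition sup_penalty ::
    "(nat \<Rightarrow> 'a::metric_space) \<Rightarrow> (real \<Rightarrow> real) \<Rightarrow> nat \<Rightarrow> nat \<Rightarrow> nat \<Rightarrow> real \<Rightarrow> real \<Rightarrow> ('f, 'r) fm \<Rightarrow> ('f, 'r) fm" where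
  "sup_penalty p \<theta> k l v N K \<phi> = sup_vars [v + k..<v + k + l]
    (Conn (penalty_connective p \<theta> k l N K) (penalty_formulas k l v \<phi>))"

lemma length_penalty_formulas: "length (penalty_formulas k l v \<phi>) = Suc (k + l * l)"
  by (simp add: penalty_formulas_def)

lemma nth_penalty_formulas:
  "penalty_formulas k l v \<phi> ! 0 = \<phi>"
  "i < k \<Longrightarrow> penalty_formulas k l v \<phi> ! Suc i = Dist (Var (v + k + i)) (Var (v + i))"
  "n < l * l \<Longrightarrow> penalty_formulas k l v \<phi> ! Suc (k + n) =
    (case List.product [0..<l] [0..<l] ! n of (i, j) \<Rightarrow> Dist (Var (v + k + i)) (Var (v + k + j)))"
  by (auto simp: penalty_formulas_def nth_append)

lemma fm_value_penalty:
  "fm_value M (Conn (penalty_connective p \<theta> k l N K) (penalty_formulas k l v \<phi>)) e =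
    trunc (\<theta> (fm_value M \<phi> e) - N * tuple_dist k (\<lambda>i. e (v + k + i)) (\<lambda>i. e (v + i))
      - K * defect l p (\<lambda>i. e (v + k + i)))"
proof -
  let ?ps = "List.product [0..<l] [0..<l]"
  define a where "a = (\<lambda>i\<in>{..<length (penalty_formulas k l v \<phi>)}.
    (map (fm_value M) (penalty_formulas k l v \<phi>) ! i) e)"
  have a: "a i = fm_value M (penalty_formulas k l v \<phi> ! i) e" if "i < Suc (k + l * l)" for i
    using that by (simp add: a_def length_penalty_formulas)
  have a0: "a 0 = fm_value M \<phi> e"
    by (simp add: a nth_penalty_formulas)
  have a1: "map (\<lambda>i. a (Suc i)) [0..<k] = map (\<lambda>i. dist (e (v + k + i)) (e (v + i))) [0..<k]"
    by (auto simp: a nth_penalty_formulas)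
  have "map (\<lambda>n. \<bar>a (Suc (k + n)) - (case ?ps ! n of (i, j) \<Rightarrow> dist (p i) (p j))\<bar>) [0..<l * l] =
    map (\<lambda>n. case ?ps ! n of (i, j) \<Rightarrow> \<bar>dist (e (v + k + i)) (e (v + k + j)) - dist (p i) (p j)\<bar>) [0..<l * l]"
    by (auto simp: a nth_penalty_formulas split: prod.splits)
  also have "\<dots> = map (\<lambda>(i, j). \<bar>dist (e (v + k + i)) (e (v + k + j)) - dist (p i) (p j)\<bar>) ?ps"
    by (rule nth_equalityI) auto
  finally have a2: "map (\<lambda>n. \<bar>a (Suc (k + n)) - (case ?ps ! n of (i, j) \<Rightarrow> dist (p i) (p j))\<bar>) [0..<l * l] =
    map (\<lambda>(i, j). \<bar>dist (e (v + k + i)) (e (v + k + j)) - dist (p i) (p j)\<bar>) ?ps" .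
  show ?thesis
    unfolding fm_value.simps a_def[symmetric] penalty_connective_def tuple_dist_def defect_def a0 a1 a2 ..
qed

text \<open>With the variables of \<open>w\<close> bound, only the \<open>k\<close> distances to
  \<open>u\<close> can change, each by at most \<open>t\<close>; so does their maximum, which is
  multiplied by \<open>N\<close>. All other coordinates have increment 0, so the constant is
  \<open>N\<close> however large \<open>K\<close> or the modulus of \<phi> may be.\<close>

lemma modulus_penalty_le:
  assumes L: "is_language L" and \<phi>: "is_formula L \<phi>" "fv \<phi> \<subseteq> {v + k..<v + k + l}"
    and kl: "k \<le> l" and N: "N \<ge> 0" and t: "t \<ge> 0"
  shows "modulus L (sup_penalty p \<theta> k l v N K \<phi>) (\<lambda>_. t) \<le> N * t"
proof -
  let ?\<delta> = "\<lambda>x. if x \<in> set [v + k..<v + k + l] then 0 else t"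
  let ?\<epsilon> = "\<lambda>i. (map (modulus L) (penalty_formulas k l v \<phi>) ! i) ?\<delta>"
  have \<epsilon>: "?\<epsilon> i = modulus L (penalty_formulas k l v \<phi> ! i) ?\<delta>" if "i < Suc (k + l * l)" for i
    using that by (simp add: length_penalty_formulas)
  have \<epsilon>0: "?\<epsilon> 0 = 0"
    using \<phi> by (subst \<epsilon>) (auto simp: nth_penalty_formulas intro!: modulus_eq_0[OF L])
  \<comment> \<open>As \<open>k \<le> l\<close>, the variable \<open>v + k + i\<close> is quantified
    and contributes 0, while the free variable \<open>v + i\<close> contributes
    \<open>t\<close>.\<close>
  have \<epsilon>1: "?\<epsilon> (Suc i) = t" if "i < k" for i
    using that kl by (subst \<epsilon>) (auto simp: nth_penalty_formulas)
  have \<epsilon>2: "?\<epsilon> (Suc (k + n)) = 0" if "n < l * l" for n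
  proof -
    obtain i j where ij: "List.product [0..<l] [0..<l] ! n = (i, j)" by fastforce
    then have "(i, j) \<in> set (List.product [0..<l] [0..<l])"
      using that by (metis length_product length_upt minus_nat.diff_0 nth_mem)
    then have "i < l" "j < l" by auto
    then show ?thesis using that ij by (subst \<epsilon>) (auto simp: nth_penalty_formulas)
  qed
  have cases: "i = 0 \<or> (\<exists>j<k. i = Suc j) \<or> (\<exists>n<l*l. i = Suc (k + n))" if "i < Suc (k + l * l)" for i
  proof (cases i)
    case (Suc j)
    then show ?thesis using that by (cases "j < k") (auto intro: exI[of _ "j - k"])
  qed simp
  have "conn_modulus (Suc (k + l * l)) (penalty_connective p \<theta> k l N K) ?\<epsilon> \<le> N * t"
  proof (rule conn_modulus_le)
    show "0 \<le> ?\<epsilon> i" if "i < Suc (k + l * l)" for i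
      using cases[OF that] \<epsilon>0 \<epsilon>1 \<epsilon>2 t by (elim disjE exE conjE) (simp_all only: order_refl)
  next
    fix a b :: "nat \<Rightarrow> real"
    assume ab: "\<And>i. i < Suc (k + l * l) \<Longrightarrow> \<bar>a i - b i\<bar> \<le> ?\<epsilon> i"
    have 0: "a 0 = b 0" using ab[of 0] \<epsilon>0 by simp
    have 1: "\<bar>a (Suc i) - b (Suc i)\<bar> \<le> t" if "i < k" for i
      using ab[of "Suc i"] \<epsilon>1[OF that] that by simp
    have 2: "a (Suc (k + n)) = b (Suc (k + n))" if "n < l * l" for n
      using ab[of "Suc (k + n)"] \<epsilon>2[OF that] that by simp
    have m2: "map (\<lambda>n. \<bar>a (Suc (k + n)) - (case List.product [0..<l] [0..<l] ! n of (i, j) \<Rightarrow> dist (p i) (p j))\<bar>) [0..<l * l] =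
      map (\<lambda>n. \<bar>b (Suc (k + n)) - (case List.product [0..<l] [0..<l] ! n of (i, j) \<Rightarrow> dist (p i) (p j))\<bar>) [0..<l * l]"
      by (auto simp: 2)
    have "\<bar>max0 (map (\<lambda>i. a (Suc i)) [0..<k]) - max0 (map (\<lambda>i. b (Suc i)) [0..<k])\<bar> \<le> t"
      using 1 t by (intro max0_map_diff) auto
    then have "N * \<bar>max0 (map (\<lambda>i. a (Suc i)) [0..<k]) - max0 (map (\<lambda>i. b (Suc i)) [0..<k])\<bar> \<le> N * t"
      using N by (rule mult_left_mono)
    moreover have "\<bar>penalty_connective p \<theta> k l N K a - penalty_connective p \<theta> k l N K b\<bar> \<le>
      \<bar>N * max0 (map (\<lambda>i. b (Suc i)) [0..<k]) - N * max0 (map (\<lambda>i. a (Suc i)) [0..<k])\<bar>"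
      unfolding penalty_connective_def m2 0 by (rule order_trans[OF trunc_diff]) simp
    ultimately show "\<bar>penalty_connective p \<theta> k l N K a - penalty_connective p \<theta> k l N K b\<bar> \<le> N * t"
      using N by (simp add: right_diff_distrib[symmetric] abs_mult abs_minus_commute)
  qed
  then show ?thesis
    unfolding sup_penalty_def modulus_sup_vars modulus.simps length_penalty_formulas .
qed

lemma is_formula_sup_penalty:
  assumes "is_formula L \<phi>" "continuous_on UNIV \<theta>"
  shows "is_formula L (sup_penalty p \<theta> k l v N K \<phi>)"
proof -
  have c: "continuous_on S (\<lambda>a::nat \<Rightarrow> real. a i)" for S i
    by (rule continuous_on_eval)
  have "is_connective n (penalty_connective p \<theta> k l N K)" for n
    unfolding is_connective_def
  proof
    show "continuous_on (cube n) (penalty_connective p \<theta> k l N K)"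
      unfolding penalty_connective_def
      by (intro continuous_intros continuous_on_max0 c continuous_on_compose2[OF assms(2)]) auto
    show "penalty_connective p \<theta> k l N K \<in> cube n \<rightarrow> {0..1}"
      by (simp add: penalty_connective_def trunc_range)
  qed
  moreover have "list_all (is_formula L) (penalty_formulas k l v \<phi>)"
    using assms(1) by (auto simp: penalty_formulas_def list_all_iff)
  ultimately show ?thesis by (simp add: sup_penalty_def)
qed

lemma fv_sup_penalty:
  assumes "fv \<phi> \<subseteq> {v + k..<v + k + l}" "k \<le> l"
  shows "fv (sup_penalty p \<theta> k l v N K \<phi>) \<subseteq> {v..<v + k}"
  using assms by (auto simp: sup_penalty_def penalty_formulas_def)

lemma tuple_dist_cong:
  "(\<And>i. i < k \<Longrightarrow> a i = a' i) \<Longrightarrow> (\<And>i. i < k \<Longrightarrow> b i = b' i) \<Longrightarrow> tuple_dist k a b = tuple_dist k a' b'"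
  unfolding tuple_dist_def by (rule arg_cong[of _ _ max0]) auto

lemma defect_cong: "(\<And>i. i < l \<Longrightarrow> w i = w' i) \<Longrightarrow> defect l p w = defect l p w'"
  unfolding defect_def by (rule arg_cong[of _ _ max0]) auto

text \<open>Assignments that differ from \<open>e\<close> only in the quantified block correspond to
  choices of \<open>w\<close>. The value of the inner formula is abstracted to \<open>V\<close>, so
  that the same computation serves atomic formulas and transforms.\<close>

lemma fm_value_sup_penalty:
  assumes V: "\<And>e. fm_value M \<phi> e = V (\<lambda>i. e (v + k + i))"
    and V_cong: "\<And>w w'. (\<And>i. i < l \<Longrightarrow> w i = w' i) \<Longrightarrow> V w = V w'"
    and kl: "k \<le> l"
  shows "fm_value M (sup_penalty p \<theta> k l v N K \<phi>) e \<in> {0..1}"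
    and "r < fm_value M (sup_penalty p \<theta> k l v N K \<phi>) e \<longleftrightarrow>
      (\<exists>w. r < trunc (\<theta> (V w) - N * tuple_dist k w (\<lambda>i. e (v + i)) - K * defect l p w))"
proof -
  let ?\<psi> = "Conn (penalty_connective p \<theta> k l N K) (penalty_formulas k l v \<phi>)"
  have bd: "fm_value M ?\<psi> e \<in> {0..1}" for e
    unfolding fm_value_penalty by (simp add: trunc_range)
  show "fm_value M (sup_penalty p \<theta> k l v N K \<phi>) e \<in> {0..1}"
    unfolding sup_penalty_def by (rule fm_value_sup_vars(1)[OF bd])
  have "r < fm_value M (sup_penalty p \<theta> k l v N K \<phi>) e \<longleftrightarrow>
    (\<exists>e'. (\<forall>x. x \<notin> set [v + k..<v + k + l] \<longrightarrow> e' x = e x) \<and>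
      r < trunc (\<theta> (V (\<lambda>i. e' (v + k + i))) - N * tuple_dist k (\<lambda>i. e' (v + k + i)) (\<lambda>i. e' (v + i))
      - K * defect l p (\<lambda>i. e' (v + k + i))))"
    unfolding sup_penalty_def fm_value_sup_vars(2)[OF bd] fm_value_penalty V ..
  also have "\<dots> \<longleftrightarrow> (\<exists>w. r < trunc (\<theta> (V w) - N * tuple_dist k w (\<lambda>i. e (v + i)) - K * defect l p w))"
    (is "?A \<longleftrightarrow> ?B")
  proof
    assume ?A
    then obtain e' where e': "\<forall>x. x \<notin> set [v + k..<v + k + l] \<longrightarrow> e' x = e x"
      "r < trunc (\<theta> (V (\<lambda>i. e' (v + k + i))) - N * tuple_dist k (\<lambda>i. e' (v + k + i)) (\<lambda>i. e' (v + i))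
      - K * defect l p (\<lambda>i. e' (v + k + i)))" by blast
    have "tuple_dist k (\<lambda>i. e' (v + k + i)) (\<lambda>i. e' (v + i)) = tuple_dist k (\<lambda>i. e' (v + k + i)) (\<lambda>i. e (v + i))"
      using e'(1) by (intro tuple_dist_cong) auto
    then show ?B using e'(2) by (intro exI[of _ "\<lambda>i. e' (v + k + i)"]) simp
  next
    assume ?B
    then obtain w where w: "r < trunc (\<theta> (V w) - N * tuple_dist k w (\<lambda>i. e (v + i)) - K * defect l p w)"
      by blast
    \<comment> \<open>The block holds only the first \<open>l\<close> entries of \<open>w\<close>;
      the congruence rules for \<open>V\<close>, \<open>tuple_dist\<close> and \<open>defect\<close>
      make up for the rest.\<close>
    define e' where "e' x = (if x \<in> set [v + k..<v + k + l] then w (x - (v + k)) else e x)" for x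
    have "V (\<lambda>i. e' (v + k + i)) = V w"
      by (rule V_cong) (simp add: e'_def)
    moreover have "tuple_dist k (\<lambda>i. e' (v + k + i)) (\<lambda>i. e' (v + i)) = tuple_dist k w (\<lambda>i. e (v + i))"
      using kl by (intro tuple_dist_cong) (simp_all add: e'_def)
    moreover have "defect l p (\<lambda>i. e' (v + k + i)) = defect l p w"
      by (rule defect_cong) (simp add: e'_def)
    moreover have "\<forall>x. x \<notin> set [v + k..<v + k + l] \<longrightarrow> e' x = e x" by (simp add: e'_def)
    ultimately show ?A using w by (intro exI[of _ e']) simp
  qed
  finally show "r < fm_value M (sup_penalty p \<theta> k l v N K \<phi>) e \<longleftrightarrow>
      (\<exists>w. r < trunc (\<theta> (V w) - N * tuple_dist k w (\<lambda>i. e (v + i)) - K * defect l p w))" .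
qed

text \<open>A common Lipschitz constant provides the uniform modulus that countable suprema and
  infima require of their members; this is where keeping \<open>N\<close> fixed through each closure
  step pays off.\<close>

lemma admissible_seq_lipschitz:
  assumes "\<And>n. lipschitz_fm L N (\<phi> n)" "\<And>n. fv (\<phi> n) \<subseteq> {v..<v + k}" "N \<ge> 0"
  shows "admissible_seq L \<phi>"
proof -
  have "is_modulus (\<lambda>t. N * t)"
    unfolding is_modulus_def using assms(3)
    by (auto intro!: mono_onI mult_left_mono tendsto_eq_intros)
  moreover have "finite (\<Union>n. fv (\<phi> n))"
    by (rule finite_subset[of _ "{v..<v + k}"]) (use assms(2) in auto)
  ultimately show ?thesis
    unfolding admissible_seq_def using assms(1) by (auto simp: lipschitz_fm_def)
qed

lemma lipschitz_fm_seq: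
  assumes "\<And>n. lipschitz_fm L N (\<phi> n)"
  shows "lipschitz_fm L N (SupN \<phi>)" "lipschitz_fm L N (InfN \<phi>)"
  using assms by (auto simp: lipschitz_fm_def intro!: cSUP_least)

lemma fm_value_SupN:
  assumes "\<And>n. fm_value M (\<phi> n) e \<in> {0..1}"
  shows "fm_value M (SupN \<phi>) e \<in> {0..1}"
    and "r < fm_value M (SupN \<phi>) e \<longleftrightarrow> (\<exists>n. r < fm_value M (\<phi> n) e)"
proof -
  have bdd: "bdd_above (range (\<lambda>n. fm_value M (\<phi> n) e))"
    using assms by (intro bdd_aboveI[of _ 1]) auto
  have "fm_value M (\<phi> 0) e \<le> (SUP n. fm_value M (\<phi> n) e)"
    by (rule cSUP_upper[OF UNIV_I bdd])
  moreover have "(SUP n. fm_value M (\<phi> n) e) \<le> 1"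
    using assms by (intro cSUP_least) auto
  ultimately show "fm_value M (SupN \<phi>) e \<in> {0..1}"
    using assms[of 0] by (auto intro: order_trans)
  show "r < fm_value M (SupN \<phi>) e \<longleftrightarrow> (\<exists>n. r < fm_value M (\<phi> n) e)"
    using less_cSUP_iff[OF _ bdd] by simp
qed

lemma fm_value_InfN:
  assumes "\<And>n. fm_value M (\<phi> n) e \<in> {0..1}"
  shows "fm_value M (InfN \<phi>) e \<in> {0..1}"
    and "r < fm_value M (InfN \<phi>) e \<longleftrightarrow> (\<exists>r'>r. \<forall>n. r' < fm_value M (\<phi> n) e)"
proof -
  have bdd: "bdd_below (range (\<lambda>n. fm_value M (\<phi> n) e))"
    using assms by (intro bdd_belowI[of _ 0]) auto
  have le: "(INF n. fm_value M (\<phi> n) e) \<le> fm_value M (\<phi> n) e" for n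
    by (rule cINF_lower[OF bdd UNIV_I])
  have "0 \<le> (INF n. fm_value M (\<phi> n) e)"
    using assms by (intro cINF_greatest) auto
  then show "fm_value M (InfN \<phi>) e \<in> {0..1}"
    using assms[of 0] le[of 0] by auto
  show "r < fm_value M (InfN \<phi>) e \<longleftrightarrow> (\<exists>r'>r. \<forall>n. r' < fm_value M (\<phi> n) e)"
  proof
    assume "r < fm_value M (InfN \<phi>) e"
    then obtain r' where "r < r'" "r' < (INF n. fm_value M (\<phi> n) e)"
      using dense by auto
    then show "\<exists>r'>r. \<forall>n. r' < fm_value M (\<phi> n) e" using le by (meson less_le_trans)
  next
    assume "\<exists>r'>r. \<forall>n. r' < fm_value M (\<phi> n) e"
    then obtain r' where r': "r < r'" "\<And>n. r' < fm_value M (\<phi> n) e" by blast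
    then have "r' \<le> (INF n. fm_value M (\<phi> n) e)" by (intro cINF_greatest) (auto intro: less_imp_le)
    then show "r < fm_value M (InfN \<phi>) e" using r'(1) by simp
  qed
qed

subsection \<open>Distances between tuples\<close>

lemma tuple_dist_nonneg: "0 \<le> tuple_dist k a b"
  unfolding tuple_dist_def by (rule max0_nonneg)

lemma tuple_dist_le_iff: "0 \<le> c \<Longrightarrow> tuple_dist k a b \<le> c \<longleftrightarrow> (\<forall>i<k. dist (a i) (b i) \<le> c)"
  unfolding tuple_dist_def by (auto simp: max0_le_iff)

lemma tuple_dist_upper: "i < k \<Longrightarrow> dist (a i) (b i) \<le> tuple_dist k a b"
  using tuple_dist_le_iff[OF tuple_dist_nonneg, of k a b k a b] by simp

lemma tuple_dist_commute: "tuple_dist k a b = tuple_dist k b a"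
  unfolding tuple_dist_def by (simp add: dist_commute)

lemma tuple_dist_self [simp]: "tuple_dist k a a = 0"
  using tuple_dist_le_iff[of 0 k a a] tuple_dist_nonneg[of k a a] by simp

lemma tuple_dist_triangle: "tuple_dist k a c \<le> tuple_dist k a b + tuple_dist k b c"
proof -
  have "dist (a i) (c i) \<le> tuple_dist k a b + tuple_dist k b c" if "i < k" for i
    using dist_triangle[of "a i" "c i" "b i"] tuple_dist_upper[OF that, of a b]
      tuple_dist_upper[OF that, of b c] by simp
  then show ?thesis
    by (subst tuple_dist_le_iff) (simp_all add: tuple_dist_nonneg add_nonneg_nonneg)
qed

lemma tuple_dist_mono: "k \<le> l \<Longrightarrow> tuple_dist k a b \<le> tuple_dist l a b"
  by (subst tuple_dist_le_iff[OF tuple_dist_nonneg]) (simp add: tuple_dist_upper)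

lemma defect_nonneg: "0 \<le> defect l p w"
  unfolding defect_def by (rule max0_nonneg)

lemma defect_upper: "i < l \<Longrightarrow> j < l \<Longrightarrow> \<bar>dist (w i) (w j) - dist (p i) (p j)\<bar> \<le> defect l p w"
  unfolding defect_def by (rule max0_upper) force

lemma defect_eq_0:
  "(\<And>i j. i < l \<Longrightarrow> j < l \<Longrightarrow> dist (w i) (w j) = dist (p i) (p j)) \<Longrightarrow> defect l p w = 0"
  unfolding defect_def by (rule max0_zero) auto

lemma nearby_defect_0:
  fixes w p :: "nat \<Rightarrow> 'u::urysohn_sphere"
  obtains w' where "\<And>i j. i < l \<Longrightarrow> j < l \<Longrightarrow> dist (w' i) (w' j) = dist (p i) (p j)"
    "tuple_dist l w w' \<le> defect l p w"
proof -
  obtain w' where w': "\<And>i j. i < l \<Longrightarrow> j < l \<Longrightarrow> dist (w' i) (w' j) = dist (p i) (p j)"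
    "\<And>i. i < l \<Longrightarrow> dist (w i) (w' i) \<le> defect l p w"
    using nearby_isometric_copy[of l w p "defect l p w"] defect_upper by metis
  then show ?thesis using that[of w'] by (simp add: tuple_dist_le_iff defect_nonneg)
qed

section \<open>Basic open sets of the isometry group\<close>

lemma continuous_on_tuple_dist_inv:
  "continuous_on isometries (\<lambda>g. tuple_dist k (\<lambda>i. inv g (p i)) (u :: nat \<Rightarrow> 'a::metric_space))"
  unfolding tuple_dist_def
  by (intro continuous_on_max0 continuous_on_dist continuous_on_inv_eval continuous_on_const)

text \<open>The set is open by continuity of inversion, and ultrahomogeneity makes it nonempty: an
  isometry \<open>h\<close> taking \<open>w\<close> to \<open>p\<close> on the first
  \<open>l\<close> entries has \<open>inv h (p i) = w i\<close> there. Nonempty open sets are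
  nonmeager by Baire's theorem.\<close>

lemma nonmeager_isometries_near_tuple:
  fixes w p :: "nat \<Rightarrow> 'u::urysohn_sphere"
  assumes w: "\<And>i j. i < l \<Longrightarrow> j < l \<Longrightarrow> dist (w i) (w j) = dist (p i) (p j)" and "\<epsilon> > 0"
  shows "\<not> meager_in Iso_topology {g \<in> isometries. tuple_dist l (\<lambda>i. inv g (p i)) w < \<epsilon>}"
proof (rule nonmeager_Iso)
  have "openin (top_of_set isometries) (isometries \<inter> (\<lambda>g. tuple_dist l (\<lambda>i. inv g (p i)) w) -` {..<\<epsilon>})"
    by (intro continuous_openin_preimage_gen continuous_on_tuple_dist_inv open_lessThan)
  moreover have "isometries \<inter> (\<lambda>g. tuple_dist l (\<lambda>i. inv g (p i)) w) -` {..<\<epsilon>} =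
      {g \<in> isometries. tuple_dist l (\<lambda>i. inv g (p i)) w < \<epsilon>}" by auto
  ultimately show "openin Iso_topology {g \<in> isometries. tuple_dist l (\<lambda>i. inv g (p i)) w < \<epsilon>}"
    by (simp add: Iso_topology_def)
  obtain h where h: "h \<in> isometries" "\<And>i. i < l \<Longrightarrow> h (w i) = p i"
    using isometry_between_tuples[of l w p] w by metis
  have "inv h (p i) = w i" if "i < l" for i
    using h that isometries_inv_inverse(2) by metis
  then have "tuple_dist l (\<lambda>i. inv h (p i)) w = tuple_dist l w w"
    by (intro tuple_dist_cong) auto
  then show "{g \<in> isometries. tuple_dist l (\<lambda>i. inv g (p i)) w < \<epsilon>} \<noteq> {}"
    using h(1) \<open>\<epsilon> > 0\<close> by auto
qed

text \<open>Closeness of inverses on finitely many \<open>p i\<close> controls the maps themselves: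
  \<open>dist (h x) (g x) = dist x (inv g (h x))\<close>, and \<open>h x\<close> is approximated by
  a point of \<open>p\<close>. Neighbourhoods of isometries are thus described by tuples, which
  formulas can quantify over. The bound \<open>k \<le> l\<close> lets such a tuple also be compared
  with \<open>u\<close>.\<close>

lemma Iso_neighbourhood:
  fixes p :: "nat \<Rightarrow> 'a::metric_space"
  assumes dense: "closure (range p) = UNIV" and G: "openin Iso_topology G" "h \<in> G"
  obtains l \<delta> where "k \<le> l" "\<delta> > 0"
    "\<And>g. g \<in> isometries \<Longrightarrow> tuple_dist l (\<lambda>i. inv g (p i)) (\<lambda>i. inv h (p i)) < \<delta> \<Longrightarrow> g \<in> G"
proof -
  obtain U where U: "open U" "G = isometries \<inter> U"
    using G(1) unfolding Iso_topology_def openin_open by blast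
  have h: "h \<in> isometries" "h \<in> U" using G(2) U(2) by auto
  have "openin (product_topology (\<lambda>i. euclidean) UNIV) U"
    using U(1) by (simp add: open_fun_def)
  from product_topology_open_contains_basis[OF this h(2)]
  obtain X where X: "h \<in> (\<Pi>\<^sub>E i\<in>UNIV. X i)" "\<And>i. open (X i)" "finite {i. X i \<noteq> UNIV}"
    "(\<Pi>\<^sub>E i\<in>UNIV. X i) \<subseteq> U" by auto
  let ?F = "{i. X i \<noteq> UNIV}"
  have "\<exists>e>0. ball (h x) e \<subseteq> X x" for x
    using X(1,2) open_contains_ball[of "X x"] by (auto simp: PiE_iff)
  then obtain e0 where e0: "\<And>x. e0 x > 0" "\<And>x. ball (h x) (e0 x) \<subseteq> X x" by metis
  \<comment> \<open>The inserted 1 keeps the minimum meaningful when \<open>X\<close> restricts no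
    coordinate.\<close>
  define e where "e = Min (insert 1 (e0 ` ?F))"
  have e: "e > 0" unfolding e_def using X(3) e0(1) by (subst Min_gr_iff) auto
  have e_le: "e \<le> e0 x" if "x \<in> ?F" for x
    unfolding e_def using X(3) that by (intro Min_le) auto
  have "\<exists>i. dist (p i) (h x) < e / 3" for x
  proof -
    have "h x \<in> closure (range p)" using dense by simp
    then show ?thesis unfolding closure_approachable using e by (auto elim!: allE[of _ "e / 3"])
  qed
  then obtain c where c: "\<And>x. dist (p (c x)) (h x) < e / 3" by metis
  \<comment> \<open>Inserting \<open>k\<close> gives \<open>k \<le> l\<close>; the successor puts
    every chosen index strictly below \<open>l\<close>.\<close>
  define l where "l = Max (insert k ((\<lambda>x. Suc (c x)) ` ?F))"
  have kl: "k \<le> l" unfolding l_def using X(3) by (intro Max_ge) auto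
  have cl: "c x < l" if "x \<in> ?F" for x
  proof -
    have "Suc (c x) \<le> l" unfolding l_def using X(3) that by (intro Max_ge) auto
    then show ?thesis by simp
  qed
  show ?thesis
  proof (rule that[OF kl, of "e / 3"])
    show "e / 3 > 0" using e by simp
    fix g :: "'a \<Rightarrow> 'a" assume g: "g \<in> isometries"
      and gh: "tuple_dist l (\<lambda>i. inv g (p i)) (\<lambda>i. inv h (p i)) < e / 3"
    have "g x \<in> X x" for x
    proof (cases "x \<in> ?F")
      case True
      let ?y = "p (c x)"
      have "dist (inv g ?y) (inv h ?y) < e / 3"
        using tuple_dist_upper[OF cl[OF True], of "\<lambda>i. inv g (p i)" "\<lambda>i. inv h (p i)"] gh by simp
      moreover have "dist (inv h (h x)) (inv h ?y) < e / 3" "dist (inv g ?y) (inv g (h x)) < e / 3"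
        using c[of x] by (simp_all only: isometries_dist[OF isometries_inv] g h dist_commute)
      \<comment> \<open>The path runs through \<open>inv h ?y\<close> and \<open>inv g ?y\<close>.
        Its outer steps are short because \<open>?y\<close> is near \<open>h x\<close>, the middle
        one by the assumption on \<open>g\<close>.\<close>
      moreover have "dist (inv h (h x)) (inv g (h x)) \<le>
          dist (inv h (h x)) (inv h ?y) + dist (inv g ?y) (inv h ?y) + dist (inv g ?y) (inv g (h x))"
        using dist_triangle[of "inv h (h x)" "inv g (h x)" "inv h ?y"]
          dist_triangle[of "inv h ?y" "inv g (h x)" "inv g ?y"] by (simp add: dist_commute)
      ultimately have "dist x (inv g (h x)) < e" using h(1) by simp
      then have "dist (h x) (g x) < e"
        using dist_inv_isometry[OF g, of "h x" x] by (simp add: dist_commute)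
      then show ?thesis using e0(2)[of x] e_le[OF True] by auto
    qed simp
    then show "g \<in> G" using X(4) g U(2) by auto
  qed
qed

section \<open>The action\<close>

lemma is_modulus_small:
  assumes "is_modulus \<omega>" "\<epsilon> > 0"
  obtains \<delta> where "\<delta> > 0" "\<And>t. 0 \<le> t \<Longrightarrow> t < \<delta> \<Longrightarrow> \<omega> t < \<epsilon>"
proof -
  have "\<forall>\<^sub>F t in at_right 0. \<omega> t < \<epsilon>"
    using assms order_tendstoD(2) unfolding is_modulus_def by blast
  then obtain b where b: "b > 0" "\<And>y. 0 < y \<Longrightarrow> y < b \<Longrightarrow> \<omega> y < \<epsilon>"
    unfolding eventually_at_right_field by blast
  have "\<omega> t < \<epsilon>" if "0 \<le> t" "t < b" for t
    using that b(2) assms unfolding is_modulus_def by (cases "t = 0") auto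
  then show ?thesis using that b(1) by blast
qed

lemma dist_max_map: "dist_max (map a xs) (map b xs) = max0 (map (\<lambda>x. dist (a x) (b x)) xs)"
  unfolding dist_max_def by (rule arg_cong[of _ _ max0]) (induction xs, auto)

lemma modulus_composition_small:
  fixes F :: "'a::metric_space list \<Rightarrow> 'b::metric_space"
  assumes \<omega>: "is_modulus \<omega>"
    and F: "\<And>xs ys. length xs = n \<Longrightarrow> length ys = n \<Longrightarrow> dist (F xs) (F ys) \<le> \<omega> (dist_max xs ys)"
    and "\<epsilon> > 0"
  obtains \<delta> where "\<delta> > 0"
    "\<And>xs a b. length xs = n \<Longrightarrow> (\<And>x. x \<in> set xs \<Longrightarrow> dist (a x) (b x) < \<delta>) \<Longrightarrow>
      dist (F (map a xs)) (F (map b xs)) < \<epsilon>"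
proof -
  obtain \<delta> where \<delta>: "\<delta> > 0" "\<And>t. 0 \<le> t \<Longrightarrow> t < \<delta> \<Longrightarrow> \<omega> t < \<epsilon>"
    using is_modulus_small[OF \<omega> \<open>\<epsilon> > 0\<close>] by metis
  have "dist (F (map a xs)) (F (map b xs)) < \<epsilon>"
    if "length xs = n" "\<And>x. x \<in> set xs \<Longrightarrow> dist (a x) (b x) < \<delta>" for xs :: "'c list" and a b
  proof -
    have "max0 (map (\<lambda>x. dist (a x) (b x)) xs) < \<delta>"
      using that(2) \<delta>(1) by (auto simp: max0_less_iff)
    then have "\<omega> (dist_max (map a xs) (map b xs)) < \<epsilon>"
      by (intro \<delta>(2)) (simp_all add: dist_max_map max0_nonneg)
    then show ?thesis using F[of "map a xs" "map b xs"] that(1) by simp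
  qed
  then show ?thesis using that \<delta>(1) by blast
qed

lemma continuous_on_modulus_composition:
  fixes F :: "'a::metric_space list \<Rightarrow> 'b::metric_space" and y :: "'c::topological_space \<Rightarrow> 'd \<Rightarrow> 'a"
  assumes \<omega>: "is_modulus \<omega>"
    and F: "\<And>xs ys. length xs = n \<Longrightarrow> length ys = n \<Longrightarrow> dist (F xs) (F ys) \<le> \<omega> (dist_max xs ys)"
    and xs: "length xs = n" and y: "\<And>x. x \<in> set xs \<Longrightarrow> continuous_on S (\<lambda>g. y g x)"
  shows "continuous_on S (\<lambda>g. F (map (y g) xs))"
  unfolding continuous_on_def
proof (intro ballI tendstoI)
  fix h and \<epsilon> :: real assume h: "h \<in> S" and "\<epsilon> > 0"
  obtain \<delta> where \<delta>: "\<delta> > 0"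
    "\<And>xs (a :: 'd \<Rightarrow> 'a) b. length xs = n \<Longrightarrow> (\<And>x. x \<in> set xs \<Longrightarrow> dist (a x) (b x) < \<delta>) \<Longrightarrow>
      dist (F (map a xs)) (F (map b xs)) < \<epsilon>"
    by (rule modulus_composition_small[OF \<omega> F \<open>\<epsilon> > 0\<close>]) auto
  have "\<forall>\<^sub>F g in at h within S. dist (y g x) (y h x) < \<delta>" if "x \<in> set xs" for x
    using y[OF that] h \<delta>(1) unfolding continuous_on_def by (auto dest!: tendstoD)
  then have "\<forall>\<^sub>F g in at h within S. \<forall>x\<in>set xs. dist (y g x) (y h x) < \<delta>"
    by (intro eventually_ball_finite) auto
  then show "\<forall>\<^sub>F g in at h within S. dist (F (map (y g) xs)) (F (map (y h) xs)) < \<epsilon>"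
    by eventually_elim (rule \<delta>(2)[OF xs], simp)
qed

text \<open>Isometries are equicontinuous, so evaluation is jointly continuous:
  \<open>g (y g)\<close> is compared with \<open>h (y h)\<close> through
  \<open>g (y h)\<close>.\<close>

lemma continuous_on_isometry_apply:
  fixes y :: "('a::metric_space \<Rightarrow> 'a) \<Rightarrow> 'a"
  assumes y: "continuous_on isometries y"
  shows "continuous_on isometries (\<lambda>g. g (y g))"
  unfolding continuous_on_def
proof (intro ballI tendstoI)
  fix h :: "'a \<Rightarrow> 'a" and \<epsilon> :: real assume h: "h \<in> isometries" and "\<epsilon> > 0"
  have "\<forall>\<^sub>F g in at h within isometries. dist (y g) (y h) < \<epsilon> / 2"
    using y h \<open>\<epsilon> > 0\<close> unfolding continuous_on_def by (auto dest!: tendstoD[where e = "\<epsilon> / 2"])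
  moreover have "\<forall>\<^sub>F g in at h within isometries. dist (g (y h)) (h (y h)) < \<epsilon> / 2"
    using continuous_on_eval[of isometries "y h"] h \<open>\<epsilon> > 0\<close>
    unfolding continuous_on_def by (auto dest!: tendstoD[where e = "\<epsilon> / 2"])
  moreover have "\<forall>\<^sub>F g in at h within isometries. g \<in> isometries"
    by (simp add: eventually_at_filter)
  ultimately show "\<forall>\<^sub>F g in at h within isometries. dist (g (y g)) (h (y h)) < \<epsilon>"
  proof eventually_elim
    case (elim g)
    have "dist (g (y g)) (h (y h)) \<le> dist (g (y g)) (g (y h)) + dist (g (y h)) (h (y h))"
      by (rule dist_triangle)
    then show ?case using elim by (simp add: isometries_dist)
  qed
qed

lemma Mod_fun:
  assumes "M \<in> Mod L" "f \<in> funs L" "length xs = fun_arity L f" "length ys = fun_arity L f"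
  shows "dist (fst M f xs) (fst M f ys) \<le> fun_modulus L f (dist_max xs ys)"
  using assms unfolding Mod_def by auto

lemma Mod_rel:
  assumes "M \<in> Mod L" "r \<in> rels L" "length xs = rel_arity L r" "length ys = rel_arity L r"
  shows "dist (snd M r xs) (snd M r ys) \<le> rel_modulus L r (dist_max xs ys)"
  using assms unfolding Mod_def by (auto simp: dist_real_def)

lemma Mod_rel_range:
  assumes "M \<in> Mod L" "r \<in> rels L" "length xs = rel_arity L r"
  shows "snd M r xs \<in> {0..1}"
  using assms unfolding Mod_def by (fastforce simp: PiE_iff)

lemma Mod_undefined:
  assumes "M \<in> Mod L"
  shows "f \<notin> funs L \<Longrightarrow> fst M f = undefined"
    and "f \<in> funs L \<Longrightarrow> length xs \<noteq> fun_arity L f \<Longrightarrow> fst M f xs = undefined"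
    and "r \<notin> rels L \<Longrightarrow> snd M r = undefined"
    and "r \<in> rels L \<Longrightarrow> length xs \<noteq> rel_arity L r \<Longrightarrow> snd M r xs = undefined"
  using assms unfolding Mod_def by (auto simp: PiE_iff extensional_def)

lemma act_in_Mod:
  assumes g: "g \<in> isometries" and M: "M \<in> Mod L"
  shows "act L g M \<in> Mod L"
proof -
  have d: "dist_max (map (inv g) xs) (map (inv g) ys) = dist_max xs ys" for xs ys
  proof -
    have "map2 dist (map (inv g) xs) (map (inv g) ys) = map2 dist xs ys"
      by (simp add: zip_map_map split_beta isometries_dist[OF isometries_inv[OF g]])
    then show ?thesis by (simp add: dist_max_def)
  qed
  show ?thesis
    unfolding Mod_def act_def
    using Mod_fun[OF M] Mod_rel[OF M] Mod_rel_range[OF M] isometries_dist[OF g] d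
    by (auto simp: dist_real_def) (smt (verit) d length_map)+
qed

text \<open>The orbit map of a fixed structure pulls Borel sets of structures back to Borel sets of
  isometries, which have the Baire property. Fixed structures suffice because the category
  quantifier ranges over \<open>g\<close> alone.\<close>

lemma continuous_on_act:
  fixes M :: "('f, 'r, 'u::metric_space) struct"
  assumes L: "is_language L" and M: "M \<in> Mod L"
  shows "continuous_on isometries (\<lambda>g. act L g M)"
  unfolding act_def
proof (intro continuous_on_Pair continuous_on_coordinatewise_then_product)
  fix f xs
  have "continuous_on isometries (\<lambda>g. g (fst M f (map (inv g) xs)))"
    if "f \<in> funs L" "length xs = fun_arity L f"
    using L that
    by (intro continuous_on_isometry_apply continuous_on_modulus_composition[where F = "fst M f"
          and \<omega> = "fun_modulus L f" and y = inv and n = "fun_arity L f"])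
      (auto simp: is_language_def intro: Mod_fun[OF M] continuous_on_inv_eval)
  then show "continuous_on isometries (\<lambda>g. (\<lambda>f\<in>funs L. \<lambda>xs\<in>{xs. length xs = fun_arity L f}.
      g (fst M f (map (inv g) xs))) f xs)"
    by (cases "f \<in> funs L"; cases "length xs = fun_arity L f") (simp_all add: restrict_def)
next
  fix r xs
  have "continuous_on isometries (\<lambda>g. snd M r (map (inv g) xs))"
    if "r \<in> rels L" "length xs = rel_arity L r"
    using L that
    by (intro continuous_on_modulus_composition[where F = "snd M r"
          and \<omega> = "rel_modulus L r" and y = inv and n = "rel_arity L r"])
      (auto simp: is_language_def intro: Mod_rel[OF M] continuous_on_inv_eval)
  then show "continuous_on isometries (\<lambda>g. (\<lambda>r\<in>rels L. \<lambda>xs\<in>{xs. length xs = rel_arity L r}.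
      snd M r (map (inv g) xs)) r xs)"
    by (cases "r \<in> rels L"; cases "length xs = rel_arity L r") (simp_all add: restrict_def)
qed

section \<open>The Vaught transform\<close>

text \<open>The left-hand side of the theorem, a graded Vaught transform. Here \<open>u\<close> is
  an initial part of a sequence, so that variable assignments fit, and a single truncation replaces
  the two of the theorem.\<close>

definition vaught ::
    "('f, 'r) language \<Rightarrow> (nat \<Rightarrow> 'u) \<Rightarrow> (('f, 'r, 'u::metric_space) struct \<Rightarrow> real) \<Rightarrow>
      real \<Rightarrow> nat \<Rightarrow> ('f, 'r, 'u) struct \<Rightarrow> (nat \<Rightarrow> 'u) \<Rightarrow> real" where
  "vaught L p A N k M u = sup_star Iso_topology
    (\<lambda>g. trunc (A (act L g M) - N * tuple_dist k (\<lambda>i. inv g (p i)) u))"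

text \<open>The truncation disappears at levels \<open>r \<ge> 0\<close> because its argument never
  exceeds 1. The induction uses the transform through these superlevel sets.\<close>

lemma vaught_greater:
  fixes L :: "('f, 'r) language" and p :: "nat \<Rightarrow> 'u::metric_space"
  assumes A: "\<And>M. M \<in> Mod L \<Longrightarrow> A M \<le> 1" and M: "M \<in> Mod L" and N: "N \<ge> 0"
  shows "vaught L p A N k M u \<in> {0..1}"
    and "0 \<le> r \<Longrightarrow> r < vaught L p A N k M u \<longleftrightarrow>
      \<not> meager_in Iso_topology {g \<in> isometries. r < A (act L g M) - N * tuple_dist k (\<lambda>i. inv g (p i)) u}"
proof -
  let ?B = "\<lambda>g. trunc (A (act L g M) - N * tuple_dist k (\<lambda>i. inv g (p i)) u)"
  let ?s = "vaught L p A N k M u"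
  have ex1: "\<exists>!s. s \<in> {0..1} \<and> (\<forall>r\<ge>0. r < s \<longleftrightarrow> \<not> meager_in Iso_topology {y \<in> topspace Iso_topology. r < ?B y})"
    by (rule sup_star_ex1) (simp add: trunc_range)
  have s: "?s \<in> {0..1} \<and> (\<forall>r\<ge>0. r < ?s \<longleftrightarrow> \<not> meager_in Iso_topology {y \<in> topspace Iso_topology. r < ?B y})"
    unfolding vaught_def sup_star_def by (rule theI'[OF ex1])
  then show "?s \<in> {0..1}" by (rule conjunct1)
  have "A (act L g M) - N * tuple_dist k (\<lambda>i. inv g (p i)) u \<le> 1" if "g \<in> isometries" for g
  proof -
    have "0 \<le> N * tuple_dist k (\<lambda>i. inv g (p i)) u"
      by (intro mult_nonneg_nonneg N tuple_dist_nonneg)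
    then show ?thesis using A[OF act_in_Mod[OF that M]] by linarith
  qed
  then have "{y \<in> topspace Iso_topology. r < ?B y} =
    {g \<in> isometries. r < A (act L g M) - N * tuple_dist k (\<lambda>i. inv g (p i)) u}" if "0 \<le> r" for r
    using trunc_greater_iff[OF that] by auto
  then show "0 \<le> r \<Longrightarrow> r < ?s \<longleftrightarrow>
      \<not> meager_in Iso_topology {g \<in> isometries. r < A (act L g M) - N * tuple_dist k (\<lambda>i. inv g (p i)) u}"
    using s by simp
qed

lemma vaught_cong: "(\<And>i. i < k \<Longrightarrow> u i = u' i) \<Longrightarrow> vaught L p A N k M u = vaught L p A N k M u'"
  unfolding vaught_def by (intro arg_cong[of _ _ "sup_star Iso_topology"] ext arg_cong[of _ _ trunc]
      arg_cong2[of _ _ _ _ minus] arg_cong2[of _ _ _ _ times] refl tuple_dist_cong) auto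

text \<open>By the triangle inequality the superlevel set for \<open>u'\<close> at level
  \<open>?s + ?e\<close> lies in the one for \<open>u\<close> at level \<open>?s\<close>. With
  \<open>?s\<close> the value at \<open>u\<close> itself, a larger value at \<open>u'\<close> would
  give \<open>?s < ?s\<close>. The estimate serves to move a tuple of small defect to an exact
  copy.\<close>

lemma vaught_lipschitz:
  fixes L :: "('f, 'r) language" and p :: "nat \<Rightarrow> 'u::metric_space"
  assumes A: "\<And>M. M \<in> Mod L \<Longrightarrow> A M \<le> 1" and M: "M \<in> Mod L" and N: "N \<ge> 0"
  shows "vaught L p A N k M u' \<le> vaught L p A N k M u + N * tuple_dist k u u'"
proof (rule ccontr)
  let ?s = "vaught L p A N k M u" and ?e = "N * tuple_dist k u u'"
  assume "\<not> ?thesis"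
  then have gt: "?s + ?e < vaught L p A N k M u'" by simp
  have s: "0 \<le> ?s" using vaught_greater(1)[where A = A and p = p and k = k and u = u, OF A M N] by simp
  have e: "0 \<le> ?e" by (intro mult_nonneg_nonneg N tuple_dist_nonneg)
  have "\<not> meager_in Iso_topology
      {g \<in> isometries. ?s + ?e < A (act L g M) - N * tuple_dist k (\<lambda>i. inv g (p i)) u'}"
    using gt s e vaught_greater(2)[where r = "?s + ?e" and A = A and p = p and k = k and u = u', OF A M N] by simp
  moreover have "{g \<in> isometries. ?s + ?e < A (act L g M) - N * tuple_dist k (\<lambda>i. inv g (p i)) u'} \<subseteq>
      {g \<in> isometries. ?s < A (act L g M) - N * tuple_dist k (\<lambda>i. inv g (p i)) u}"
  proof (intro subsetI CollectI conjI; elim CollectE conjE)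
    fix g assume "?s + ?e < A (act L g M) - N * tuple_dist k (\<lambda>i. inv g (p i)) u'"
    moreover have "N * tuple_dist k (\<lambda>i. inv g (p i)) u \<le>
        N * (tuple_dist k (\<lambda>i. inv g (p i)) u' + tuple_dist k u u')"
      using tuple_dist_triangle[of k "\<lambda>i. inv g (p i)" u u'] N
      by (intro mult_left_mono) (simp_all add: tuple_dist_commute)
    ultimately show "?s < A (act L g M) - N * tuple_dist k (\<lambda>i. inv g (p i)) u"
      by (simp add: distrib_left)
  qed
  ultimately have "\<not> meager_in Iso_topology
      {g \<in> isometries. ?s < A (act L g M) - N * tuple_dist k (\<lambda>i. inv g (p i)) u}"
    using meager_in_mono by blast
  then have "?s < ?s" using vaught_greater(2)[where r = ?s and A = A and p = p and k = k and u = u, OF A M N] s by blast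
  then show False by simp
qed

text \<open>
  The offset \<open>v\<close> of the free variables is arbitrary: then no variable of an infinitary
  formula ever has to be renamed.
\<close>

definition vaught_definable ::
    "('f, 'r) language \<Rightarrow> (nat \<Rightarrow> 'u) \<Rightarrow> (('f, 'r, 'u::metric_space) struct \<Rightarrow> real) \<Rightarrow> bool" where
  "vaught_definable L p A \<longleftrightarrow> (\<forall>(N::nat) k v. \<exists>\<phi>. is_formula L \<phi> \<and> fv \<phi> \<subseteq> {v..<v + k} \<and>
    lipschitz_fm L N \<phi> \<and> (\<forall>M\<in>Mod L. \<forall>e. fm_value M \<phi> e = vaught L p A N k M (\<lambda>i. e (v + i))))"

text \<open>Numbers in the unit interval are determined by the nonnegative numbers strictly below
  them, so formula and transform need to be compared only at levels
  \<open>r \<ge> 0\<close>.\<close>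

lemma vaught_definableI:
  fixes L :: "('f, 'r) language" and p :: "nat \<Rightarrow> 'u::metric_space"
  assumes A: "\<And>M. M \<in> Mod L \<Longrightarrow> A M \<le> 1"
    and ex: "\<And>(N::nat) k v. \<exists>\<phi>. is_formula L \<phi> \<and> fv \<phi> \<subseteq> {v..<v + k} \<and> lipschitz_fm L N \<phi> \<and>
      (\<forall>M\<in>Mod L. \<forall>e. fm_value M \<phi> e \<in> {0..1} \<and> (\<forall>r\<ge>0. r < fm_value M \<phi> e \<longleftrightarrow>
        \<not> meager_in Iso_topology {g \<in> isometries.
          r < A (act L g M) - N * tuple_dist k (\<lambda>i. inv g (p i)) (\<lambda>i. e (v + i))}))"
  shows "vaught_definable L p A"
  unfolding vaught_definable_def
proof (intro allI)
  fix N k v :: nat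
  obtain \<phi> where \<phi>: "is_formula L \<phi>" "fv \<phi> \<subseteq> {v..<v + k}" "lipschitz_fm L N \<phi>"
    "\<And>(M :: ('f, 'r, 'u) struct) e. M \<in> Mod L \<Longrightarrow> fm_value M \<phi> e \<in> {0..1}"
    "\<And>(M :: ('f, 'r, 'u) struct) e r. M \<in> Mod L \<Longrightarrow> r \<ge> 0 \<Longrightarrow> r < fm_value M \<phi> e \<longleftrightarrow>
        \<not> meager_in Iso_topology {g \<in> isometries.
          r < A (act L g M) - N * tuple_dist k (\<lambda>i. inv g (p i)) (\<lambda>i. e (v + i))}"
    using ex[of v k N] by blast
  have "fm_value M \<phi> e = vaught L p A N k M (\<lambda>i. e (v + i))" if M: "M \<in> Mod L" for M :: "('f, 'r, 'u) struct" and e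
  proof -
    let ?x = "fm_value M \<phi> e" and ?y = "vaught L p A N k M (\<lambda>i. e (v + i))"
    have iff: "r < ?x \<longleftrightarrow> r < ?y" if "r \<ge> 0" for r
      unfolding \<phi>(5)[OF M that] by (rule vaught_greater(2)[OF A M _ that, symmetric]) simp_all
    have "0 \<le> ?x" "0 \<le> ?y"
      using \<phi>(4)[OF M, of e] vaught_greater(1)[where A = A and p = p and k = k and N = N and u = "\<lambda>i. e (v + i)", OF A M] by simp_all
    then show ?thesis using iff[of ?x] iff[of ?y] by simp
  qed
  then show "\<exists>\<phi>. is_formula L \<phi> \<and> fv \<phi> \<subseteq> {v..<v + k} \<and> lipschitz_fm L N \<phi> \<and>
      (\<forall>M\<in>Mod L. \<forall>e. fm_value M \<phi> e = vaught L p A N k M (\<lambda>i. e (v + i)))"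
    using \<phi>(1-3) by blast
qed

lemma vaught_definable_Sup:
  fixes L :: "('f, 'r) language" and p :: "nat \<Rightarrow> 'u::metric_space"
  assumes A: "\<And>n::nat. vaught_definable L p (A n)" "\<And>n M. M \<in> Mod L \<Longrightarrow> A n M \<le> 1"
    and B: "\<And>M s. M \<in> Mod L \<Longrightarrow> 0 \<le> s \<Longrightarrow> s < B M \<longleftrightarrow> (\<exists>n. s < A n M)"
  shows "vaught_definable L p B"
proof (rule vaught_definableI)
  fix M :: "('f, 'r, 'u) struct" assume M: "M \<in> Mod L"
  show "B M \<le> 1" using B[OF M, of 1] A(2)[OF M] by (metis linorder_not_less zero_le_one)
next
  fix N k v :: nat
  have "\<forall>n. \<exists>\<phi>. is_formula L \<phi> \<and> fv \<phi> \<subseteq> {v..<v + k} \<and> lipschitz_fm L N \<phi> \<and>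
    (\<forall>M\<in>Mod L. \<forall>e. fm_value M \<phi> e = vaught L p (A n) N k M (\<lambda>i. e (v + i)))"
    using A(1) unfolding vaught_definable_def by blast
  then obtain \<phi> where \<phi>: "\<And>n. is_formula L (\<phi> n)" "\<And>n. fv (\<phi> n) \<subseteq> {v..<v + k}" "\<And>n. lipschitz_fm L N (\<phi> n)"
    "\<And>n M e. M \<in> Mod L \<Longrightarrow> fm_value M (\<phi> n) e = vaught L p (A n) N k M (\<lambda>i. e (v + i))"
    by metis
  show "\<exists>\<phi>. is_formula L \<phi> \<and> fv \<phi> \<subseteq> {v..<v + k} \<and> lipschitz_fm L N \<phi> \<and>
      (\<forall>M\<in>Mod L. \<forall>e. fm_value M \<phi> e \<in> {0..1} \<and> (\<forall>r\<ge>0. r < fm_value M \<phi> e \<longleftrightarrow>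
        \<not> meager_in Iso_topology {g \<in> isometries.
          r < B (act L g M) - N * tuple_dist k (\<lambda>i. inv g (p i)) (\<lambda>i. e (v + i))}))"
  proof (intro exI[of _ "SupN \<phi>"] conjI ballI allI impI)
    show "is_formula L (SupN \<phi>)"
      using \<phi>(1) admissible_seq_lipschitz[of L N \<phi>, OF \<phi>(3,2)] by simp
    show "fv (SupN \<phi>) \<subseteq> {v..<v + k}" using \<phi>(2) by auto
    show "lipschitz_fm L N (SupN \<phi>)" by (rule lipschitz_fm_seq(1)[OF \<phi>(3)])
    fix M :: "('f, 'r, 'u) struct" and e assume M: "M \<in> Mod L"
    have rng: "fm_value M (\<phi> n) e \<in> {0..1}" for n
      unfolding \<phi>(4)[OF M] by (rule vaught_greater(1)[OF A(2) M]) simp_all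
    show "fm_value M (SupN \<phi>) e \<in> {0..1}" by (rule fm_value_SupN(1)[OF rng])
    fix r :: real assume r: "r \<ge> 0"
    let ?T = "\<lambda>C. {g \<in> isometries. r < C (act L g M) - N * tuple_dist k (\<lambda>i. inv g (p i)) (\<lambda>i. e (v + i))}"
    have "?T B = (\<Union>n. ?T (A n))"
    proof (intro set_eqI)
      fix g
      let ?c = "N * tuple_dist k (\<lambda>i. inv g (p i)) (\<lambda>i. e (v + i))"
      \<comment> \<open>The penalty is moved to the level; since the sum is nonnegative, the
        hypothesis on \<open>B\<close> applies at each \<open>g\<close> separately.\<close>
      have "0 \<le> r + ?c" using r by (simp add: tuple_dist_nonneg)
      then have "r + ?c < B (act L g M) \<longleftrightarrow> (\<exists>n. r + ?c < A n (act L g M))" if "g \<in> isometries"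
        by (rule B[OF act_in_Mod[OF that M]])
      then show "g \<in> ?T B \<longleftrightarrow> g \<in> (\<Union>n. ?T (A n))"
        by (auto simp: less_diff_eq)
    qed
    moreover have "meager_in Iso_topology (\<Union>n. ?T (A n)) \<longleftrightarrow> (\<forall>n. meager_in Iso_topology (?T (A n)))"
      using meager_in_mono[of Iso_topology "\<Union>n. ?T (A n)"] meager_in_Union[of Iso_topology "\<lambda>n. ?T (A n)"]
      by blast
    moreover have "r < fm_value M (\<phi> n) e \<longleftrightarrow> \<not> meager_in Iso_topology (?T (A n))" for n
      unfolding \<phi>(4)[OF M] by (rule vaught_greater(2)[OF A(2) M _ r]) simp_all
    ultimately show "r < fm_value M (SupN \<phi>) e \<longleftrightarrow> \<not> meager_in Iso_topology (?T B)"
      unfolding fm_value_SupN(2)[OF rng] by simp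
  qed
qed

text \<open>From left to right, a bound \<open>c\<close> on the transform at an exact copy
  \<open>w'\<close> says that \<open>A\<close> is at most \<open>c\<close> plus \<open>m\<close>
  times the distance to \<open>w'\<close> for almost all \<open>g\<close>; so a small ball around
  \<open>w'\<close> lies in the wanted set up to a meager set. From right to left, the set is
  comeager in an open set, which contains a ball around \<open>w = inv h p\<close>. For large
  \<open>m\<close> the penalty cuts off everything outside a smaller ball, and the transform at
  \<open>w\<close> is bounded by what holds almost everywhere inside.\<close>

lemma nonmeager_complement_iff:
  fixes L :: "('f, 'r) language" and p :: "nat \<Rightarrow> 'u::urysohn_sphere" and N :: nat
  assumes L: "is_language L" and dense: "closure (range p) = UNIV"
    and A: "\<And>M. M \<in> Mod L \<Longrightarrow> 0 \<le> A M" "\<And>M. M \<in> Mod L \<Longrightarrow> A M \<le> q" and q: "q \<le> 1"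
    and meas: "A \<in> borel_measurable (restrict_space borel (Mod L))"
    and M: "M \<in> Mod L" and r: "0 \<le> r"
  shows "(\<exists>l\<ge>k. \<exists>m::nat. \<exists>w. r < trunc (q - vaught L p A m l M w - N * tuple_dist k w u - (m + N) * defect l p w))
    \<longleftrightarrow> \<not> meager_in Iso_topology {g \<in> isometries. r < q - A (act L g M) - N * tuple_dist k (\<lambda>i. inv g (p i)) u}"
    (is "?lhs \<longleftrightarrow> \<not> meager_in _ (?T r)")
proof -
  have A1: "A M \<le> 1" if "M \<in> Mod L" for M using A(2)[OF that] q by simp
  let ?V = "\<lambda>m l. vaught L p A (real m) l M"
  let ?D = "\<lambda>l g. tuple_dist l (\<lambda>i. inv g (p i))"
  have V01: "0 \<le> ?V m l w" for m l w
    using vaught_greater(1)[where A = A and p = p and k = l and N = m and u = w, OF A1 M] by simp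
  have Vlip: "?V m l w' \<le> ?V m l w + m * tuple_dist l w w'" for m l w w'
    by (rule vaught_lipschitz[OF A1 M]) simp_all
  have Vgr: "0 \<le> c \<Longrightarrow> c < ?V m l w \<longleftrightarrow>
      \<not> meager_in Iso_topology {g \<in> isometries. c < A (act L g M) - m * ?D l g w}" for c m l w
    by (rule vaught_greater(2)[OF A1 M]) simp_all
  show ?thesis
  proof
    assume ?lhs
    then obtain l m w where kl: "k \<le> l"
      and "r < trunc (q - ?V m l w - N * tuple_dist k w u - (m + N) * defect l p w)"
      by blast
    moreover have "q - ?V m l w - N * tuple_dist k w u - (m + N) * defect l p w \<le> 1"
    proof -
      have "0 \<le> N * tuple_dist k w u" "0 \<le> (m + N) * defect l p w"
        by (simp_all add: tuple_dist_nonneg defect_nonneg)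
      then show ?thesis using V01[of m l w] q by linarith
    qed
    ultimately have r1: "r < q - ?V m l w - N * tuple_dist k w u - (m + N) * defect l p w"
      using trunc_greater_iff[OF r] by blast
    obtain w' where w': "\<And>i j. i < l \<Longrightarrow> j < l \<Longrightarrow> dist (w' i) (w' j) = dist (p i) (p j)"
      "tuple_dist l w w' \<le> defect l p w"
      by (rule nearby_defect_0[of l p w]) blast
    define c where "c = ?V m l w'"
    have c0: "0 \<le> c" unfolding c_def by (rule V01)
    \<comment> \<open>Moving from \<open>w\<close> to \<open>w'\<close> costs \<open>m\<close> times
      the defect in the transform and \<open>N\<close> times the defect in the distance to
      \<open>u\<close>, which together is the multiple subtracted.\<close>
    have "c \<le> ?V m l w + m * defect l p w"
      using Vlip[of m l w' w] mult_left_mono[OF w'(2), of "real m"] unfolding c_def by simp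
    moreover have "tuple_dist k w' u \<le> tuple_dist k w u + defect l p w"
      using tuple_dist_triangle[of k w' u w] tuple_dist_mono[OF kl, of w w'] w'(2)
      by (simp add: tuple_dist_commute)
    then have "N * tuple_dist k w' u \<le> N * (tuple_dist k w u + defect l p w)"
      by (rule mult_left_mono) simp
    ultimately have r2: "r < q - c - N * tuple_dist k w' u"
      using r1 by (simp add: algebra_simps)
    \<comment> \<open>In the ball of radius \<epsilon> the estimate loses at most
      \<open>m * \<epsilon>\<close> in \<open>A\<close> and \<open>N * \<epsilon>\<close> in the
      penalty; the additional 1 keeps the loss strictly below the available room.\<close>
    define \<epsilon> where "\<epsilon> = (q - c - N * tuple_dist k w' u - r) / (m + N + 1)"
    have \<epsilon>: "\<epsilon> > 0" unfolding \<epsilon>_def using r2 by simp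
    have "(m + N) * \<epsilon> < (m + N + 1) * \<epsilon>" using \<epsilon> by simp
    also have "(m + N + 1) * \<epsilon> = q - c - N * tuple_dist k w' u - r"
      unfolding \<epsilon>_def by simp
    finally have r3: "r + (m + N) * \<epsilon> < q - c - N * tuple_dist k w' u" by simp
    let ?O = "{g \<in> isometries. ?D l g w' < \<epsilon>}"
    let ?C = "{g \<in> isometries. c < A (act L g M) - m * ?D l g w'}"
    have sub: "?O \<subseteq> ?T r \<union> ?C"
    proof
      fix g assume "g \<in> ?O"
      then have g: "g \<in> isometries" "?D l g w' < \<epsilon>" by auto
      show "g \<in> ?T r \<union> ?C"
      proof (cases "g \<in> ?C")
        case False
        then have "A (act L g M) \<le> c + m * ?D l g w'" using g(1) by simp
        moreover have "m * ?D l g w' \<le> m * \<epsilon>" using g(2) by (intro mult_left_mono) auto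
        moreover have "?D k g u \<le> \<epsilon> + tuple_dist k w' u"
          using tuple_dist_triangle[of k "\<lambda>i. inv g (p i)" u w'] g(2)
            tuple_dist_mono[OF kl, of "\<lambda>i. inv g (p i)" w'] by linarith
        then have "N * ?D k g u \<le> N * (\<epsilon> + tuple_dist k w' u)" by (rule mult_left_mono) simp
        ultimately have "r < q - A (act L g M) - N * ?D k g u"
          using r3 by (simp add: algebra_simps)
        then show ?thesis using g(1) by simp
      qed simp
    qed
    have C: "meager_in Iso_topology ?C"
      using Vgr[OF c0, of m l w'] unfolding c_def by simp
    have "\<not> meager_in Iso_topology ?O"
      by (rule nonmeager_isometries_near_tuple[OF w'(1) \<epsilon>])
    then show "\<not> meager_in Iso_topology (?T r)"
      by (rule contrapos_nn) (rule meager_in_mono[OF meager_in_Un[OF _ C] sub])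
  next
    assume nm: "\<not> meager_in Iso_topology (?T r)"
    \<comment> \<open>Some higher level still has a nonmeager superlevel set. The surplus pays for
      replacing \<open>g\<close> by the centre of a ball.\<close>
    have sub: "?T r \<subseteq> (\<Union>n. ?T (r + inverse (real (Suc n))))"
    proof
      fix g assume "g \<in> ?T r"
      then have g: "g \<in> isometries" "0 < q - A (act L g M) - N * ?D k g u - r" by auto
      obtain n where "inverse (real (Suc n)) < q - A (act L g M) - N * ?D k g u - r"
        using reals_Archimedean[OF g(2)] by blast
      then show "g \<in> (\<Union>n. ?T (r + inverse (real (Suc n))))"
        using g(1) by (intro UN_I[of n]) auto
    qed
    have "\<exists>n. \<not> meager_in Iso_topology (?T (r + inverse (real (Suc n))))"
    proof (rule ccontr)
      assume "\<nexists>n. \<not> meager_in Iso_topology (?T (r + inverse (real (Suc n))))"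
      then have "meager_in Iso_topology (\<Union>n. ?T (r + inverse (real (Suc n))))"
        by (intro meager_in_Union) simp
      then show False using nm meager_in_mono[OF _ sub] by simp
    qed
    then obtain n where n: "\<not> meager_in Iso_topology (?T (r + inverse (real (Suc n))))" ..
    define \<epsilon> where "\<epsilon> = inverse (real (Suc n))"
    have \<epsilon>: "\<epsilon> > 0" "\<not> meager_in Iso_topology (?T (r + \<epsilon>))"
      using n unfolding \<epsilon>_def by simp_all
    have "baire_property_in (top_of_set isometries) (?T (r + \<epsilon>))"
    proof (rule baire_property_in_borel)
      let ?R = "restrict_space borel (isometries :: ('u \<Rightarrow> 'u) set)"
      have "(\<lambda>g. act L g M) \<in> measurable ?R (restrict_space borel (Mod L))"
        using continuous_on_act[OF L M] act_in_Mod[OF _ M]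
        by (intro measurable_restrict_space2 borel_measurable_continuous_on_restrict)
          (auto simp: space_restrict_space)
      then have "(\<lambda>g. A (act L g M)) \<in> borel_measurable ?R"
        by (rule measurable_compose[OF _ meas])
      moreover have "(\<lambda>g. ?D k g u) \<in> borel_measurable ?R"
        by (intro borel_measurable_continuous_on_restrict continuous_on_tuple_dist_inv)
      ultimately have "(\<lambda>g. q - A (act L g M) - N * ?D k g u) \<in> borel_measurable ?R"
        by measurable
      then have "{g \<in> space ?R. r + \<epsilon> < q - A (act L g M) - N * ?D k g u} \<in> sets ?R"
        by measurable
      then show "?T (r + \<epsilon>) \<in> sets ?R" by (simp add: space_restrict_space)
    qed
    then obtain G where G: "openin Iso_topology G" "G \<noteq> {}" "meager_in Iso_topology (G - ?T (r + \<epsilon>))"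
      using nonmeager_baire_propertyE[OF _ \<epsilon>(2)] unfolding Iso_topology_def by blast
    then obtain h where h: "h \<in> G" "h \<in> isometries"
      using openin_subset[OF G(1)] by auto
    obtain l \<delta> where kl: "k \<le> l" and \<delta>: "\<delta> > 0"
      "\<And>g. g \<in> isometries \<Longrightarrow> tuple_dist l (\<lambda>i. inv g (p i)) (\<lambda>i. inv h (p i)) < \<delta> \<Longrightarrow> g \<in> G"
      by (rule Iso_neighbourhood[OF dense G(1) h(1), of k]) blast
    define w where "w = (\<lambda>i. inv h (p i))"
    have w: "dist (w i) (w j) = dist (p i) (p j)" for i j
      unfolding w_def by (rule isometries_dist[OF isometries_inv[OF h(2)]])
    \<comment> \<open>The radius is at most \<delta>, so that the ball stays inside
      \<open>G\<close>, and small enough that \<open>N * \<delta>' < \<epsilon>\<close>.\<close>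
    define \<delta>' where "\<delta>' = min \<delta> (\<epsilon> / (N + 1))"
    have \<delta>': "\<delta>' > 0" "\<delta>' \<le> \<delta>" unfolding \<delta>'_def using \<delta>(1) \<epsilon>(1) by auto
    have "N * \<delta>' < (N + 1) * \<delta>'" using \<delta>'(1) by simp
    also have "\<dots> \<le> (N + 1) * (\<epsilon> / (N + 1))" unfolding \<delta>'_def by (intro mult_left_mono) auto
    finally have N\<delta>: "N * \<delta>' < \<epsilon>" by simp
    \<comment> \<open>With \<open>m * \<delta>' > 1\<close> the penalty exceeds every value of
      \<open>A\<close> outside the ball of radius \<open>\<delta>'\<close>.\<close>
    obtain m :: nat where m: "1 / \<delta>' < m" using reals_Archimedean2 by blast
    then have m\<delta>: "1 < m * \<delta>'" using \<delta>'(1) by (simp add: field_simps)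
    \<comment> \<open>Membership in \<open>?T (r + \<epsilon>)\<close> is solved for
      \<open>A\<close>, and the distance from \<open>inv g p\<close> to \<open>u\<close> is replaced
      by that from \<open>w\<close>, which is larger by at most \<open>\<delta>'\<close>.\<close>
    define c where "c = q - r - \<epsilon> - N * tuple_dist k w u + N * \<delta>'"
    let ?O = "{g \<in> isometries. ?D l g w < \<delta>'}"
    have OG: "?O \<subseteq> G" using \<delta>(2) \<delta>'(2) unfolding w_def by fastforce
    have bound: "A (act L g M) < c" if "g \<in> ?O" "g \<in> ?T (r + \<epsilon>)" for g
    proof -
      have "tuple_dist k w u \<le> ?D k g u + ?D l g w"
        using tuple_dist_triangle[of k w u "\<lambda>i. inv g (p i)"]
          tuple_dist_mono[OF kl, of "\<lambda>i. inv g (p i)" w] tuple_dist_commute[of k w "\<lambda>i. inv g (p i)"]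
        by linarith
      then have "tuple_dist k w u \<le> ?D k g u + \<delta>'" using that(1) by simp
      then have "N * tuple_dist k w u \<le> N * (?D k g u + \<delta>')" by (rule mult_left_mono) simp
      then show ?thesis using that(2) unfolding c_def by (simp add: algebra_simps)
    qed
    \<comment> \<open>The transform is described only at levels \<open>c \<ge> 0\<close>. The ball
      is nonmeager, so it contains some \<open>g\<close> in \<open>?T (r + \<epsilon>)\<close>, and
      there \<open>0 \<le> A (act L g M) < c\<close>.\<close>
    have "\<not> meager_in Iso_topology ?O"
      by (rule nonmeager_isometries_near_tuple[OF w \<delta>'(1)])
    then have "\<not> ?O \<subseteq> G - ?T (r + \<epsilon>)" by (rule contrapos_nn) (rule meager_in_mono[OF G(3)])
    then obtain g where g: "g \<in> ?O" "g \<in> ?T (r + \<epsilon>)" using OG by blast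
    then have c0: "0 \<le> c" using bound[OF g] A(1)[OF act_in_Mod[OF _ M], of g] by simp
    have "?V m l w \<le> c"
    proof (rule ccontr)
      assume "\<not> ?thesis"
      then have nC: "\<not> meager_in Iso_topology {g \<in> isometries. c < A (act L g M) - m * ?D l g w}"
        using Vgr[OF c0, of m l w] by simp
      have "{g \<in> isometries. c < A (act L g M) - m * ?D l g w} \<subseteq> G - ?T (r + \<epsilon>)" (is "?S \<subseteq> _")
      proof
        fix g assume "g \<in> {g \<in> isometries. c < A (act L g M) - m * ?D l g w}"
        then have g: "g \<in> isometries" "c < A (act L g M) - m * ?D l g w" by auto
        have "?D l g w < \<delta>'"
        proof (rule ccontr)
          assume "\<not> ?thesis"
          then have "m * \<delta>' \<le> m * ?D l g w" by (intro mult_left_mono) auto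
          then show False using g(2) m\<delta> c0 A1[OF act_in_Mod[OF g(1) M]] by linarith
        qed
        then have gO: "g \<in> ?O" using g(1) by simp
        moreover have "0 \<le> m * ?D l g w" by (simp add: tuple_dist_nonneg)
        then have "c < A (act L g M)" using g(2) by linarith
        ultimately show "g \<in> G - ?T (r + \<epsilon>)" using bound[OF gO] OG by fastforce
      qed
      then have "meager_in Iso_topology ?S" by (rule meager_in_mono[OF G(3)])
      then show False using nC by simp
    qed
    moreover have "defect l p w = 0" by (rule defect_eq_0) (rule w)
    ultimately have "r < q - ?V m l w - N * tuple_dist k w u - (m + N) * defect l p w"
      using N\<delta> unfolding c_def by simp
    moreover have "q - ?V m l w - N * tuple_dist k w u - (m + N) * defect l p w \<le> 1"
    proof -
      have "0 \<le> N * tuple_dist k w u" "0 \<le> (m + N) * defect l p w"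
        by (simp_all add: tuple_dist_nonneg defect_nonneg)
      then show ?thesis using V01[of m l w] q by linarith
    qed
    ultimately have "r < trunc (q - ?V m l w - N * tuple_dist k w u - (m + N) * defect l p w)"
      using trunc_greater_iff[OF r] by blast
    then show ?lhs using kl by blast
  qed
qed

lemma ex_prod_decode: "(\<exists>n. P (prod_decode n)) \<longleftrightarrow> (\<exists>x. P x)"
  by (metis prod_encode_inverse)

lemma ex_add_iff: "(\<exists>j. P (k + j)) \<longleftrightarrow> (\<exists>l\<ge>k. P l)" for k :: nat
  by (metis le_add1 le_Suc_ex)

lemma vaught_definable_complement:
  fixes L :: "('f, 'r) language" and p :: "nat \<Rightarrow> 'u::urysohn_sphere"
  assumes L: "is_language L" and dense: "closure (range p) = UNIV"
    and A: "\<And>M. M \<in> Mod L \<Longrightarrow> 0 \<le> A M" "\<And>M. M \<in> Mod L \<Longrightarrow> A M \<le> q" and q: "q \<le> 1"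
    and meas: "A \<in> borel_measurable (restrict_space borel (Mod L))"
    and def: "vaught_definable L p A"
  shows "vaught_definable L p (\<lambda>M. q - A M)"
proof (rule vaught_definableI)
  fix M :: "('f, 'r, 'u) struct" assume M: "M \<in> Mod L"
  show "q - A M \<le> 1" using A(1)[OF M] q by simp
next
  fix N k v :: nat
  \<comment> \<open>Definability of \<open>A\<close> is used with offset \<open>v + k\<close>, so
    that the free variables of these formulas fall into the block that \<open>sup_penalty\<close>
    quantifies.\<close>
  have "\<forall>m l. \<exists>\<phi>. is_formula L \<phi> \<and> fv \<phi> \<subseteq> {v + k..<v + k + l} \<and> lipschitz_fm L (real m) \<phi> \<and>
    (\<forall>M\<in>Mod L. \<forall>e. fm_value M \<phi> e = vaught L p A m l M (\<lambda>i. e (v + k + i)))"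
    using def unfolding vaught_definable_def by blast
  then obtain \<phi> where \<phi>: "\<And>m l. is_formula L (\<phi> m l)" "\<And>m l. fv (\<phi> m l) \<subseteq> {v + k..<v + k + l}"
    "\<And>m l M e. M \<in> Mod L \<Longrightarrow> fm_value M (\<phi> m l) e = vaught L p A (real m) l M (\<lambda>i. e (v + k + i))"
    by metis
  \<comment> \<open>The lengths \<open>k + l'\<close> run through all \<open>l \<ge> k\<close>, and
    one index \<open>n\<close> codes the pair of \<open>l'\<close> and \<open>m\<close>, since only
    a supremum over the natural numbers is available.\<close>
  define \<xi> where "\<xi> n = (case prod_decode n of (l', m) \<Rightarrow>
    sup_penalty p (\<lambda>x. q - x) k (k + l') v N (real m + real N) (\<phi> m (k + l')))" for n
  have lip: "lipschitz_fm L N (\<xi> n)" for n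
    unfolding \<xi>_def lipschitz_fm_def
    by (auto split: prod.splits intro!: modulus_penalty_le[OF L \<phi>(1)] \<phi>(2))
  have fv: "fv (\<xi> n) \<subseteq> {v..<v + k}" for n
    unfolding \<xi>_def by (auto split: prod.splits dest!: subsetD[OF fv_sup_penalty[OF \<phi>(2)], rotated])
  have fm: "is_formula L (\<xi> n)" for n
    unfolding \<xi>_def
    by (auto split: prod.splits intro!: is_formula_sup_penalty \<phi>(1) continuous_intros)
  show "\<exists>\<phi>. is_formula L \<phi> \<and> fv \<phi> \<subseteq> {v..<v + k} \<and> lipschitz_fm L N \<phi> \<and>
      (\<forall>M\<in>Mod L. \<forall>e. fm_value M \<phi> e \<in> {0..1} \<and> (\<forall>r\<ge>0. r < fm_value M \<phi> e \<longleftrightarrow>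
        \<not> meager_in Iso_topology {g \<in> isometries.
          r < q - A (act L g M) - N * tuple_dist k (\<lambda>i. inv g (p i)) (\<lambda>i. e (v + i))}))"
  proof (intro exI[of _ "SupN \<xi>"] conjI ballI allI impI)
    show "is_formula L (SupN \<xi>)"
      using fm admissible_seq_lipschitz[of L N \<xi>, OF lip fv] by simp
    show "fv (SupN \<xi>) \<subseteq> {v..<v + k}" using fv by auto
    show "lipschitz_fm L N (SupN \<xi>)" by (rule lipschitz_fm_seq(1)[OF lip])
    fix M :: "('f, 'r, 'u) struct" and e assume M: "M \<in> Mod L"
    let ?W = "\<lambda>m l w. trunc (q - vaught L p A (real m) l M w -
      N * tuple_dist k w (\<lambda>i. e (v + i)) - (real m + real N) * defect l p w)"
    have val: "fm_value M (\<xi> n) e \<in> {0..1}"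
      "r < fm_value M (\<xi> n) e \<longleftrightarrow> (case prod_decode n of (l', m) \<Rightarrow> \<exists>w. r < ?W m (k + l') w)" for n r
      unfolding \<xi>_def
      using fm_value_sup_penalty[of M _ "vaught L p A _ _ M", OF \<phi>(3)[OF M] vaught_cong] by (auto split: prod.splits)
    show "fm_value M (SupN \<xi>) e \<in> {0..1}" by (rule fm_value_SupN(1)[OF val(1)])
    fix r :: real assume r: "r \<ge> 0"
    have "r < fm_value M (SupN \<xi>) e \<longleftrightarrow> (\<exists>l' m w. r < ?W m (k + l') w)"
    proof -
      have "r < fm_value M (SupN \<xi>) e \<longleftrightarrow> (\<exists>n. case prod_decode n of (l', m) \<Rightarrow> \<exists>w. r < ?W m (k + l') w)"
        unfolding fm_value_SupN(2)[OF val(1)] val(2) ..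
      also have "\<dots> \<longleftrightarrow> (\<exists>x. case x of (l', m) \<Rightarrow> \<exists>w. r < ?W m (k + l') w)"
        by (rule ex_prod_decode)
      finally show ?thesis by simp
    qed
    also have "\<dots> \<longleftrightarrow> (\<exists>l\<ge>k. \<exists>m w. r < ?W m l w)"
      by (rule ex_add_iff)
    also have "\<dots> \<longleftrightarrow> \<not> meager_in Iso_topology {g \<in> isometries.
          r < q - A (act L g M) - N * tuple_dist k (\<lambda>i. inv g (p i)) (\<lambda>i. e (v + i))}"
      using nonmeager_complement_iff[OF L dense A q meas M r, of k N "\<lambda>i. e (v + i)"] by simp
    finally show "r < fm_value M (SupN \<xi>) e \<longleftrightarrow> \<not> meager_in Iso_topology {g \<in> isometries.
          r < q - A (act L g M) - N * tuple_dist k (\<lambda>i. inv g (p i)) (\<lambda>i. e (v + i))}" .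
  qed
qed

section \<open>Atomic grey subsets\<close>

text \<open>An isometry in the set on the right supplies the tuple \<open>inv g p\<close>, whose
  defect is 0, as a witness for every \<open>m\<close> at once. Conversely, a witness for a large
  \<open>m\<close> has small defect, and uniform continuity carries it to an exact copy and on to a
  whole ball of isometries; the room between \<open>r\<close> and \<open>r'\<close> absorbs the
  loss.\<close>

lemma nonmeager_atomic_iff:
  fixes L :: "('f, 'r) language" and p :: "nat \<Rightarrow> 'u::urysohn_sphere" and N :: nat
    and W :: "(nat \<Rightarrow> 'u) \<Rightarrow> real"
  assumes W: "\<And>w. 0 \<le> W w" "\<And>w. W w \<le> 1"
    and unif: "\<And>\<epsilon>. \<epsilon> > 0 \<Longrightarrow> \<exists>\<delta>>0. \<forall>w w'. tuple_dist l w w' < \<delta> \<longrightarrow> \<bar>W w - W w'\<bar> < \<epsilon>"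
    and kl: "k \<le> l" and r: "0 \<le> r"
  shows "(\<exists>r'>r. \<forall>m::nat. \<exists>w. r' < trunc (W w - N * tuple_dist k w u - m * defect l p w)) \<longleftrightarrow>
    \<not> meager_in Iso_topology
      {g \<in> isometries. r < W (\<lambda>i. inv g (p i)) - N * tuple_dist k (\<lambda>i. inv g (p i)) u}"
    (is "?lhs \<longleftrightarrow> \<not> meager_in _ ?T")
proof -
  define H where "H w = W w - N * tuple_dist k w u" for w
  have H_le: "H w \<le> 1" for w
  proof -
    have "0 \<le> N * tuple_dist k w u" by (simp add: tuple_dist_nonneg)
    then show ?thesis unfolding H_def using W(2)[of w] by linarith
  qed
  have T_eq: "?T = {g \<in> isometries. r < H (\<lambda>i. inv g (p i))}" by (simp add: H_def)
  have trunc_iff: "r' < trunc (H w - m * defect l p w) \<longleftrightarrow> r' < H w - m * defect l p w" if "0 \<le> r'" for r' w and m :: nat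
  proof (rule trunc_greater_iff[OF that])
    have "0 \<le> m * defect l p w" by (simp add: defect_nonneg)
    then show "H w - m * defect l p w \<le> 1" using H_le[of w] by linarith
  qed
  have "?lhs \<longleftrightarrow> \<not> meager_in Iso_topology {g \<in> isometries. r < H (\<lambda>i. inv g (p i))}"
    unfolding H_def[symmetric]
  proof
    assume "\<exists>r'>r. \<forall>m::nat. \<exists>w. r' < trunc (H w - m * defect l p w)"
    then obtain r' where r': "r < r'" "\<And>m::nat. \<exists>w. r' < trunc (H w - m * defect l p w)" by blast
    \<comment> \<open>Two moves, from \<open>w\<close> to the exact copy \<open>w'\<close> and from
      there to \<open>inv g p\<close>, cost less than \<open>2 * \<epsilon>\<close> each: \<epsilon>
      for \<open>W\<close> and \<epsilon> for the penalty.\<close>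
    define \<epsilon> where "\<epsilon> = (r' - r) / 4"
    have \<epsilon>: "\<epsilon> > 0" using r'(1) by (simp add: \<epsilon>_def)
    obtain \<delta>0 where \<delta>0: "\<delta>0 > 0" "\<And>w w'. tuple_dist l w w' < \<delta>0 \<Longrightarrow> \<bar>W w - W w'\<bar> < \<epsilon>"
      using unif[OF \<epsilon>] by blast
    define \<delta> where "\<delta> = min \<delta>0 (\<epsilon> / (N + 1))"
    have \<delta>: "\<delta> > 0" unfolding \<delta>_def using \<delta>0(1) \<epsilon> by simp
    have "N * \<delta> \<le> (N + 1) * \<delta>" using \<delta> by simp
    also have "\<dots> \<le> (N + 1) * (\<epsilon> / (N + 1))" unfolding \<delta>_def by (intro mult_left_mono) auto
    finally have N\<delta>: "N * \<delta> \<le> \<epsilon>" by simp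
    have H_close: "H b - 2 * \<epsilon> < H a" if "tuple_dist l a b < \<delta>" for a b
    proof -
      have "\<bar>W a - W b\<bar> < \<epsilon>" by (rule \<delta>0(2)) (use that in \<open>simp add: \<delta>_def\<close>)
      moreover have "tuple_dist k a u \<le> tuple_dist k b u + \<delta>"
        using tuple_dist_triangle[of k a u b] tuple_dist_mono[OF kl, of a b] that by linarith
      then have "N * tuple_dist k a u \<le> N * (tuple_dist k b u + \<delta>)" by (rule mult_left_mono) simp
      ultimately show ?thesis unfolding H_def using N\<delta> by (simp add: distrib_left)
    qed
    \<comment> \<open>As \<open>H \<le> 1\<close>, the inequality \<open>m * \<delta> > 1\<close>
      forces the defect of a witness below \<delta>.\<close>
    obtain m :: nat where m: "1 / \<delta> < m" using reals_Archimedean2 by blast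
    then have m\<delta>: "1 < m * \<delta>" using \<delta> by (simp add: field_simps)
    obtain w where "r' < trunc (H w - m * defect l p w)" using r'(2) by blast
    then have w: "r' < H w - m * defect l p w" using trunc_iff r r'(1) by simp
    then have "m * defect l p w < m * \<delta>" using H_le[of w] r r'(1) m\<delta> by linarith
    then have def_less: "defect l p w < \<delta>" by (rule mult_left_less_imp_less) simp
    have "0 \<le> m * defect l p w" by (simp add: defect_nonneg)
    then have Hw: "r' < H w" using w by linarith
    obtain w' where w': "\<And>i j. i < l \<Longrightarrow> j < l \<Longrightarrow> dist (w' i) (w' j) = dist (p i) (p j)"
      "tuple_dist l w w' \<le> defect l p w"
      by (rule nearby_defect_0[of l p w]) blast
    have "H w - 2 * \<epsilon> < H w'"
      by (rule H_close) (use w'(2) def_less in \<open>simp add: tuple_dist_commute\<close>)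
    then have "r' - 2 * \<epsilon> < H w'" using Hw by simp
    have sub: "{g \<in> isometries. tuple_dist l (\<lambda>i. inv g (p i)) w' < \<delta>} \<subseteq> {g \<in> isometries. r < H (\<lambda>i. inv g (p i))}"
    proof (intro subsetI CollectI conjI; elim CollectE conjE)
      fix g assume "tuple_dist l (\<lambda>i. inv g (p i)) w' < \<delta>"
      then have "H w' - 2 * \<epsilon> < H (\<lambda>i. inv g (p i))" by (rule H_close)
      moreover have "4 * \<epsilon> = r' - r" by (simp add: \<epsilon>_def)
      ultimately show "r < H (\<lambda>i. inv g (p i))" using \<open>r' - 2 * \<epsilon> < H w'\<close> by linarith
    qed
    have "\<not> meager_in Iso_topology {g \<in> isometries. tuple_dist l (\<lambda>i. inv g (p i)) w' < \<delta>}"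
      by (rule nonmeager_isometries_near_tuple[OF w'(1) \<delta>])
    then show "\<not> meager_in Iso_topology {g \<in> isometries. r < H (\<lambda>i. inv g (p i))}"
      by (rule contrapos_nn) (rule meager_in_mono[OF _ sub])
  next
    assume "\<not> meager_in Iso_topology {g \<in> isometries. r < H (\<lambda>i. inv g (p i))}"
    then have "{g \<in> isometries. r < H (\<lambda>i. inv g (p i))} \<noteq> {}"
      by (rule contrapos_nn) (simp only: meager_in_empty)
    then obtain g where g: "g \<in> isometries" "r < H (\<lambda>i. inv g (p i))" by blast
    then obtain r' where r': "r < r'" "r' < H (\<lambda>i. inv g (p i))" using dense by blast
    have "defect l p (\<lambda>i. inv g (p i)) = 0"
      by (rule defect_eq_0) (rule isometries_dist[OF isometries_inv[OF g(1)]])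
    then have "r' < H (\<lambda>i. inv g (p i)) - m * defect l p (\<lambda>i. inv g (p i))" for m :: nat
      using r'(2) by simp
    then have "r' < trunc (H (\<lambda>i. inv g (p i)) - m * defect l p (\<lambda>i. inv g (p i)))" for m :: nat
      using r r'(1) by (intro iffD2[OF trunc_iff]) auto
    then show "\<exists>r'>r. \<forall>m::nat. \<exists>w. r' < trunc (H w - m * defect l p w)" using r'(1) by blast
  qed
  then show ?thesis unfolding T_eq .
qed

text \<open>By the equivariance \<open>act\<close>, the value in the translated structure at
  \<open>p\<close> is the value in \<open>M\<close> at \<open>inv g p\<close>, so the transform
  becomes a supremum over isometric copies of \<open>p\<close>. The infimum over the multiples of
  the defect expresses it.\<close>

lemma vaught_definable_atomic:
  fixes L :: "('f, 'r) language" and p :: "nat \<Rightarrow> 'u::urysohn_sphere"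
    and W :: "('f, 'r, 'u) struct \<Rightarrow> (nat \<Rightarrow> 'u) \<Rightarrow> real"
  assumes L: "is_language L"
    and \<psi>: "\<And>v. is_formula L (\<psi> v)" "\<And>v. fv (\<psi> v) \<subseteq> {v..<v + l0}"
    and val: "\<And>M v e. M \<in> Mod L \<Longrightarrow> fm_value M (\<psi> v) e = W M (\<lambda>i. e (v + i))"
    and unif: "\<And>M \<epsilon>. M \<in> Mod L \<Longrightarrow> \<epsilon> > 0 \<Longrightarrow>
      \<exists>\<delta>>0. \<forall>w w'. tuple_dist l0 w w' < \<delta> \<longrightarrow> \<bar>W M w - W M w'\<bar> < \<epsilon>"
    and act: "\<And>M g. M \<in> Mod L \<Longrightarrow> g \<in> isometries \<Longrightarrow> W (act L g M) p = W M (\<lambda>i. inv g (p i))"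
    and \<theta>: "\<And>x. 0 \<le> \<theta> x" "\<And>x. \<theta> x \<le> 1" "\<And>x y. \<bar>\<theta> x - \<theta> y\<bar> \<le> C * \<bar>x - y\<bar>"
  shows "vaught_definable L p (\<lambda>M. \<theta> (W M p))"
proof (rule vaught_definableI)
  show "\<theta> (W M p) \<le> 1" for M by (rule \<theta>(2))
next
  fix N k v :: nat
  \<comment> \<open>The tuple must be long enough for the comparison with \<open>u\<close> and for
    all variables of the atomic formula.\<close>
  define l where "l = max k l0"
  have kl: "k \<le> l" and l0l: "l0 \<le> l" by (simp_all add: l_def)
  \<comment> \<open>A Lipschitz constant of \<theta> by which one may divide.\<close>
  define D where "D = max C 1"
  have D: "D > 0" "\<bar>\<theta> x - \<theta> y\<bar> \<le> D * \<bar>x - y\<bar>" for x y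
    using \<theta>(3)[of x y] mult_right_mono[of C D "\<bar>x - y\<bar>"] by (auto simp: D_def intro: order_trans)
  have unif': "\<exists>\<delta>>0. \<forall>w w'. tuple_dist l w w' < \<delta> \<longrightarrow> \<bar>\<theta> (W M w) - \<theta> (W M w')\<bar> < \<epsilon>"
    if M: "M \<in> Mod L" and "\<epsilon> > 0" for M \<epsilon>
  proof -
    obtain \<delta> where \<delta>: "\<delta> > 0" "\<And>w w'. tuple_dist l0 w w' < \<delta> \<Longrightarrow> \<bar>W M w - W M w'\<bar> < \<epsilon> / D"
      using unif[OF M, of "\<epsilon> / D"] D(1) \<open>\<epsilon> > 0\<close> by auto
    have "\<bar>\<theta> (W M w) - \<theta> (W M w')\<bar> < \<epsilon>" if "tuple_dist l w w' < \<delta>" for w w'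
    proof -
      have "tuple_dist l0 w w' < \<delta>" using tuple_dist_mono[OF l0l, of w w'] that by simp
      then have "D * \<bar>W M w - W M w'\<bar> < \<epsilon>" using \<delta>(2)[of w w'] D(1) by (simp add: field_simps)
      then show ?thesis using D(2)[of "W M w" "W M w'"] by simp
    qed
    then show ?thesis using \<delta>(1) by blast
  qed
  \<comment> \<open>Uniform continuity, applied to tuples at distance 0, shows that
    \<open>W M\<close> depends only on the first \<open>l0\<close> entries.\<close>
  have W_cong: "W M w = W M w'" if M: "M \<in> Mod L" and eq: "\<And>i. i < l \<Longrightarrow> w i = w' i" for M w w'
  proof -
    have "tuple_dist l0 w w' = tuple_dist l0 w w" using eq l0l by (intro tuple_dist_cong) auto
    then have "\<bar>W M w - W M w'\<bar> < \<epsilon>" if "\<epsilon> > 0" for \<epsilon>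
      using unif[OF M that] by auto
    from this[of "\<bar>W M w - W M w'\<bar>"] show ?thesis by auto
  qed
  have cont: "continuous_on UNIV \<theta>"
    unfolding continuous_on_iff
  proof (intro ballI allI impI)
    fix x e :: real assume "e > 0"
    then show "\<exists>d>0. \<forall>x'\<in>UNIV. dist x' x < d \<longrightarrow> dist (\<theta> x') (\<theta> x) < e"
      using D by (intro exI[of _ "e / D"]) (fastforce simp: dist_real_def field_simps intro: le_less_trans)
  qed
  define \<xi> where "\<xi> m = sup_penalty p \<theta> k l v N (real m) (\<psi> (v + k))" for m
  have fv_\<psi>: "fv (\<psi> (v + k)) \<subseteq> {v + k..<v + k + l}" using \<psi>(2)[of "v + k"] l0l by force
  have lip: "lipschitz_fm L N (\<xi> m)" for m
    unfolding \<xi>_def lipschitz_fm_def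
    by (intro allI impI modulus_penalty_le[OF L \<psi>(1) fv_\<psi> kl]) simp_all
  have fv: "fv (\<xi> m) \<subseteq> {v..<v + k}" for m
    unfolding \<xi>_def by (rule fv_sup_penalty[OF fv_\<psi> kl])
  have fm: "is_formula L (\<xi> m)" for m
    unfolding \<xi>_def by (rule is_formula_sup_penalty[OF \<psi>(1) cont])
  show "\<exists>\<phi>. is_formula L \<phi> \<and> fv \<phi> \<subseteq> {v..<v + k} \<and> lipschitz_fm L N \<phi> \<and>
      (\<forall>M\<in>Mod L. \<forall>e. fm_value M \<phi> e \<in> {0..1} \<and> (\<forall>r\<ge>0. r < fm_value M \<phi> e \<longleftrightarrow>
        \<not> meager_in Iso_topology {g \<in> isometries.
          r < \<theta> (W (act L g M) p) - N * tuple_dist k (\<lambda>i. inv g (p i)) (\<lambda>i. e (v + i))}))"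
  proof (intro exI[of _ "InfN \<xi>"] conjI ballI allI impI)
    show "is_formula L (InfN \<xi>)"
      using fm admissible_seq_lipschitz[of L N \<xi>, OF lip fv] by simp
    show "fv (InfN \<xi>) \<subseteq> {v..<v + k}" using fv by auto
    show "lipschitz_fm L N (InfN \<xi>)" by (rule lipschitz_fm_seq(2)[OF lip])
    fix M :: "('f, 'r, 'u) struct" and e assume M: "M \<in> Mod L"
    have v: "fm_value M (\<psi> (v + k)) e = W M (\<lambda>i. e (v + k + i))" for e
      by (rule val[OF M])
    have rng: "fm_value M (\<xi> m) e \<in> {0..1}"
      and gr: "r < fm_value M (\<xi> m) e \<longleftrightarrow> (\<exists>w. r < trunc (\<theta> (W M w)
        - N * tuple_dist k w (\<lambda>i. e (v + i)) - m * defect l p w))" for m r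
      unfolding \<xi>_def
      using fm_value_sup_penalty[of M _ "W M", OF v W_cong[OF M] kl] by auto
    show "fm_value M (InfN \<xi>) e \<in> {0..1}" by (rule fm_value_InfN(1)[OF rng])
    fix r :: real assume r: "r \<ge> 0"
    have eq: "{g \<in> isometries. r < \<theta> (W (act L g M) p) - N * tuple_dist k (\<lambda>i. inv g (p i)) (\<lambda>i. e (v + i))} =
      {g \<in> isometries. r < \<theta> (W M (\<lambda>i. inv g (p i))) - N * tuple_dist k (\<lambda>i. inv g (p i)) (\<lambda>i. e (v + i))}"
      using act[OF M] by auto
    show "r < fm_value M (InfN \<xi>) e \<longleftrightarrow> \<not> meager_in Iso_topology {g \<in> isometries.
        r < \<theta> (W (act L g M) p) - N * tuple_dist k (\<lambda>i. inv g (p i)) (\<lambda>i. e (v + i))}"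
      unfolding fm_value_InfN(2)[OF rng] gr eq
      by (rule nonmeager_atomic_iff[of "\<lambda>w. \<theta> (W M w)", OF \<theta>(1,2) unif'[OF M] kl r])
  qed
qed

text \<open>The transform looks at \<open>A\<close> only on \<open>Mod L\<close>. The constant
  sequence \<open>A\<close> has supremum \<open>B\<close> there.\<close>

lemma vaught_definable_cong:
  fixes L :: "('f, 'r) language" and p :: "nat \<Rightarrow> 'u::metric_space"
  assumes "vaught_definable L p A" "\<And>M. M \<in> Mod L \<Longrightarrow> A M \<le> 1" "\<And>M. M \<in> Mod L \<Longrightarrow> A M = B M"
  shows "vaught_definable L p B"
  by (rule vaught_definable_Sup[of L p "\<lambda>_. A"]) (simp_all add: assms(1,2) assms(3)[symmetric])

text \<open>The ramps \<open>min q (max 0 (j * (x - s)))\<close> are Lipschitz and increase with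
  \<open>j\<close> to \<open>q\<close> times the indicator of \<open>x > s\<close>, which reduces
  the indicator to a countable supremum of the previous case.\<close>

lemma vaught_definable_atomic_indicator:
  fixes L :: "('f, 'r) language" and p :: "nat \<Rightarrow> 'u::urysohn_sphere"
    and W :: "('f, 'r, 'u) struct \<Rightarrow> (nat \<Rightarrow> 'u) \<Rightarrow> real"
  assumes L: "is_language L"
    and \<psi>: "\<And>v. is_formula L (\<psi> v)" "\<And>v. fv (\<psi> v) \<subseteq> {v..<v + l0}"
    and val: "\<And>M v e. M \<in> Mod L \<Longrightarrow> fm_value M (\<psi> v) e = W M (\<lambda>i. e (v + i))"
    and unif: "\<And>M \<epsilon>. M \<in> Mod L \<Longrightarrow> \<epsilon> > 0 \<Longrightarrow>
      \<exists>\<delta>>0. \<forall>w w'. tuple_dist l0 w w' < \<delta> \<longrightarrow> \<bar>W M w - W M w'\<bar> < \<epsilon>"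
    and act: "\<And>M g. M \<in> Mod L \<Longrightarrow> g \<in> isometries \<Longrightarrow> W (act L g M) p = W M (\<lambda>i. inv g (p i))"
    and q: "0 \<le> q" "q \<le> 1"
  shows "vaught_definable L p (\<lambda>M. if s < W M p then q else 0)"
proof (rule vaught_definable_Sup)
  let ?\<theta> = "\<lambda>j x. min q (max 0 (real j * (x - s)))"
  show "vaught_definable L p (\<lambda>M. ?\<theta> j (W M p))" for j
  proof (rule vaught_definable_atomic[OF L \<psi> val unif act])
    fix x y :: real
    have "\<bar>?\<theta> j x - ?\<theta> j y\<bar> \<le> \<bar>real j * (x - s) - real j * (y - s)\<bar>" by linarith
    also have "real j * (x - s) - real j * (y - s) = real j * (x - y)" by (simp add: algebra_simps)
    finally show "\<bar>?\<theta> j x - ?\<theta> j y\<bar> \<le> real j * \<bar>x - y\<bar>" by (simp add: abs_mult)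
  qed (use q in auto)
  show "?\<theta> j (W M p) \<le> 1" for j M using q by simp
  fix M :: "('f, 'r, 'u) struct" and t :: real assume "M \<in> Mod L" and t: "0 \<le> t"
  show "t < (if s < W M p then q else 0) \<longleftrightarrow> (\<exists>j. t < ?\<theta> j (W M p))"
  proof (cases "s < W M p")
    case True
    obtain j :: nat where "t / (W M p - s) < j" using reals_Archimedean2 by blast
    then have "t < j * (W M p - s)" using True by (simp add: field_simps)
    then show ?thesis using True by auto
  next
    case False
    then have "real j * (W M p - s) \<le> 0" for j by (intro mult_nonneg_nonpos) auto
    then have "\<not> t < ?\<theta> j (W M p)" for j using t by (auto simp: min_def max_def not_less intro: order_trans)
    then show ?thesis using False t by auto
  qed
qed

lemma vaught_definable_zero:
  fixes L :: "('f, 'r) language" and p :: "nat \<Rightarrow> 'u::metric_space"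
  shows "vaught_definable L p (\<lambda>_. 0)"
proof (rule vaught_definableI)
  fix N k v :: nat
  let ?\<phi> = "Conn (\<lambda>_. 0) [] :: ('f, 'r) fm"
  have "conn_modulus 0 (\<lambda>_. 0) \<epsilon> \<le> real N * t" if "t \<ge> 0" for \<epsilon> t
    using that by (intro conn_modulus_le) auto
  then have "lipschitz_fm L N ?\<phi>" by (simp add: lipschitz_fm_def)
  moreover have "is_formula L ?\<phi>" by (simp add: is_connective_def)
  moreover have "\<not> r < 0 - N * tuple_dist k a b" if "r \<ge> 0" for r a and b :: "nat \<Rightarrow> 'u"
  proof -
    have "0 \<le> N * tuple_dist k a b" by (simp add: tuple_dist_nonneg)
    then show ?thesis using that by linarith
  qed
  ultimately show "\<exists>\<phi>. is_formula L \<phi> \<and> fv \<phi> \<subseteq> {v..<v + k} \<and> lipschitz_fm L N \<phi> \<and>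
      (\<forall>M\<in>Mod L. \<forall>e. fm_value M \<phi> e \<in> {0..1} \<and> (\<forall>r\<ge>0. r < fm_value M \<phi> e \<longleftrightarrow>
        \<not> meager_in Iso_topology {g \<in> isometries.
          r < 0 - N * tuple_dist k (\<lambda>i. inv g (p i)) (\<lambda>i. e (v + i))}))"
    by (intro exI[of _ ?\<phi>]) (auto simp: meager_in_empty)
qed simp

section \<open>Borel grey subsets\<close>

text \<open>All heights \<open>q\<close> are required together because rescaling height 1 to
  \<open>q\<close> would turn the constant \<open>N\<close> into \<open>N / q\<close>, which need
  not be a natural number. Borel measurability is included since complementation relies on the Baire
  property.\<close>

definition vaught_sets ::
    "('f, 'r) language \<Rightarrow> (nat \<Rightarrow> 'u) \<Rightarrow> ('f, 'r, 'u::metric_space) struct set set" where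
  "vaught_sets L p = {S \<in> sets (restrict_space borel (Mod L)).
    \<forall>q\<in>{0..1}. vaught_definable L p (\<lambda>M. if M \<in> S then q else 0)}"

lemma sigma_algebra_vaught_sets:
  fixes L :: "('f, 'r) language" and p :: "nat \<Rightarrow> 'u::urysohn_sphere"
  assumes L: "is_language L" and dense: "closure (range p) = UNIV"
  shows "sigma_algebra (Mod L) (vaught_sets L p)"
  unfolding sigma_algebra_iff2
proof (intro conjI ballI allI impI)
  let ?B = "restrict_space borel (Mod L) :: ('f, 'r, 'u) struct measure"
  have sp: "space ?B = Mod L" by (simp add: space_restrict_space)
  show "vaught_sets L p \<subseteq> Pow (Mod L)"
    unfolding vaught_sets_def using sets.sets_into_space[of _ ?B] sp by auto
  show "{} \<in> vaught_sets L p"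
    unfolding vaught_sets_def by (simp add: vaught_definable_zero)
  show "Mod L - S \<in> vaught_sets L p" if S: "S \<in> vaught_sets L p" for S
    unfolding vaught_sets_def
  proof (intro CollectI conjI ballI)
    have SB: "S \<in> sets ?B" using S by (simp add: vaught_sets_def)
    then show "Mod L - S \<in> sets ?B" using sets.compl_sets[of S ?B] sp by simp
    fix q :: real assume q: "q \<in> {0..1}"
    let ?A = "\<lambda>M. if M \<in> S then q else 0"
    have "vaught_definable L p (\<lambda>M. q - ?A M)"
    proof (rule vaught_definable_complement[OF L dense])
      show "?A \<in> borel_measurable ?B"
        using SB by (intro measurable_If_set) (auto intro: sets.Int_space_eq2[THEN subst])
      show "vaught_definable L p ?A" using S q by (simp add: vaught_sets_def)
    qed (use q in auto)
    then show "vaught_definable L p (\<lambda>M. if M \<in> Mod L - S then q else 0)"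
      by (rule vaught_definable_cong) (use q in auto)
  qed
  show "(\<Union>i. S i) \<in> vaught_sets L p" if S: "range S \<subseteq> vaught_sets L p" for S :: "nat \<Rightarrow> _"
    unfolding vaught_sets_def
  proof (intro CollectI conjI ballI)
    have Sn: "S n \<in> vaught_sets L p" for n using S by blast
    then have "range S \<subseteq> sets ?B" by (auto simp: vaught_sets_def)
    then show "(\<Union>i. S i) \<in> sets ?B" by (rule sets.countable_UN)
    fix q :: real assume q: "q \<in> {0..1}"
    show "vaught_definable L p (\<lambda>M. if M \<in> (\<Union>i. S i) then q else 0)"
    proof (rule vaught_definable_Sup)
      show "vaught_definable L p (\<lambda>M. if M \<in> S n then q else 0)" for n
        using Sn q by (simp add: vaught_sets_def)
    qed (use q in auto)
  qed
qed

section \<open>Reduction to countably many coordinates\<close>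

text \<open>Balls with centres \<open>p j\<close> and radii \<open>1 / (n + 1)\<close> form a
  countable base. The criterion is made for function symbols: their values are points, of which
  formulas can express only distances.\<close>

lemma measurable_dist_dense:
  fixes p :: "nat \<Rightarrow> 'a::metric_space"
  assumes dense: "closure (range p) = UNIV"
    and d: "\<And>j. (\<lambda>x. dist (f x) (p j)) \<in> borel_measurable M"
  shows "f \<in> borel_measurable M"
proof (rule borel_measurableI)
  fix S :: "'a set" assume "open S"
  define B where "B = (\<lambda>(j, n). ball (p j) (inverse (real (Suc n))))"
  define J where "J = {x. B x \<subseteq> S}"
  have "S = \<Union>(B ` J)"
  proof
    show "S \<subseteq> \<Union>(B ` J)"
    proof
      fix x assume "x \<in> S"
      then obtain e where e: "e > 0" "ball x e \<subseteq> S" using \<open>open S\<close> open_contains_ball by blast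
      obtain n where n: "inverse (real (Suc n)) < e / 2" using reals_Archimedean[of "e / 2"] e(1) by auto
      have "x \<in> closure (range p)" using dense by simp
      then obtain j where j: "dist (p j) x < inverse (real (Suc n))"
        unfolding closure_approachable by (auto elim!: allE[of _ "inverse (real (Suc n))"])
      have "B (j, n) \<subseteq> ball x e"
      proof
        fix y assume "y \<in> B (j, n)"
        then show "y \<in> ball x e"
          using dist_triangle[of x y "p j"] j n by (simp add: B_def dist_commute)
      qed
      then have "(j, n) \<in> J" using e(2) unfolding J_def by blast
      moreover have "x \<in> B (j, n)" using j by (simp add: B_def)
      ultimately show "x \<in> \<Union>(B ` J)" by blast
    qed
  qed (auto simp: J_def)
  then have "f -` S \<inter> space M = (\<Union>x\<in>J. {y \<in> space M. f y \<in> B x})" by auto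
  moreover have "{y \<in> space M. f y \<in> B x} \<in> sets M" for x
  proof -
    obtain j n where x: "x = (j, n)" by fastforce
    have "{y \<in> space M. dist (f y) (p j) < inverse (real (Suc n))} \<in> sets M"
      using d[of j] by measurable
    then show ?thesis by (simp add: x B_def dist_commute)
  qed
  then have "(\<Union>x\<in>J. {y \<in> space M. f y \<in> B x}) \<in> sets M"
    by (intro sets.countable_UN'') auto
  ultimately show "f -` S \<inter> space M \<in> sets M" by simp
qed

lemma dense_tuple_approx:
  fixes p :: "nat \<Rightarrow> 'a::metric_space"
  assumes dense: "closure (range p) = UNIV"
  obtains c :: "nat \<Rightarrow> nat list" where "\<And>n. length (c n) = length xs"
    "(\<lambda>n. dist_max (map p (c n)) xs) \<longlonglongrightarrow> 0"
proof -
  obtain s where s: "\<And>x. (\<lambda>n. p (s x n)) \<longlonglongrightarrow> x" using dense_range_sequence[OF dense] by metis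
  have "(\<lambda>n. max0 (map (\<lambda>x. dist (p (s x n)) x) xs)) \<longlonglongrightarrow> 0"
  proof (induction xs)
    case (Cons x xs)
    have "(\<lambda>n. dist (p (s x n)) x) \<longlonglongrightarrow> 0" by (rule iffD1[OF tendsto_dist_iff s])
    then have "(\<lambda>n. max (dist (p (s x n)) x) (max0 (map (\<lambda>x. dist (p (s x n)) x) xs))) \<longlonglongrightarrow> max 0 0"
      using Cons by (rule tendsto_max)
    then show ?case by simp
  qed simp
  moreover have "dist_max (map p (map (\<lambda>x. s x n) xs)) xs = max0 (map (\<lambda>x. dist (p (s x n)) x) xs)" for n
    using dist_max_map[of "\<lambda>x. p (s x n)" xs "\<lambda>x. x"] by (simp add: comp_def)
  ultimately show ?thesis by (intro that[of "\<lambda>n. map (\<lambda>x. s x n) xs"]) simp_all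
qed

lemma dist_max_nonneg: "0 \<le> dist_max xs ys"
  unfolding dist_max_def by (rule max0_nonneg)

text \<open>The modulus is shared by the whole family, so the error at the \<open>m\<close>-th
  approximating tuple is bounded independently of \<open>y\<close>. Continuity and equality of
  interpretations thereby reduce to tuples from \<open>p\<close>.\<close>

lemma uniform_limit_dense_tuples:
  fixes F :: "'y \<Rightarrow> 'a::metric_space list \<Rightarrow> 'b::metric_space"
  assumes \<omega>: "is_modulus \<omega>"
    and F: "\<And>y xs ys. y \<in> C \<Longrightarrow> length xs = n \<Longrightarrow> length ys = n \<Longrightarrow>
      dist (F y xs) (F y ys) \<le> \<omega> (dist_max xs ys)"
    and xs: "length xs = n" and c: "\<And>m. length (c m) = n" "(\<lambda>m. dist_max (c m) xs) \<longlonglongrightarrow> 0"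
  shows "uniform_limit C (\<lambda>m y. F y (c m)) (\<lambda>y. F y xs) sequentially"
proof (rule uniform_limitI)
  fix e :: real assume "e > 0"
  then obtain \<delta> where \<delta>: "\<delta> > 0" "\<And>t. 0 \<le> t \<Longrightarrow> t < \<delta> \<Longrightarrow> \<omega> t < e"
    using is_modulus_small[OF \<omega>] by metis
  have "\<forall>\<^sub>F m in sequentially. dist_max (c m) xs < \<delta>"
    using c(2) \<delta>(1) by (rule order_tendstoD(2))
  then show "\<forall>\<^sub>F m in sequentially. \<forall>y\<in>C. dist (F y (c m)) (F y xs) < e"
    by eventually_elim (use F c(1) xs \<delta>(2) dist_max_nonneg in \<open>blast intro: le_less_trans\<close>)
qed

lemma continuous_on_dense_tuples:
  fixes p :: "nat \<Rightarrow> 'a::metric_space" and F :: "'y::topological_space \<Rightarrow> 'a list \<Rightarrow> 'b::metric_space"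
  assumes dense: "closure (range p) = UNIV" and \<omega>: "is_modulus \<omega>"
    and F: "\<And>y xs ys. y \<in> C \<Longrightarrow> length xs = n \<Longrightarrow> length ys = n \<Longrightarrow>
      dist (F y xs) (F y ys) \<le> \<omega> (dist_max xs ys)"
    and cont: "\<And>is. length is = n \<Longrightarrow> continuous_on C (\<lambda>y. F y (map p is))"
    and xs: "length xs = n"
  shows "continuous_on C (\<lambda>y. F y xs)"
proof -
  obtain c where c: "\<And>m. length (c m) = length xs" "(\<lambda>m. dist_max (map p (c m)) xs) \<longlonglongrightarrow> 0"
    by (rule dense_tuple_approx[OF dense, of xs]) (rule that)
  have "uniform_limit C (\<lambda>m y. F y (map p (c m))) (\<lambda>y. F y xs) sequentially"
    by (rule uniform_limit_dense_tuples[OF \<omega> F xs _ c(2)]) (simp_all add: c(1) xs)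
  moreover have "continuous_on C (\<lambda>y. F y (map p (c m)))" for m
    by (rule cont) (simp add: c(1) xs)
  ultimately show ?thesis
    by (intro uniform_limit_theorem[where F = sequentially and f = "\<lambda>m y. F y (map p (c m))"]) auto
qed

lemma eq_on_dense_tuples:
  fixes p :: "nat \<Rightarrow> 'a::metric_space" and F F' :: "'a list \<Rightarrow> 'b::metric_space"
  assumes dense: "closure (range p) = UNIV" and \<omega>: "is_modulus \<omega>"
    and F: "\<And>xs ys. length xs = n \<Longrightarrow> length ys = n \<Longrightarrow> dist (F xs) (F ys) \<le> \<omega> (dist_max xs ys)"
    and F': "\<And>xs ys. length xs = n \<Longrightarrow> length ys = n \<Longrightarrow> dist (F' xs) (F' ys) \<le> \<omega> (dist_max xs ys)"
    and eq: "\<And>is. length is = n \<Longrightarrow> F (map p is) = F' (map p is)"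
    and xs: "length xs = n"
  shows "F xs = F' xs"
proof -
  obtain c where c: "\<And>m. length (c m) = length xs" "(\<lambda>m. dist_max (map p (c m)) xs) \<longlonglongrightarrow> 0"
    by (rule dense_tuple_approx[OF dense, of xs]) (rule that)
  have lim: "(\<lambda>m. G (map p (c m))) \<longlonglongrightarrow> G xs"
    if "\<And>xs ys. length xs = n \<Longrightarrow> length ys = n \<Longrightarrow> dist (G xs) (G ys) \<le> \<omega> (dist_max xs ys)"
    for G :: "'a list \<Rightarrow> 'b"
  proof -
    \<comment> \<open>A one-point parameter space turns the uniform limit into an ordinary
      one.\<close>
    have "uniform_limit UNIV (\<lambda>m (_::unit). G (map p (c m))) (\<lambda>_. G xs) sequentially"
      by (rule uniform_limit_dense_tuples[OF \<omega> that xs _ c(2)]) (simp_all add: c(1) xs)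
    then show ?thesis by (rule tendsto_uniform_limitI[where x = "()"]) simp
  qed
  have "(\<lambda>m. F (map p (c m))) \<longlonglongrightarrow> F xs" by (rule lim) (rule F)
  moreover have "(\<lambda>m. F' (map p (c m))) \<longlonglongrightarrow> F' xs" by (rule lim) (rule F')
  then have "(\<lambda>m. F (map p (c m))) \<longlonglongrightarrow> F' xs" by (simp add: eq c(1) xs)
  ultimately show ?thesis by (rule LIMSEQ_unique)
qed

section \<open>Generating sets given by atomic formulas\<close>

lemma vaught_sets_atomic:
  fixes L :: "('f, 'r) language" and p :: "nat \<Rightarrow> 'u::urysohn_sphere"
    and W :: "('f, 'r, 'u) struct \<Rightarrow> (nat \<Rightarrow> 'u) \<Rightarrow> real"
  assumes L: "is_language L"
    and \<psi>: "\<And>v. is_formula L (\<psi> v)" "\<And>v. fv (\<psi> v) \<subseteq> {v..<v + l0}"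
    and val: "\<And>M v e. M \<in> Mod L \<Longrightarrow> fm_value M (\<psi> v) e = W M (\<lambda>i. e (v + i))"
    and unif: "\<And>M \<epsilon>. M \<in> Mod L \<Longrightarrow> \<epsilon> > 0 \<Longrightarrow>
      \<exists>\<delta>>0. \<forall>w w'. tuple_dist l0 w w' < \<delta> \<longrightarrow> \<bar>W M w - W M w'\<bar> < \<epsilon>"
    and act: "\<And>M g. M \<in> Mod L \<Longrightarrow> g \<in> isometries \<Longrightarrow> W (act L g M) p = W M (\<lambda>i. inv g (p i))"
    and cont: "continuous_on UNIV (\<lambda>M. W M p)"
  shows "{M \<in> Mod L. s < W M p} \<in> vaught_sets L p"
  unfolding vaught_sets_def
proof (intro CollectI conjI ballI)
  have "(\<lambda>M. W M p) \<in> borel_measurable borel"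
    by (rule borel_measurable_continuous_onI[OF cont])
  then have "{M \<in> space borel. s < W M p} \<in> sets borel" by measurable
  then have "{M. s < W M p} \<in> sets borel" by simp
  then have "Mod L \<inter> {M. s < W M p} \<in> sets (restrict_space borel (Mod L))"
    unfolding sets_restrict_space by (rule imageI)
  moreover have "Mod L \<inter> {M. s < W M p} = {M \<in> Mod L. s < W M p}" by blast
  ultimately show "{M \<in> Mod L. s < W M p} \<in> sets (restrict_space borel (Mod L))" by simp
  fix q :: real assume q: "q \<in> {0..1}"
  have "vaught_definable L p (\<lambda>M. if s < W M p then q else 0)"
    by (rule vaught_definable_atomic_indicator[OF L \<psi> val unif act]) (use q in auto)
  then show "vaught_definable L p (\<lambda>M. if M \<in> {M \<in> Mod L. s < W M p} then q else 0)"
    by (rule vaught_definable_cong) (use q in auto)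
qed

lemma vaught_sets_rel:
  fixes L :: "('f, 'r) language" and p :: "nat \<Rightarrow> 'u::urysohn_sphere"
  assumes L: "is_language L" and r: "r \<in> rels L" and js: "length js = rel_arity L r"
  shows "{M \<in> Mod L. s < snd M r (map p js)} \<in> vaught_sets L p"
proof -
  obtain l0 where l0: "\<And>i. i \<in> set js \<Longrightarrow> i < l0"
    using finite_nat_set_iff_bounded[of "set js"] by auto
  have mod: "is_modulus (rel_modulus L r)" using L r by (simp add: is_language_def)
  show ?thesis
  proof (rule vaught_sets_atomic[where W = "\<lambda>M w. snd M r (map w js)" and ?l0.0 = l0
        and \<psi> = "\<lambda>v. Rel r (map (\<lambda>i. Var (v + i)) js)", OF L])
    show "is_formula L (Rel r (map (\<lambda>i. Var (v + i)) js))" for v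
      using r js by (simp add: list_all_iff)
    show "fv (Rel r (map (\<lambda>i. Var (v + i)) js)) \<subseteq> {v..<v + l0}" for v
      using l0 by auto
    show "fm_value M (Rel r (map (\<lambda>i. Var (v + i)) js)) e = snd M r (map (\<lambda>i. e (v + i)) js)"
      for M :: "('f, 'r, 'u) struct" and v e by (simp add: comp_def)
    show "\<exists>\<delta>>0. \<forall>w w'. tuple_dist l0 w w' < \<delta> \<longrightarrow> \<bar>snd M r (map w js) - snd M r (map w' js)\<bar> < \<epsilon>"
      if M: "M \<in> Mod L" and "\<epsilon> > 0" for M :: "('f, 'r, 'u) struct" and \<epsilon>
    proof -
      obtain \<delta> where \<delta>: "\<delta> > 0" "\<And>(xs :: nat list) a b. length xs = rel_arity L r \<Longrightarrow>
          (\<And>x. x \<in> set xs \<Longrightarrow> dist (a x) (b x) < \<delta>) \<Longrightarrow> dist (snd M r (map a xs)) (snd M r (map b xs)) < \<epsilon>"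
        by (rule modulus_composition_small[where F = "snd M r", OF mod Mod_rel[OF M r] \<open>\<epsilon> > 0\<close>]) auto
      have "\<bar>snd M r (map w js) - snd M r (map w' js)\<bar> < \<epsilon>" if "tuple_dist l0 w w' < \<delta>" for w w'
      proof -
        have "dist (w i) (w' i) < \<delta>" if "i \<in> set js" for i
          using tuple_dist_upper[OF l0[OF that], of w w'] \<open>tuple_dist l0 w w' < \<delta>\<close> by simp
        then show ?thesis using \<delta>(2)[OF js, of w w'] by (simp add: dist_real_def)
      qed
      then show ?thesis using \<delta>(1) by blast
    qed
    show "snd (act L g M) r (map p js) = snd M r (map (\<lambda>i. inv g (p i)) js)"
      for M :: "('f, 'r, 'u) struct" and g
      using r js by (simp add: act_def comp_def)
    show "continuous_on UNIV (\<lambda>M :: ('f, 'r, 'u) struct. snd M r (map p js))"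
      by (rule continuous_on_product_then_coordinatewise[where f = "\<lambda>M. snd M r"])
        (rule continuous_on_snd_apply)
  qed
qed

text \<open>The point \<open>p j\<close> from which the distance is measured is treated as one more
  entry of the tuple, so that the condition is atomic with parameters from \<open>p\<close> only and
  is moved correctly by the action.\<close>

lemma vaught_sets_fun:
  fixes L :: "('f, 'r) language" and p :: "nat \<Rightarrow> 'u::urysohn_sphere"
  assumes L: "is_language L" and f: "f \<in> funs L" and js: "length js = fun_arity L f"
  shows "{M \<in> Mod L. s < dist (fst M f (map p js)) (p j)} \<in> vaught_sets L p"
proof -
  obtain l1 where l1: "\<And>i. i \<in> set js \<Longrightarrow> i < l1"
    using finite_nat_set_iff_bounded[of "set js"] by auto
  \<comment> \<open>\<open>Suc j\<close> makes the initial part of the tuple reach the entry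
    \<open>p j\<close>.\<close>
  define l0 where "l0 = max l1 (Suc j)"
  have l0: "i < l0" if "i \<in> set js" for i using l1[OF that] by (simp add: l0_def)
  have jl0: "j < l0" by (simp add: l0_def)
  have mod: "is_modulus (fun_modulus L f)" using L f by (simp add: is_language_def)
  show ?thesis
  proof (rule vaught_sets_atomic[where W = "\<lambda>M w. dist (fst M f (map w js)) (w j)" and ?l0.0 = l0
        and \<psi> = "\<lambda>v. Dist (Fn f (map (\<lambda>i. Var (v + i)) js)) (Var (v + j))", OF L])
    show "is_formula L (Dist (Fn f (map (\<lambda>i. Var (v + i)) js)) (Var (v + j)))" for v
      using f js by (simp add: list_all_iff)
    show "fv (Dist (Fn f (map (\<lambda>i. Var (v + i)) js)) (Var (v + j))) \<subseteq> {v..<v + l0}" for v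
      using l0 jl0 by auto
    show "fm_value M (Dist (Fn f (map (\<lambda>i. Var (v + i)) js)) (Var (v + j))) e =
        dist (fst M f (map (\<lambda>i. e (v + i)) js)) (e (v + j))"
      for M :: "('f, 'r, 'u) struct" and v e by (simp add: comp_def)
    show "\<exists>\<delta>>0. \<forall>w w'. tuple_dist l0 w w' < \<delta> \<longrightarrow>
        \<bar>dist (fst M f (map w js)) (w j) - dist (fst M f (map w' js)) (w' j)\<bar> < \<epsilon>"
      if M: "M \<in> Mod L" and "\<epsilon> > 0" for M :: "('f, 'r, 'u) struct" and \<epsilon>
    proof -
      have "\<epsilon> / 2 > 0" using \<open>\<epsilon> > 0\<close> by simp
      obtain \<delta> where \<delta>: "\<delta> > 0" "\<And>(xs :: nat list) a b. length xs = fun_arity L f \<Longrightarrow>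
          (\<And>x. x \<in> set xs \<Longrightarrow> dist (a x) (b x) < \<delta>) \<Longrightarrow> dist (fst M f (map a xs)) (fst M f (map b xs)) < \<epsilon> / 2"
        by (rule modulus_composition_small[where F = "fst M f", OF mod Mod_fun[OF M f] \<open>\<epsilon> / 2 > 0\<close>]) auto
      have "\<bar>dist (fst M f (map w js)) (w j) - dist (fst M f (map w' js)) (w' j)\<bar> < \<epsilon>"
        if "tuple_dist l0 w w' < min \<delta> (\<epsilon> / 2)" for w w'
      proof -
        have d: "dist (w i) (w' i) < \<delta>" "dist (w i) (w' i) < \<epsilon> / 2" if "i < l0" for i
          using tuple_dist_upper[OF that, of w w'] \<open>tuple_dist l0 w w' < min \<delta> (\<epsilon> / 2)\<close> by simp_all
        have "dist (fst M f (map w js)) (fst M f (map w' js)) < \<epsilon> / 2"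
          by (rule \<delta>(2)[OF js]) (rule d(1)[OF l0])
        moreover have "dist (w j) (w' j) < \<epsilon> / 2" by (rule d(2)[OF jl0])
        moreover have "\<bar>dist a b - dist a' b'\<bar> \<le> dist a a' + dist b b'" for a b a' b' :: 'u
          using dist_triangle[of a b a'] dist_triangle[of a' b b'] dist_triangle[of a' b' a]
            dist_triangle[of a b' b] by (simp add: dist_commute abs_le_iff)
        from this[of "fst M f (map w js)" "w j" "fst M f (map w' js)" "w' j"]
        have "\<bar>dist (fst M f (map w js)) (w j) - dist (fst M f (map w' js)) (w' j)\<bar> \<le>
          dist (fst M f (map w js)) (fst M f (map w' js)) + dist (w j) (w' j)" .
        ultimately show ?thesis by linarith
      qed
      then show ?thesis using \<delta>(1) \<open>\<epsilon> / 2 > 0\<close> by (intro exI[of _ "min \<delta> (\<epsilon> / 2)"]) simp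
    qed
    show "dist (fst (act L g M) f (map p js)) (p j) = dist (fst M f (map (\<lambda>i. inv g (p i)) js)) (inv g (p j))"
      if "g \<in> isometries" for M :: "('f, 'r, 'u) struct" and g
    proof -
      \<comment> \<open>The isometry that the action applies to the value is moved to the other
        argument as its inverse.\<close>
      have "dist (g x) (p j) = dist x (inv g (p j))" for x
        unfolding dist_commute[of "g x"] dist_commute[of x] by (rule dist_inv_isometry[OF that, symmetric])
      then show ?thesis using f js by (simp add: act_def comp_def)
    qed
    show "continuous_on UNIV (\<lambda>M :: ('f, 'r, 'u) struct. dist (fst M f (map p js)) (p j))"
      by (intro continuous_on_dist continuous_on_const
          continuous_on_product_then_coordinatewise[where f = "\<lambda>M. fst M f"] continuous_on_fst_apply)
  qed
qed

text \<open>
  A structure is coded by the values of the symbols at tuples from \<open>p\<close>. By equicontinuity this is a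
  homeomorphic embedding of the space of structures into a countable power, where Borel sets are
  generated by coordinates.
\<close>

lemma borel_vaught_sets:
  fixes L :: "('f, 'r) language" and p :: "nat \<Rightarrow> 'u::urysohn_sphere"
  assumes L: "countable_language L" and dense: "closure (range p) = UNIV"
    and S: "S \<in> sets (borel :: ('f, 'r, 'u) struct measure)"
  shows "Mod L \<inter> S \<in> vaught_sets L p"
proof -
  have lang: "is_language L" and cf: "countable (funs L)" and cr: "countable (rels L)"
    using L by (auto simp: countable_language_def)
  define fn where "fn = from_nat_into (funs L)"
  define rn where "rn = from_nat_into (rels L)"
  have fn: "\<exists>n. fn n = f" if "f \<in> funs L" for f
    unfolding fn_def using from_nat_into_surj[OF cf that] .
  have rn: "\<exists>n. rn n = r" if "r \<in> rels L" for r
    unfolding rn_def using from_nat_into_surj[OF cr that] .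
  define E :: "('f, 'r, 'u) struct \<Rightarrow> (nat \<times> nat list \<Rightarrow> 'u) \<times> (nat \<times> nat list \<Rightarrow> real)" where
    "E M = ((\<lambda>x. fst M (fn (fst x)) (map p (snd x))), (\<lambda>x. snd M (rn (fst x)) (map p (snd x))))" for M
  define B where "B = sigma (Mod L) (vaught_sets L p)"
  interpret vs: sigma_algebra "Mod L" "vaught_sets L p"
    by (rule sigma_algebra_vaught_sets[OF lang dense])
  have sets_B: "sets B = vaught_sets L p"
    unfolding B_def by (simp add: sets_measure_of vs.space_closed vs.sigma_sets_eq)
  have space_B: "space B = Mod L"
    unfolding B_def by (simp add: space_measure_of vs.space_closed)
  have mod_f: "is_modulus (fun_modulus L f)" if "f \<in> funs L" for f
    using lang that by (simp add: is_language_def)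
  have mod_r: "is_modulus (rel_modulus L r)" if "r \<in> rels L" for r
    using lang that by (simp add: is_language_def)

  have "(\<lambda>M. fst M (fn n) (map p js)) \<in> borel_measurable B" for n js
  proof (cases "fn n \<in> funs L \<and> length js = fun_arity L (fn n)")
    case True
    show ?thesis
    proof (rule measurable_dist_dense[OF dense])
      fix j show "(\<lambda>M. dist (fst M (fn n) (map p js)) (p j)) \<in> borel_measurable B"
        unfolding borel_measurable_iff_greater space_B sets_B
        using vaught_sets_fun[OF lang, of "fn n"] True by blast
    qed
  next
    \<comment> \<open>\<open>fn n\<close> can lie outside the language only if \<open>funs L\<close>
      is empty. In that case, and for tuples of the wrong length, extensionality makes the
      coordinate constant on \<open>Mod L\<close>.\<close>
    case False
    then have "fst M (fn n) (map p js) = (if fn n \<in> funs L then undefined else undefined (map p js))"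
      if "M \<in> space B" for M
      using Mod_undefined(1,2)[of M L] that unfolding space_B by auto
    then show ?thesis by (subst measurable_cong) auto
  qed
  moreover have "(\<lambda>M. snd M (rn n) (map p js)) \<in> borel_measurable B" for n js
  proof (cases "rn n \<in> rels L \<and> length js = rel_arity L (rn n)")
    case True
    then show ?thesis
      unfolding borel_measurable_iff_greater space_B sets_B
      using vaught_sets_rel[OF lang, of "rn n"] by blast
  next
    case False
    then have "snd M (rn n) (map p js) = (if rn n \<in> rels L then undefined else undefined (map p js))"
      if "M \<in> space B" for M
      using Mod_undefined(3,4)[of M L] that unfolding space_B by auto
    then show ?thesis by (subst measurable_cong) auto
  qed
  \<comment> \<open>The coordinates of a code are indexed by countable sets, so measurability of
    each of them gives measurability into the product.\<close>
  ultimately have E_meas: "E \<in> borel_measurable B"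
    unfolding E_def by (intro borel_measurable_Pair measurable_coordinatewise_then_product)

  have inj: "M = M'" if M: "M \<in> Mod L" and M': "M' \<in> Mod L" and eq: "E M = E M'" for M M'
  proof (rule prod_eqI; intro ext)
    fix f xs
    show "fst M f xs = fst M' f xs"
    proof (cases "f \<in> funs L \<and> length xs = fun_arity L f")
      case True
      then have f: "f \<in> funs L" and xs: "length xs = fun_arity L f" by auto
      obtain n where n: "fn n = f" using fn[OF f] by blast
      have "fst M f (map p js) = fst M' f (map p js)" for js
        using fun_cong[OF arg_cong[OF eq, of fst], of "(n, js)"] by (simp add: E_def n)
      then show ?thesis
        by (intro eq_on_dense_tuples[OF dense mod_f[OF f] Mod_fun[OF M f] Mod_fun[OF M' f] _ xs])
    next
      case False
      then show ?thesis using Mod_undefined(1,2)[OF M] Mod_undefined(1,2)[OF M'] by metis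
    qed
  next
    fix r xs
    show "snd M r xs = snd M' r xs"
    proof (cases "r \<in> rels L \<and> length xs = rel_arity L r")
      case True
      then have r: "r \<in> rels L" and xs: "length xs = rel_arity L r" by auto
      obtain n where n: "rn n = r" using rn[OF r] by blast
      have "snd M r (map p js) = snd M' r (map p js)" for js
        using fun_cong[OF arg_cong[OF eq, of snd], of "(n, js)"] by (simp add: E_def n)
      then show ?thesis
        by (intro eq_on_dense_tuples[OF dense mod_r[OF r] Mod_rel[OF M r] Mod_rel[OF M' r] _ xs])
    next
      case False
      then show ?thesis using Mod_undefined(3,4)[OF M] Mod_undefined(3,4)[OF M'] by metis
    qed
  qed
  define G where "G y = (SOME M. M \<in> Mod L \<and> E M = y)" for y
  have G: "G y \<in> Mod L" "E (G y) = y" if "y \<in> E ` Mod L" for y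
  proof -
    have "\<exists>M. M \<in> Mod L \<and> E M = y" using that by blast
    from someI_ex[OF this] show "G y \<in> Mod L" "E (G y) = y" unfolding G_def by auto
  qed
  have GE: "G (E M) = M" if "M \<in> Mod L" for M
    by (rule inj) (use G[of "E M"] that in auto)
  let ?C = "E ` Mod L"
  have "continuous_on ?C (\<lambda>y. fst (G y) f xs)" for f xs
  proof (cases "f \<in> funs L \<and> length xs = fun_arity L f")
    case True
    then have f: "f \<in> funs L" and xs: "length xs = fun_arity L f" by auto
    obtain n where n: "fn n = f" using fn[OF f] by blast
    have c: "continuous_on ?C (\<lambda>y. fst (G y) f (map p js))" for js
    proof (rule continuous_on_eq)
      show "continuous_on ?C (\<lambda>y. fst y (n, js))"
        by (rule continuous_on_fst_apply)
      show "fst y (n, js) = fst (G y) f (map p js)" if "y \<in> ?C" for y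
        using fun_cong[OF arg_cong[OF G(2)[OF that], of fst], of "(n, js)"] by (simp add: E_def n)
    qed
    show ?thesis
      by (rule continuous_on_dense_tuples[OF dense mod_f[OF f] Mod_fun[OF G(1) f] c xs])
  next
    case False
    then have eq: "fst (G y) f xs = (if f \<in> funs L then undefined else undefined xs)" if "y \<in> ?C" for y
      using Mod_undefined(1,2)[OF G(1)[OF that]] by auto
    show ?thesis
      by (rule continuous_on_eq[OF continuous_on_const]) (simp only: eq)
  qed
  moreover have "continuous_on ?C (\<lambda>y. snd (G y) r xs)" for r xs
  proof (cases "r \<in> rels L \<and> length xs = rel_arity L r")
    case True
    then have r: "r \<in> rels L" and xs: "length xs = rel_arity L r" by auto
    obtain n where n: "rn n = r" using rn[OF r] by blast
    have c: "continuous_on ?C (\<lambda>y. snd (G y) r (map p js))" for js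
    proof (rule continuous_on_eq)
      show "continuous_on ?C (\<lambda>y. snd y (n, js))"
        by (rule continuous_on_snd_apply)
      show "snd y (n, js) = snd (G y) r (map p js)" if "y \<in> ?C" for y
        using fun_cong[OF arg_cong[OF G(2)[OF that], of snd], of "(n, js)"] by (simp add: E_def n)
    qed
    show ?thesis
      by (rule continuous_on_dense_tuples[OF dense mod_r[OF r] Mod_rel[OF G(1) r] c xs])
  next
    case False
    then have eq: "snd (G y) r xs = (if r \<in> rels L then undefined else undefined xs)" if "y \<in> ?C" for y
      using Mod_undefined(3,4)[OF G(1)[OF that]] by auto
    show ?thesis
      by (rule continuous_on_eq[OF continuous_on_const]) (simp only: eq)
  qed
  ultimately have "continuous_on ?C (\<lambda>y. (fst (G y), snd (G y)))"
    by (intro continuous_on_Pair continuous_on_coordinatewise_then_product)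
  then have G_cont: "continuous_on ?C G" by simp

  \<comment> \<open>Continuity of the decoding \<open>G\<close> on the image makes the trace of an
    open set on \<open>Mod L\<close> the preimage under \<open>E\<close> of an open set
    \<open>T\<close>, which lies in the sigma-algebra. Measurability of the identity then extends
    this to all Borel sets.\<close>
  have "(\<lambda>M. M) \<in> borel_measurable B"
  proof (rule borel_measurableI)
    fix U :: "('f, 'r, 'u) struct set" assume "open U"
    then have "openin (top_of_set ?C) (?C \<inter> G -` U)"
      by (rule continuous_openin_preimage_gen[OF G_cont])
    then obtain T where T: "open T" "?C \<inter> G -` U = ?C \<inter> T" unfolding openin_open by blast
    have "M \<in> U \<longleftrightarrow> E M \<in> T" if "M \<in> Mod L" for M
    proof -
      have "E M \<in> ?C \<inter> G -` U \<longleftrightarrow> E M \<in> ?C \<inter> T" using T(2) by simp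
      then show ?thesis using that GE[OF that] by simp
    qed
    then have "(\<lambda>M. M) -` U \<inter> space B = E -` T \<inter> space B"
      unfolding space_B by auto
    then show "(\<lambda>M. M) -` U \<inter> space B \<in> sets B"
      using measurable_sets[OF E_meas, of T] T(1) by simp
  qed
  from measurable_sets[OF this S] show ?thesis
    unfolding space_B sets_B by (simp add: Int_commute)
qed

text \<open>A rational number fits between \<open>s\<close> and \<open>A M\<close>, so
  \<open>A\<close> is the countable supremum over rational \<open>q\<close> of \<open>q\<close>
  times the indicator of \<open>A > q\<close>.\<close>

lemma vaught_definable_borel:
  fixes L :: "('f, 'r) language" and p :: "nat \<Rightarrow> 'u::urysohn_sphere"
  assumes L: "countable_language L" and dense: "closure (range p) = UNIV"
    and A: "borel_grey_subset L A"
  shows "vaught_definable L p A"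
proof (rule vaught_definable_Sup)
  let ?q = "\<lambda>n. real_of_rat (from_nat_into UNIV n)"
  let ?A = "\<lambda>n M. if ?q n \<in> {0..1} \<and> ?q n < A M then ?q n else 0"
  have meas: "A \<in> borel_measurable (restrict_space borel (Mod L))"
    and A01: "\<And>M. M \<in> Mod L \<Longrightarrow> A M \<in> {0..1}"
    using A by (auto simp: borel_grey_subset_def)
  show "vaught_definable L p (?A n)" for n
  proof -
    \<comment> \<open>Rationals outside the unit interval get height 0 and contribute the zero
      function.\<close>
    define q where "q = (if ?q n \<in> {0..1} then ?q n else 0)"
    have "{M \<in> space (restrict_space borel (Mod L)). ?q n < A M} \<in> sets (restrict_space borel (Mod L))"
      using meas by measurable
    then have "{M \<in> Mod L. ?q n < A M} \<in> sets (restrict_space borel (Mod L))"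
      by (simp add: space_restrict_space)
    then obtain S where S: "S \<in> sets borel" "{M \<in> Mod L. ?q n < A M} = Mod L \<inter> S"
      unfolding sets_restrict_space by blast
    have "Mod L \<inter> S \<in> vaught_sets L p" by (rule borel_vaught_sets[OF L dense S(1)])
    then have "vaught_definable L p (\<lambda>M. if M \<in> {M \<in> Mod L. ?q n < A M} then q else 0)"
      unfolding S(2)[symmetric] vaught_sets_def by (simp add: q_def)
    then show ?thesis
      by (rule vaught_definable_cong) (auto simp: q_def)
  qed
  show "?A n M \<le> 1" for n M by simp
  fix M :: "('f, 'r, 'u) struct" and s :: real assume M: "M \<in> Mod L" and s: "0 \<le> s"
  show "s < A M \<longleftrightarrow> (\<exists>n. s < ?A n M)"
  proof
    assume "s < A M"
    then obtain x where x: "s < real_of_rat x" "real_of_rat x < A M"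
      using of_rat_dense by blast
    obtain n where n: "from_nat_into UNIV n = x"
      using from_nat_into_surj[of "UNIV :: rat set" x] by auto
    have "A M \<le> 1" using A01[OF M] by simp
    then have "real_of_rat x \<in> {0..1}" unfolding atLeastAtMost_iff using x s by linarith
    then show "\<exists>n. s < ?A n M" using x by (intro exI[of _ n]) (simp only: n if_True simp_thms)
  next
    assume "\<exists>n. s < ?A n M"
    then show "s < A M" using s by (auto split: if_splits)
  qed
qed

theorem theorem3p2:
  fixes L :: "('f, 'r) language"
    and p :: "nat \<Rightarrow> 'u::urysohn_sphere"
    and k :: nat
    and A :: "('f, 'r, 'u) struct \<Rightarrow> real"
    and N :: nat
  assumes "countable_language L"
    and "closure (range p) = UNIV"
    and "borel_grey_subset L A"
    and "N > 0"
  shows "\<exists>\<phi>. is_formula L \<phi> \<and> fv \<phi> \<subseteq> {..<k} \<and> lipschitz_fm L (real N) \<phi> \<and>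
    (\<forall>M\<in>Mod L. \<forall>u::'u list. length u = k \<longrightarrow>
      sup_star Iso_topology
        (\<lambda>g. A (act L g M) \<ominus>\<^sub>t real N \<otimes>\<^sub>t dist_max (map (\<lambda>i. inv g (p i)) [0..<k]) u)
      = value_at M \<phi> u)"
proof -
  obtain \<phi> where \<phi>: "is_formula L \<phi>" "fv \<phi> \<subseteq> {0..<0 + k}" "lipschitz_fm L N \<phi>"
    "\<And>(M :: ('f, 'r, 'u) struct) e. M \<in> Mod L \<Longrightarrow> fm_value M \<phi> e = vaught L p A N k M (\<lambda>i. e (0 + i))"
    using vaught_definable_borel[OF assms(1-3)] unfolding vaught_definable_def by blast
  \<comment> \<open>The inner truncation replaces \<open>N * d\<close> by
    \<open>min 1 (N * d)\<close>. Since \<open>a \<le> 1\<close>, both differences truncate to 0 as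
    soon as \<open>N * d \<ge> 1\<close>.\<close>
  have tr: "a \<ominus>\<^sub>t real N \<otimes>\<^sub>t d = trunc (a - N * d)" if "a \<le> 1" "0 \<le> d" for a d :: real
  proof -
    have "0 \<le> N * d" using that(2) by simp
    then show ?thesis using that(1) by (auto simp: tminus_def ttimes_def trunc_def)
  qed
  have "sup_star Iso_topology
        (\<lambda>g. A (act L g M) \<ominus>\<^sub>t real N \<otimes>\<^sub>t dist_max (map (\<lambda>i. inv g (p i)) [0..<k]) u)
      = value_at M \<phi> u" if M: "M \<in> Mod L" and u: "length u = k" for M and u :: "'u list"
  proof -
    have u_map: "u = map ((!) u) [0..<k]" using u map_nth[of u] by simp
    have d: "dist_max (map (\<lambda>i. inv g (p i)) [0..<k]) u = tuple_dist k (\<lambda>i. inv g (p i)) ((!) u)" for g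
      by (subst u_map) (simp only: dist_max_map tuple_dist_def)
    have eq: "A (act L g M) \<ominus>\<^sub>t real N \<otimes>\<^sub>t dist_max (map (\<lambda>i. inv g (p i)) [0..<k]) u =
        trunc (A (act L g M) - N * tuple_dist k (\<lambda>i. inv g (p i)) ((!) u))"
      if "g \<in> isometries" for g
      unfolding d using act_in_Mod[OF that M] assms(3)
      by (intro tr) (auto simp: borel_grey_subset_def tuple_dist_nonneg)
    \<comment> \<open>The two integrands are compared on isometries only; this suffices because
      \<open>sup_star\<close> evaluates them on the space of isometries.\<close>
    then have "{g \<in> topspace Iso_topology. r < A (act L g M) \<ominus>\<^sub>t real N \<otimes>\<^sub>t dist_max (map (\<lambda>i. inv g (p i)) [0..<k]) u} =
        {g \<in> topspace Iso_topology. r < trunc (A (act L g M) - N * tuple_dist k (\<lambda>i. inv g (p i)) ((!) u))}" for r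
      by auto
    then show ?thesis
      unfolding value_at_def \<phi>(4)[OF M] vaught_def sup_star_def by simp
  qed
  then show ?thesis using \<phi>(1-3) by (intro exI[of _ \<phi>]) (auto simp: atLeast0LessThan)
qed

end
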